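(* Let $\mathcal M$ be a von Neumann algebra. There is a unique weak$^*$-topology on $\mathcal M$ which makes the multiplication map of $\mathcal M$ separately continuous.
   Context: A weak$^*$-topology on a Banach space $\mathcal M$ is a topology obtained from a Banach space $X$ and a (not necessarily isometric) Banach space isomorphism $j:\mathcal M\to X'$ by pulling back $\sigma(X',X)$ along $j$. *)

theory Defs
  imports "HOL-Analysis.Analysis" "HOL-Library.Function_Algebras"
begin

section \<open>Complex Banach spaces and weak-star topologies\<close>

text \<open>The space is a subset \<open>X\<close> of the ambient type, so that one can quantify
  existentially over Banach spaces. Nothing is assumed about \<open>N\<close> outside \<open>X\<close>.\<close>

locale complex_banach_space = vector_space smul
  for smul :: "complex \<Rightarrow> 'x::ab_group_add \<Rightarrow> 'x" +
  fixes X :: "'x set" and N :: "'x \<Rightarrow> real"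
  assumes subspace_carrier: "subspace X"
    and norm_nonneg: "x \<in> X \<Longrightarrow> 0 \<le> N x"
    and norm_eq_zero: "x \<in> X \<Longrightarrow> N x = 0 \<longleftrightarrow> x = 0"
    and norm_scale: "x \<in> X \<Longrightarrow> N (smul c x) = cmod c * N x"
    and norm_triangle: "x \<in> X \<Longrightarrow> y \<in> X \<Longrightarrow> N (x + y) \<le> N x + N y"
    and complete: "(\<And>n. s n \<in> X) \<Longrightarrow>
      (\<forall>e>0. \<exists>n0. \<forall>m\<ge>n0. \<forall>n\<ge>n0. N (s m - s n) < e) \<Longrightarrow>
      \<exists>l\<in>X. (\<lambda>n. N (s n - l)) \<longlonglongrightarrow> 0"

text \<open>Functionals on \<open>X\<close> are extended by \<open>0\<close> to the ambient type, so that equality of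
  functionals is equality of functions and the operations of the dual are pointwise.\<close>

definition dual_space ::
  "(complex \<Rightarrow> 'x \<Rightarrow> 'x) \<Rightarrow> 'x set \<Rightarrow> ('x \<Rightarrow> real) \<Rightarrow> ('x::ab_group_add \<Rightarrow> complex) set" where
  "dual_space smul X N = {f.
     (\<forall>x. x \<notin> X \<longrightarrow> f x = 0) \<and>
     (\<forall>x\<in>X. \<forall>y\<in>X. f (x + y) = f x + f y) \<and>
     (\<forall>c. \<forall>x\<in>X. f (smul c x) = c * f x) \<and>
     (\<exists>K. \<forall>x\<in>X. cmod (f x) \<le> K * N x)}"

definition dual_norm :: "'x set \<Rightarrow> ('x \<Rightarrow> real) \<Rightarrow> ('x \<Rightarrow> complex) \<Rightarrow> real" where
  "dual_norm X N f = (SUP x\<in>{x\<in>X. N x \<le> 1}. cmod (f x))"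

definition weak_star_on_dual ::
  "(complex \<Rightarrow> 'x \<Rightarrow> 'x) \<Rightarrow> 'x set \<Rightarrow> ('x \<Rightarrow> real) \<Rightarrow> ('x::ab_group_add \<Rightarrow> complex) topology" where
  "weak_star_on_dual smul X N =
     topology_generated_by {{f \<in> dual_space smul X N. f x \<in> U} | x U. x \<in> X \<and> open U}"

definition banach_isomorphism ::
  "(complex \<Rightarrow> 'a \<Rightarrow> 'a) \<Rightarrow> 'a set \<Rightarrow> ('a \<Rightarrow> real) \<Rightarrow>
   (complex \<Rightarrow> 'b \<Rightarrow> 'b) \<Rightarrow> 'b set \<Rightarrow> ('b \<Rightarrow> real) \<Rightarrow> ('a::ab_group_add \<Rightarrow> 'b::ab_group_add) \<Rightarrow> bool" where
  "banach_isomorphism sE E NE sF F NF j \<longleftrightarrow>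
     bij_betw j E F \<and>
     (\<forall>x\<in>E. \<forall>y\<in>E. j (x + y) = j x + j y) \<and>
     (\<forall>c. \<forall>x\<in>E. j (sE c x) = sF c (j x)) \<and>
     (\<exists>K. \<forall>x\<in>E. NF (j x) \<le> K * NE x) \<and>
     (\<exists>K. \<forall>x\<in>E. NE x \<le> K * NF (j x))"

text \<open>\<open>T\<close> is a weak-star topology on the Banach space \<open>E\<close>, induced by a Banach space \<open>X\<close>
  whose elements have type \<open>'x\<close>. HOL cannot quantify over types inside a formula, hence the
  type argument. A Banach space \<open>X\<close> whose dual is isomorphic to \<open>E\<close> embeds isomorphically into
  the dual of \<open>E\<close>, so every weak-star topology on \<open>E :: 'a set\<close> already arises with
  \<open>'x = 'a \<Rightarrow> complex\<close>.\<close>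

definition weak_star_topology ::
  "'x::ab_group_add itself \<Rightarrow> (complex \<Rightarrow> 'a \<Rightarrow> 'a) \<Rightarrow> 'a set \<Rightarrow> ('a \<Rightarrow> real) \<Rightarrow>
   'a::ab_group_add topology \<Rightarrow> bool" where
  "weak_star_topology (_ :: 'x itself) sE E NE T \<longleftrightarrow>
     (\<exists>(smul :: complex \<Rightarrow> 'x \<Rightarrow> 'x) X N j.
        complex_banach_space smul X N \<and>
        banach_isomorphism sE E NE
          (\<lambda>c f x. c * f x) (dual_space smul X N) (dual_norm X N) j \<and>
        T = pullback_topology E j (weak_star_on_dual smul X N))"


section \<open>Von Neumann algebras\<close>

class complex_hilbert = banach +
  fixes scaleC :: "complex \<Rightarrow> 'a \<Rightarrow> 'a" (infixr \<open>*\<^sub>C\<close> 75)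
    and cinner :: "'a \<Rightarrow> 'a \<Rightarrow> complex"
  assumes scaleC_add_right: "c *\<^sub>C (x + y) = c *\<^sub>C x + c *\<^sub>C y"
    and scaleC_add_left: "(c + d) *\<^sub>C x = c *\<^sub>C x + d *\<^sub>C x"
    and scaleC_scaleC: "c *\<^sub>C d *\<^sub>C x = (c * d) *\<^sub>C x"
    and scaleR_scaleC: "r *\<^sub>R x = complex_of_real r *\<^sub>C x"
    and cinner_commute: "cinner x y = cnj (cinner y x)"
    and cinner_add_left: "cinner (x + y) z = cinner x z + cinner y z"
    and cinner_scaleC_left: "cinner (c *\<^sub>C x) y = c * cinner x y"
    and cinner_self: "cinner x x = complex_of_real ((norm x)\<^sup>2)"

text \<open>The type \<open>'h \<Rightarrow>\<^sub>L 'h\<close> consists of the bounded real-linear operators; the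
  bounded operators on the complex Hilbert space are the complex-linear ones among them.\<close>

definition bounded_ops :: "('h::complex_hilbert \<Rightarrow>\<^sub>L 'h) set" where
  "bounded_ops = {T :: 'h \<Rightarrow>\<^sub>L 'h. \<forall>c x. T (c *\<^sub>C x) = c *\<^sub>C T x}"

definition op_scale :: "complex \<Rightarrow> ('h \<Rightarrow>\<^sub>L 'h) \<Rightarrow> ('h::complex_hilbert \<Rightarrow>\<^sub>L 'h)" where
  "op_scale c T = Blinfun (\<lambda>x. c *\<^sub>C T x)"

definition op_adjoint :: "('h \<Rightarrow>\<^sub>L 'h) \<Rightarrow> ('h::complex_hilbert \<Rightarrow>\<^sub>L 'h)" where
  "op_adjoint T = (THE S :: 'h \<Rightarrow>\<^sub>L 'h. \<forall>x y. cinner (S x) y = cinner x (T y))"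

definition commutant :: "('h \<Rightarrow>\<^sub>L 'h) set \<Rightarrow> ('h::complex_hilbert \<Rightarrow>\<^sub>L 'h) set" where
  "commutant S = {T \<in> bounded_ops. \<forall>A\<in>S. T o\<^sub>L A = A o\<^sub>L T}"

text \<open>A commutant is a unital subalgebra (see below), so this makes \<open>M\<close> a unital
  star-subalgebra of the bounded operators.\<close>

definition von_neumann_algebra :: "('h::complex_hilbert \<Rightarrow>\<^sub>L 'h) set \<Rightarrow> bool" where
  "von_neumann_algebra M \<longleftrightarrow>
     M \<subseteq> bounded_ops \<and> (\<forall>T\<in>M. op_adjoint T \<in> M) \<and> commutant (commutant M) = M"

definition separately_continuous_mult ::
  "('h::complex_hilbert \<Rightarrow>\<^sub>L 'h) set \<Rightarrow> ('h \<Rightarrow>\<^sub>L 'h) topology \<Rightarrow> bool" where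
  "separately_continuous_mult M T \<longleftrightarrow>
     (\<forall>a\<in>M. continuous_map T T (\<lambda>b. a o\<^sub>L b) \<and> continuous_map T T (\<lambda>b. b o\<^sub>L a))"

lemma norm_scaleC: "norm (c *\<^sub>C (x::'h::complex_hilbert)) = cmod c * norm x"
proof -
  have "cinner (c *\<^sub>C x) (c *\<^sub>C x) = c * cnj (c * cinner x x)"
    by (metis cinner_commute cinner_scaleC_left)
  also have "\<dots> = complex_of_real ((cmod c * norm x)\<^sup>2)"
    by (simp add: cinner_self power_mult_distrib complex_norm_square[symmetric] mult.assoc[symmetric]
        del: of_real_power)
  finally have "(norm (c *\<^sub>C x))\<^sup>2 = (cmod c * norm x)\<^sup>2"
    unfolding cinner_self of_real_eq_iff .
  then show ?thesis by (simp add: power2_eq_iff_nonneg)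
qed

lemma op_scale_apply [simp]:
  fixes T :: "'h::complex_hilbert \<Rightarrow>\<^sub>L 'h"
  shows "op_scale c T x = c *\<^sub>C T x"
proof -
  have "bounded_linear (\<lambda>x. c *\<^sub>C T x)"
  proof (rule bounded_linear_intro[where K = "cmod c * norm T"])
    show "c *\<^sub>C T (r *\<^sub>R x) = r *\<^sub>R (c *\<^sub>C T x)" for r x
      by (simp only: blinfun.scaleR_right) (simp add: scaleR_scaleC scaleC_scaleC mult.commute)
    show "norm (c *\<^sub>C T x) \<le> norm x * (cmod c * norm T)" for x
      using mult_left_mono[OF norm_blinfun[of T x], of "cmod c"]
      by (simp add: norm_scaleC mult_ac)
  qed (simp add: blinfun.add_right scaleC_add_right)
  then show ?thesis by (simp add: op_scale_def bounded_linear_Blinfun_apply)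
qed

lemma vector_space_op_scale:
  "vector_space (op_scale :: complex \<Rightarrow> ('h::complex_hilbert \<Rightarrow>\<^sub>L 'h) \<Rightarrow> _)"
proof
  fix T :: "'h \<Rightarrow>\<^sub>L 'h"
  have "1 *\<^sub>C x = x" for x :: 'h
    using scaleR_scaleC[of 1 x] by simp
  then show "op_scale 1 T = T" by (intro blinfun_eqI) simp
qed (auto intro!: blinfun_eqI
      simp: blinfun.add_left scaleC_add_right scaleC_add_left scaleC_scaleC)

lemma commutant_unital_subalgebra:
  fixes S :: "('h::complex_hilbert \<Rightarrow>\<^sub>L 'h) set"
  assumes "S \<subseteq> bounded_ops"
  shows "id_blinfun \<in> commutant S"
    and "A \<in> commutant S \<Longrightarrow> B \<in> commutant S \<Longrightarrow> A + B \<in> commutant S"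
    and "A \<in> commutant S \<Longrightarrow> op_scale c A \<in> commutant S"
    and "A \<in> commutant S \<Longrightarrow> B \<in> commutant S \<Longrightarrow> A o\<^sub>L B \<in> commutant S"
proof -
  have *: "A \<in> commutant S \<longleftrightarrow> (\<forall>c x. A (c *\<^sub>C x) = c *\<^sub>C A x) \<and> (\<forall>B\<in>S. \<forall>x. A (B x) = B (A x))"
    for A :: "'h \<Rightarrow>\<^sub>L 'h"
    by (auto simp: commutant_def bounded_ops_def intro!: blinfun_eqI)
      (metis blinfun_apply_blinfun_compose)+
  have S: "B (c *\<^sub>C x) = c *\<^sub>C B x" if "B \<in> S" for B :: "'h \<Rightarrow>\<^sub>L 'h" and c x
    using assms that by (auto simp: bounded_ops_def)
  show "id_blinfun \<in> commutant S"
    "A \<in> commutant S \<Longrightarrow> B \<in> commutant S \<Longrightarrow> A + B \<in> commutant S"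
    "A \<in> commutant S \<Longrightarrow> op_scale c A \<in> commutant S"
    "A \<in> commutant S \<Longrightarrow> B \<in> commutant S \<Longrightarrow> A o\<^sub>L B \<in> commutant S"
    by (auto simp: * S blinfun.add_left blinfun.add_right scaleC_add_right scaleC_scaleC mult.commute)
qed

end

(*
The normal predual consists of the norm limits of sums of vector functionals
a |-> <a x, y>; a functional on it is given by a bounded sesquilinear form, whose operator
commutes with the commutant.

For uniqueness, let T' be a weak-star topology with separately continuous multiplication.
The T'-closure of the unit ball is a bounded semigroup, and the C*-identity applied to powers of
c* c forces it to be the unit ball. Hence the unit ball and the order interval [0, 1], an
intersection of balls, are T'-compact. A T'-continuous functional attains its norm on the unit
ball; this gives a polar decomposition and a reduction to positive functionals. A compactness
argument, in which rapidly decreasing sequences in [0, 1] are dominated by truncations h / (1 + h)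
of their sums, shows that a positive T'-continuous functional is small where finitely many vector
states are small. By Cauchy-Schwarz, Hahn-Banach and Riesz it is then normal. Finally the predual
of T' separates M, so by Hahn-Banach it is dense in, and hence equal to, the normal predual.
*)

theory Submission imports Defs begin

section \<open>Complex Hilbert spaces\<close>

text \<open>The rival topology T' comes with little structure. Its isomorphism with a dual space
  need not be isometric, so Banach-Alaoglu yields compactness of some bounded set, not of the
  operator unit ball. Neither the adjoint nor any vector state is known to be T'-continuous, so
  positivity is not visibly a closed condition. The remedy is to express order by norm: balls
  centred at the multiples \<open>1/2 + i t\<close> of the identity cut out [0, 1], and it follows
  that each set of effects q with q \<le> c + m is T'-closed. This is the bridge between T' and
  quadratic forms. It explains why a sequence of effects is dominated by a single effect c: a
  T'-cluster point inherits an operator inequality, whereas it need not inherit a bound on one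
  vector state. The effect c itself is found by compactness in the normal topology, where vector
  states are continuous. The truncation is t / (1 + t) and not min(t, 1) because the former is
  operator monotone and the latter is not.\<close>

lemma scaleC_one [simp]: "1 *\<^sub>C x = (x::'h::complex_hilbert)"
  using scaleR_scaleC[of 1 x] by simp

lemma scaleC_zero_left [simp]: "0 *\<^sub>C x = (0::'h::complex_hilbert)"
  using scaleR_scaleC[of 0 x] by simp

lemma scaleC_zero_right [simp]: "c *\<^sub>C 0 = (0::'h::complex_hilbert)"
  using scaleC_add_right[of c 0 0] by simp

lemma scaleC_minus1: "(-1) *\<^sub>C x = - (x::'h::complex_hilbert)"
  using scaleR_scaleC[of "-1" x] by simp

lemma cinner_add_right: "cinner (x::'h::complex_hilbert) (y + z) = cinner x y + cinner x z"
  by (metis cinner_add_left cinner_commute complex_cnj_add)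

lemma cinner_scaleC_right: "cinner (x::'h::complex_hilbert) (c *\<^sub>C y) = cnj c * cinner x y"
  by (metis cinner_commute cinner_scaleC_left complex_cnj_mult)

lemma cinner_scaleR_left: "cinner (r *\<^sub>R x) (y::'h::complex_hilbert) = of_real r * cinner x y"
  by (simp add: scaleR_scaleC cinner_scaleC_left)

lemma cinner_scaleR_right: "cinner x (r *\<^sub>R y::'h::complex_hilbert) = of_real r * cinner x y"
  by (simp add: scaleR_scaleC cinner_scaleC_right)

lemma cinner_zero_left [simp]: "cinner 0 (x::'h::complex_hilbert) = 0"
  using cinner_add_left[of 0 0 x] by simp

lemma cinner_zero_right [simp]: "cinner (x::'h::complex_hilbert) 0 = 0"
  using cinner_add_right[of x 0 0] by simp

lemma cinner_minus_left: "cinner (- x) (y::'h::complex_hilbert) = - cinner x y"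
  using cinner_add_left[of x "-x" y] by (simp add: eq_neg_iff_add_eq_0 add.commute)

lemma cinner_minus_right: "cinner x (- y::'h::complex_hilbert) = - cinner x y"
  using cinner_add_right[of x y "-y"] by (simp add: eq_neg_iff_add_eq_0 add.commute)

lemma cinner_diff_left: "cinner (x - y) (z::'h::complex_hilbert) = cinner x z - cinner y z"
  using cinner_add_left[of x "-y" z] by (simp add: cinner_minus_left)

lemma cinner_diff_right: "cinner x (y - z::'h::complex_hilbert) = cinner x y - cinner x z"
  using cinner_add_right[of x y "-z"] by (simp add: cinner_minus_right)

lemmas cinner_algebra = cinner_add_left cinner_add_right cinner_diff_left cinner_diff_right
  cinner_minus_left cinner_minus_right cinner_scaleC_left cinner_scaleC_right
  cinner_scaleR_left cinner_scaleR_right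

lemma Re_cinner_commute: "Re (cinner x y) = Re (cinner y (x::'h::complex_hilbert))"
  by (metis cinner_commute complex_cnj cnj.simps(1))

lemma Re_cinner_self [simp]: "Re (cinner x (x::'h::complex_hilbert)) = (norm x)\<^sup>2"
  by (simp add: cinner_self)

lemma norm_add_square:
  "(norm (x + y))\<^sup>2 = (norm x)\<^sup>2 + 2 * Re (cinner x y) + (norm (y::'h::complex_hilbert))\<^sup>2"
  using Re_cinner_commute[of x y]
  by (simp flip: Re_cinner_self add: cinner_add_left cinner_add_right)

lemma norm_diff_square:
  "(norm (x - y))\<^sup>2 = (norm x)\<^sup>2 - 2 * Re (cinner x y) + (norm (y::'h::complex_hilbert))\<^sup>2"
  using norm_add_square[of x "-y"] by (simp add: cinner_minus_right)

text \<open>Cauchy--Schwarz for a positive semidefinite form, read off the quadratic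
  polynomial \<open>l \<mapsto> q(v - l w)\<close>.\<close>

lemma psd_quadratic_discriminant:
  fixes z :: complex
  assumes "\<And>l. 0 \<le> A - 2 * Re (cnj l * z) + (cmod l)\<^sup>2 * B" and "0 \<le> B"
  shows "(cmod z)\<^sup>2 \<le> A * B"
proof -
  \<comment> \<open>Taking \<open>l\<close> to be a real multiple of \<open>z\<close> makes the
    linear term a multiple of \<open>(cmod z)\<^sup>2\<close>, which leaves a real quadratic in
    \<open>t\<close>.\<close>
  have *: "0 \<le> A - 2 * t * (cmod z)\<^sup>2 + t\<^sup>2 * (cmod z)\<^sup>2 * B" for t :: real
  proof -
    have "Re (cnj (of_real t * z) * z) = t * (cmod z)\<^sup>2"
      by (simp add: cmod_power2) (simp add: power2_eq_square algebra_simps)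
    moreover have "(cmod (of_real t * z))\<^sup>2 = t\<^sup>2 * (cmod z)\<^sup>2"
      by (simp add: norm_mult power_mult_distrib)
    ultimately show ?thesis using assms(1)[of "of_real t * z"] by (simp only: mult.assoc)
  qed
  show ?thesis
  proof (cases "B = 0")
    case True
    have "(cmod z)\<^sup>2 = 0"
    proof (rule ccontr)
      assume "(cmod z)\<^sup>2 \<noteq> 0"
      \<comment> \<open>For \<open>B = 0\<close> the polynomial is affine in \<open>t\<close>, and
        at this \<open>t\<close> its value is -1.\<close>
      then show False using *[of "(A + 1) / (2 * (cmod z)\<^sup>2)"] True by (simp add: field_simps)
    qed
    then show ?thesis using True by simp
  next
    case False
    then have B: "B > 0" using assms(2) by simp
    have "(1 / B)\<^sup>2 * (cmod z)\<^sup>2 * B = (cmod z)\<^sup>2 / B" using B by (simp add: power2_eq_square)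
    with *[of "1/B"] have "(cmod z)\<^sup>2 / B \<le> A" by simp
    then show ?thesis using B by (simp add: field_simps)
  qed
qed

lemma cinner_cauchy_schwarz: "cmod (cinner x y) \<le> norm x * norm (y::'h::complex_hilbert)"
proof -
  have "(cmod (cinner x y))\<^sup>2 \<le> (norm x)\<^sup>2 * (norm y)\<^sup>2"
  proof (rule psd_quadratic_discriminant)
    fix l
    have "0 \<le> (norm (x - l *\<^sub>C y))\<^sup>2" by simp
    also have "\<dots> = (norm x)\<^sup>2 - 2 * Re (cnj l * cinner x y) + (cmod l)\<^sup>2 * (norm y)\<^sup>2"
      by (simp add: norm_diff_square cinner_scaleC_right norm_scaleC power_mult_distrib)
    finally show "0 \<le> \<dots>" .
  qed simp
  then show ?thesis
    by (metis norm_ge_zero power_mult_distrib power2_le_imp_le mult_nonneg_nonneg)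
qed

lemma bounded_bilinear_cinner: "bounded_bilinear (cinner :: 'h::complex_hilbert \<Rightarrow> _)"
  by (rule bounded_bilinear.intro)
    (auto simp: cinner_algebra scaleR_conv_of_real intro!: exI[of _ 1] cinner_cauchy_schwarz)

lemmas cinner_sum_left = bounded_bilinear.sum_left[OF bounded_bilinear_cinner]
lemmas tendsto_cinner = bounded_bilinear.tendsto[OF bounded_bilinear_cinner]

lemma cinner_eqI: "(\<And>z. cinner x z = cinner y z) \<Longrightarrow> x = (y::'h::complex_hilbert)"
proof -
  assume "\<And>z. cinner x z = cinner y z"
  then have "cinner (x - y) (x - y) = 0" by (simp add: cinner_diff_left)
  then show ?thesis by (simp add: cinner_self)
qed

lemma norm_le_cinnerI:
  fixes x :: "'h::complex_hilbert"
  assumes "\<And>y. cmod (cinner x y) \<le> K * norm y" "0 \<le> K"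
  shows "norm x \<le> K"
proof (cases "x = 0")
  case False
  have "norm x * norm x \<le> K * norm x"
    using assms(1)[of x] by (simp add: cinner_self power2_eq_square norm_mult)
  then show ?thesis using False by simp
qed (use assms in simp)

text \<open>The representing vector is the limit of a minimising sequence of
  \<open>w \<mapsto> \<parallel>w\<parallel>\<^sup>2 - 2 Re (f w)\<close>.\<close>

lemma riesz_representation_on:
  fixes W :: "'h::complex_hilbert set" and f :: "'h \<Rightarrow> complex"
  assumes W0: "0 \<in> W" and W1: "\<And>u v. u \<in> W \<Longrightarrow> v \<in> W \<Longrightarrow> u + v \<in> W"
    and W2: "\<And>c u. u \<in> W \<Longrightarrow> c *\<^sub>C u \<in> W"
    and f1: "\<And>u v. u \<in> W \<Longrightarrow> v \<in> W \<Longrightarrow> f (u + v) = f u + f v"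
    and f2: "\<And>c u. u \<in> W \<Longrightarrow> f (c *\<^sub>C u) = c * f u"
    and bd: "\<And>u. u \<in> W \<Longrightarrow> cmod (f u) \<le> C * norm u"
  shows "\<exists>y. \<forall>w\<in>W. f w = cinner w y"
proof -
  define J where "J w = (norm w)\<^sup>2 - 2 * Re (f w)" for w
  have Jlow: "J w \<ge> - (C\<^sup>2)" if "w \<in> W" for w
  proof -
    have "Re (f w) \<le> C * norm w" using bd[OF that] abs_Re_le_cmod[of "f w"] by linarith
    moreover have "0 \<le> (norm w - C)\<^sup>2" by simp
    ultimately show ?thesis by (simp add: J_def power2_eq_square algebra_simps)
  qed
  define m where "m = (INF w\<in>W. J w)"
  have bdd: "bdd_below (J ` W)" using Jlow by (meson bdd_belowI2)
  have mle: "m \<le> J w" if "w \<in> W" for w unfolding m_def by (rule cINF_lower[OF bdd that])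
  have "\<exists>w\<in>W. J w < m + e" if "e > 0" for e
    using cINF_less_iff[OF _ bdd, of "m + e"] that W0 unfolding m_def by (metis empty_iff less_add_same_cancel1)
  then have "\<forall>n. \<exists>w\<in>W. J w < m + inverse (real (Suc n))" by simp
  then obtain w where wW: "\<And>n. w n \<in> W" and wJ: "\<And>n. J (w n) < m + inverse (real (Suc n))"
    by metis
  \<comment> \<open>The midpoint lies in \<open>W\<close>, where \<open>J\<close> is at least
    \<open>m\<close>; the parallelogram law turns this into a distance bound, so minimising
    sequences are Cauchy.\<close>
  have half: "(norm (u - v))\<^sup>2 \<le> 2 * (J u - m) + 2 * (J v - m)" if "u \<in> W" "v \<in> W" for u v
  proof -
    have s: "(1/2) *\<^sub>C (u + v) \<in> W" using that W1 W2 by blast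
    have "Re (f ((1/2) *\<^sub>C (u + v))) = (Re (f u) + Re (f v)) / 2"
      using that by (simp add: f2 W1 f1)
    moreover have "(norm ((1/2) *\<^sub>C (u + v)))\<^sup>2 = (norm (u + v))\<^sup>2 / 4"
      by (simp add: norm_scaleC power_divide)
    ultimately have "J ((1/2) *\<^sub>C (u + v)) = (norm (u + v))\<^sup>2 / 4 - (Re (f u) + Re (f v))"
      by (simp add: J_def)
    then have "4 * m \<le> (norm (u + v))\<^sup>2 - 4 * (Re (f u) + Re (f v))" using mle[OF s] by simp
    then show ?thesis unfolding J_def norm_add_square norm_diff_square by argo
  qed
  have "Cauchy w"
  proof (rule metric_CauchyI)
    fix e :: real assume "e > 0"
    then obtain N where N: "inverse (real (Suc N)) < e\<^sup>2 / 4"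
      using reals_Archimedean[of "e\<^sup>2/4"] by auto
    have "dist (w i) (w k) < e" if "i \<ge> N" "k \<ge> N" for i k
    proof -
      have a: "J (w n) - m < e\<^sup>2 / 4" if "n \<ge> N" for n
      proof -
        have "inverse (real (Suc n)) \<le> inverse (real (Suc N))" using that by (simp add: field_simps)
        then show ?thesis using wJ[of n] N by linarith
      qed
      have "2 * (J (w i) - m) + 2 * (J (w k) - m) < e\<^sup>2"
        using a[OF that(1)] a[OF that(2)] by argo
      with half[OF wW wW] have "(norm (w i - w k))\<^sup>2 < e\<^sup>2" by (rule order.strict_trans1)
      then show ?thesis using \<open>e > 0\<close> by (simp add: dist_norm power2_less_imp_less)
    qed
    then show "\<exists>M. \<forall>m\<ge>M. \<forall>n\<ge>M. dist (w m) (w n) < e" by blast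
  qed
  then obtain y where y: "w \<longlonglongrightarrow> y" using Cauchy_convergent_iff convergent_def by blast
  have Jlim: "(\<lambda>n. J (w n)) \<longlonglongrightarrow> m"
  proof (rule real_tendsto_sandwich[OF _ _ tendsto_const])
    show "\<forall>\<^sub>F n in sequentially. m \<le> J (w n)" using mle wW by simp
    show "\<forall>\<^sub>F n in sequentially. J (w n) \<le> m + inverse (real (Suc n))"
      using wJ by (simp add: less_imp_le)
    show "(\<lambda>n. m + inverse (real (Suc n))) \<longlonglongrightarrow> m"
      using tendsto_add[OF tendsto_const LIMSEQ_inverse_real_of_nat, of m] by simp
  qed
  \<comment> \<open>\<open>W\<close> need not be closed, so \<open>y\<close> may lie outside it.
    Minimality is therefore used at the perturbed points \<open>w n + cnj l *\<^sub>C u\<close> of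
    \<open>W\<close>, and only then is the limit taken; the discriminant with \<open>A = 0\<close>
    forces the difference to vanish.\<close>
  have "f u = cinner u y" if u: "u \<in> W" for u
  proof -
    have "0 \<le> 0 - 2 * Re (cnj l * (f u - cinner u y)) + (cmod l)\<^sup>2 * (norm u)\<^sup>2" for l
    proof -
      let ?g = "\<lambda>z. 2 * Re (cnj l * (f u - cinner u z)) - (cmod l)\<^sup>2 * (norm u)\<^sup>2"
      have "(\<lambda>n. J (w n) - ?g (w n)) \<longlonglongrightarrow> m - ?g y" by (intro tendsto_intros Jlim tendsto_cinner y)
      moreover have "m \<le> J (w n) - ?g (w n)" for n
      proof -
        have lu: "cnj l *\<^sub>C u \<in> W" using u W2 by blast
        have "Re (l * cinner (w n) u) = Re (cnj l * cinner u (w n))"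
          using cinner_commute[of u "w n"] by simp
        moreover have "m \<le> J (w n + cnj l *\<^sub>C u)" using mle W1 wW lu by blast
        ultimately show ?thesis
          by (simp add: J_def f1[OF wW lu] f2[OF u] norm_add_square norm_scaleC power_mult_distrib
              cinner_scaleC_right right_diff_distrib)
      qed
      ultimately have "m \<le> m - ?g y" using LIMSEQ_le_const by blast
      then show ?thesis by simp
    qed
    from psd_quadratic_discriminant[OF this] show ?thesis by simp
  qed
  then show ?thesis by blast
qed

text \<open>Riesz applied to the conjugate of \<open>B x\<close> gives the vector \<open>T x\<close>
  for each fixed \<open>x\<close>; linearity and boundedness in \<open>x\<close> are then tested
  against all \<open>y\<close>.\<close>

lemma sesquilinear_bounded_representation:
  fixes B :: "'h::complex_hilbert \<Rightarrow> 'h \<Rightarrow> complex"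
  assumes l1: "\<And>x x' y. B (x + x') y = B x y + B x' y" and l2: "\<And>c x y. B (c *\<^sub>C x) y = c * B x y"
    and r1: "\<And>x y y'. B x (y + y') = B x y + B x y'" and r2: "\<And>c x y. B x (c *\<^sub>C y) = cnj c * B x y"
    and bd: "\<And>x y. cmod (B x y) \<le> C * norm x * norm y" and "0 \<le> C"
  shows "\<exists>T\<in>bounded_ops. \<forall>x y. cinner (blinfun_apply T x) y = B x y"
proof -
  have "\<exists>z. \<forall>y\<in>UNIV. cnj (B x y) = cinner y z" for x
    by (rule riesz_representation_on[where C = "C * norm x"]) (auto simp: r1 r2 bd)
  then have "\<forall>x. \<exists>z. \<forall>y. cnj (B x y) = cinner y z" by simp
  then obtain t where t: "\<And>x y. cnj (B x y) = cinner y (t x)" by metis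
  then have t: "cinner (t x) y = B x y" for x y by (metis cinner_commute complex_cnj_cnj)
  have bl: "bounded_linear t"
  proof (rule bounded_linear_intro[where K = C])
    show "t (x + y) = t x + t y" for x y by (rule cinner_eqI) (simp add: cinner_add_left t l1)
    show "t (r *\<^sub>R x) = r *\<^sub>R t x" for r x
      by (rule cinner_eqI) (simp add: scaleR_scaleC cinner_scaleC_left t l2)
    show "norm (t x) \<le> norm x * C" for x
    proof (rule norm_le_cinnerI)
      show "cmod (cinner (t x) y) \<le> norm x * C * norm y" for y
        using bd[of x y] by (simp add: t mult.commute)
    qed (use \<open>0 \<le> C\<close> in simp)
  qed
  have tc: "t (c *\<^sub>C x) = c *\<^sub>C t x" for c x by (rule cinner_eqI) (simp add: cinner_scaleC_left t l2)
  show ?thesis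
    by (rule bexI[of _ "Blinfun t"])
      (auto simp: bounded_ops_def bounded_linear_Blinfun_apply[OF bl] t tc)
qed

text \<open>\<open>op_adjoint\<close> is a definite description, so existence must come first: it is
  the operator of the form \<open>cinner x (T y)\<close>, and uniqueness is nondegeneracy of the
  inner product.\<close>

lemma op_adjoint:
  fixes T :: "'h::complex_hilbert \<Rightarrow>\<^sub>L 'h"
  assumes "T \<in> bounded_ops"
  shows "cinner (op_adjoint T x) y = cinner x (T y)" and "op_adjoint T \<in> bounded_ops"
proof -
  have Tc: "T (c *\<^sub>C x) = c *\<^sub>C T x" for c x using assms by (auto simp: bounded_ops_def)
  have "\<exists>S\<in>bounded_ops. \<forall>x y. cinner (blinfun_apply S x) y = cinner x (T y)"
  proof (rule sesquilinear_bounded_representation[where C = "norm T"])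
    fix x y :: 'h
    have "cmod (cinner x (T y)) \<le> norm x * norm (T y)" by (rule cinner_cauchy_schwarz)
    also have "\<dots> \<le> norm x * (norm T * norm y)" by (intro mult_left_mono norm_blinfun) simp
    finally show "cmod (cinner x (T y)) \<le> norm T * norm x * norm y" by (simp add: mult_ac)
  qed (auto simp: cinner_algebra blinfun.add_right Tc)
  then obtain S where S: "S \<in> bounded_ops" "\<forall>x y. cinner (blinfun_apply S x) y = cinner x (T y)"
    by blast
  have "op_adjoint T = S" unfolding op_adjoint_def
  proof (rule the_equality[where P = "\<lambda>S. \<forall>x y. cinner (blinfun_apply S x) y = cinner x (T y)"])
    fix S' :: "'h \<Rightarrow>\<^sub>L 'h"
    assume "\<forall>x y. cinner (S' x) y = cinner x (T y)"
    then show "S' = S" using S by (intro blinfun_eqI cinner_eqI) simp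
  qed (use S in blast)
  then show "cinner (op_adjoint T x) y = cinner x (T y)" "op_adjoint T \<in> bounded_ops"
    using S by auto
qed

section \<open>Operators in a von Neumann algebra\<close>

lemma bounded_ops_scaleC: "T \<in> bounded_ops \<Longrightarrow> T (c *\<^sub>C x) = c *\<^sub>C T x"
  by (simp add: bounded_ops_def)

lemma norm_op_scale: "norm (op_scale c T) = cmod c * norm (T :: 'h::complex_hilbert \<Rightarrow>\<^sub>L 'h)"
proof -
  have le: "norm (op_scale c T) \<le> cmod c * norm T" for c and T :: "'h \<Rightarrow>\<^sub>L 'h"
  proof (rule norm_blinfun_bound)
    show "norm (op_scale c T x) \<le> cmod c * norm T * norm x" for x
      using mult_left_mono[OF norm_blinfun[of T x], of "cmod c"] by (simp add: norm_scaleC mult_ac)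
  qed simp
  show ?thesis
  proof (cases "c = 0")
    case False
    have "op_scale (inverse c) (op_scale c T) = T"
      using False by (intro blinfun_eqI) (simp add: scaleC_scaleC)
    then have "norm T \<le> cmod (inverse c) * norm (op_scale c T)" using le[of "inverse c" "op_scale c T"] by simp
    then have "cmod c * norm T \<le> norm (op_scale c T)" using False by (simp add: norm_divide field_simps)
    then show ?thesis using le[of c T] by simp
  qed (use le[of 0 T] in simp)
qed

lemma scaleR_op_scale: "r *\<^sub>R T = op_scale (of_real r) (T :: 'h::complex_hilbert \<Rightarrow>\<^sub>L 'h)"
  by (intro blinfun_eqI) (simp add: blinfun.scaleR_left scaleR_scaleC)

lemma op_scale_simps [simp]:
  fixes T :: "'h::complex_hilbert \<Rightarrow>\<^sub>L 'h"
  shows "op_scale 1 T = T" "op_scale c 0 = 0" "op_scale c (op_scale d T) = op_scale (c * d) T"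
  by (auto intro!: blinfun_eqI simp: scaleC_scaleC)

lemma norm_op_adjoint_le: "T \<in> bounded_ops \<Longrightarrow> norm (op_adjoint T) \<le> norm (T :: 'h::complex_hilbert \<Rightarrow>\<^sub>L 'h)"
proof (rule norm_blinfun_bound)
  fix x assume T: "T \<in> bounded_ops"
  show "norm (op_adjoint T x) \<le> norm T * norm x"
  proof (rule norm_le_cinnerI)
    fix y
    have "cmod (cinner x (T y)) \<le> norm x * (norm T * norm y)"
      using cinner_cauchy_schwarz[of x "T y"] mult_left_mono[OF norm_blinfun[of T y], of "norm x"] by simp
    then show "cmod (cinner (op_adjoint T x) y) \<le> norm T * norm x * norm y"
      by (simp add: op_adjoint[OF T] mult_ac)
  qed simp
qed simp

section \<open>Positive operators and the order interval [0, 1]\<close>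

definition positive_op :: "('h::complex_hilbert \<Rightarrow>\<^sub>L 'h) \<Rightarrow> bool" where
  "positive_op h \<longleftrightarrow> h \<in> bounded_ops \<and> (\<forall>x. Im (cinner (h x) x) = 0 \<and> 0 \<le> Re (cinner (h x) x))"

abbreviation quad :: "('h::complex_hilbert \<Rightarrow>\<^sub>L 'h) \<Rightarrow> 'h \<Rightarrow> real" where
  "quad a x \<equiv> Re (cinner (blinfun_apply a x) x)"

text \<open>The order interval [0, 1] of \<open>M\<close>; its members are called effects in quantum
  measurement theory.\<close>

definition effects :: "('h::complex_hilbert \<Rightarrow>\<^sub>L 'h) set \<Rightarrow> ('h \<Rightarrow>\<^sub>L 'h) set" where
  "effects M = {a \<in> M. positive_op a \<and> (\<forall>x. quad a x \<le> (norm x)\<^sup>2)}"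

text \<open>The defect form \<open>s\<close> vanishes on the diagonal. Polarising with
  \<open>y\<close> and with \<open>\<i> *\<^sub>C y\<close> makes it both antisymmetric and
  symmetric, hence zero.\<close>

lemma selfadjoint_of_real_form:
  fixes h :: "'h::complex_hilbert \<Rightarrow>\<^sub>L 'h"
  assumes "h \<in> bounded_ops" and "\<And>x. Im (cinner (h x) x) = 0"
  shows "cinner (h x) y = cinner x (h y)"
proof -
  define s where "s x y = cinner (h x) y - cinner x (h y)" for x y
  have s0: "s x x = 0" for x
    unfolding s_def using assms(2)[of x] cinner_commute[of x "h x"]
    by (simp add: complex_eq_iff)
  have sa: "s (x + y) (x + y) = s x x + s x y + s y x + s y y" for x y
    by (simp add: s_def cinner_algebra blinfun.add_right)
  have sc: "s x (\<i> *\<^sub>C y) = - \<i> * s x y" "s (\<i> *\<^sub>C y) x = \<i> * s y x" for x y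
    by (simp_all add: s_def cinner_algebra bounded_ops_scaleC[OF assms(1)] algebra_simps)
  have 1: "s x y + s y x = 0" using sa[of x y] s0[of "x+y"] s0[of x] s0[of y] by simp
  have "\<i> * (s y x - s x y) = 0"
    using sa[of x "\<i> *\<^sub>C y"] s0[of "x + \<i> *\<^sub>C y"] s0[of x] s0[of "\<i> *\<^sub>C y"] sc by (simp add: algebra_simps)
  then have "s y x = s x y" by simp
  then have "s x y = 0" using 1 by simp
  then show ?thesis by (simp add: s_def)
qed

lemma positive_op_selfadjoint: "positive_op h \<Longrightarrow> cinner (h x) y = cinner x (h y)"
  by (rule selfadjoint_of_real_form) (auto simp: positive_op_def)

lemma positive_op_nonneg: "positive_op h \<Longrightarrow> 0 \<le> quad h x"
  by (auto simp: positive_op_def)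

lemma quad_diff_scale:
  fixes h :: "'h::complex_hilbert \<Rightarrow>\<^sub>L 'h"
  assumes "positive_op h"
  shows "quad h (x - l *\<^sub>C y) = quad h x - 2 * Re (cnj l * cinner (h x) y) + (cmod l)\<^sup>2 * quad h y"
proof -
  have hc: "h (l *\<^sub>C y) = l *\<^sub>C h y" using assms bounded_ops_scaleC by (auto simp: positive_op_def)
  have "cinner (h y) x = cnj (cinner (h x) y)"
    by (metis assms cinner_commute positive_op_selfadjoint)
  moreover have "Im (cinner (h y) y) = 0" using assms by (simp add: positive_op_def)
  ultimately show ?thesis
    by (simp add: blinfun.diff_right hc cinner_algebra cmod_power2)
      (simp add: power2_eq_square algebra_simps)
qed

lemma positive_op_cauchy_schwarz:
  fixes h :: "'h::complex_hilbert \<Rightarrow>\<^sub>L 'h"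
  assumes "positive_op h"
  shows "(cmod (cinner (h x) y))\<^sup>2 \<le> quad h x * quad h y"
  by (rule psd_quadratic_discriminant)
    (use quad_diff_scale[OF assms] positive_op_nonneg[OF assms] in \<open>metis+\<close>)

text \<open>This is \<open>a\<^sup>2 \<le> a\<close> for an effect. Cauchy-Schwarz for the form of
  \<open>a\<close> at the pair \<open>x\<close>, \<open>a x\<close> bounds the fourth power of
  \<open>norm (a x)\<close> by \<open>quad a x * (norm (a x))\<^sup>2\<close>.\<close>

lemma effects_norm_square_le:
  assumes "a \<in> effects M" shows "(norm (a x))\<^sup>2 \<le> quad a x"
proof -
  have a: "positive_op a" "quad a y \<le> (norm y)\<^sup>2" for y using assms by (auto simp: effects_def)
  show ?thesis
  proof (cases "a x = 0")
    case False
    have "cmod (cinner (a x) (a x)) = (norm (a x))\<^sup>2" by (simp add: cinner_self norm_power)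
    then have "(norm (a x))\<^sup>2 * (norm (a x))\<^sup>2 = (cmod (cinner (a x) (a x)))\<^sup>2"
      by (simp only: power2_eq_square[of "(norm (a x))\<^sup>2"])
    also have "\<dots> \<le> quad a x * quad a (a x)" by (rule positive_op_cauchy_schwarz[OF a(1)])
    also have "\<dots> \<le> quad a x * (norm (a x))\<^sup>2"
      by (intro mult_left_mono a positive_op_nonneg)
    finally show ?thesis by (rule mult_right_le_imp_le) (use False in simp)
  qed (simp add: positive_op_nonneg[OF a(1)])
qed

text \<open>The disks with centre \<open>s/2 + its\<close> passing through \<open>0\<close> and \<open>s\<close> intersect in \<open>[0, s]\<close>.
  This makes the order interval an intersection of balls.\<close>

lemma in_segment_if_in_disks:
  assumes "\<And>t. cmod (z - (1/2 + \<i> * of_real t) * of_real s) \<le> sqrt (1/4 + t\<^sup>2) * s" "0 \<le> s"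
  shows "Im z = 0" "0 \<le> Re z" "Re z \<le> s"
proof -
  have k: "(Re z - s/2)\<^sup>2 + (Im z - t * s)\<^sup>2 \<le> (1/4 + t\<^sup>2) * s\<^sup>2" for t
  proof -
    have "(cmod (z - (1/2 + \<i> * of_real t) * of_real s))\<^sup>2 \<le> (sqrt (1/4 + t\<^sup>2) * s)\<^sup>2"
      by (rule power_mono[OF assms(1)]) simp
    then show ?thesis by (simp add: cmod_power2 power_mult_distrib)
  qed
  have lin: "(Re z - s/2)\<^sup>2 + (Im z)\<^sup>2 \<le> s\<^sup>2/4 + t * (2 * s * Im z)" for t
    using k[of t] by (simp add: power2_eq_square algebra_simps)
  show "Im z = 0"
  proof (cases "s = 0")
    case True then show ?thesis using k[of 0]
      by (simp add: sum_power2_le_zero_iff)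
  next
    case False
    show ?thesis
    proof (rule ccontr)
      assume "Im z \<noteq> 0"
      then have n: "2 * s * Im z \<noteq> 0" using False by simp
      \<comment> \<open>The bound \<open>lin\<close> is affine in \<open>t\<close> with slope
        \<open>2 * s * Im z\<close>; this \<open>t\<close> makes it equal to -1.\<close>
      have "(Re z - s/2)\<^sup>2 + (Im z)\<^sup>2 \<le> s\<^sup>2/4 + (- (s\<^sup>2/4 + 1) / (2 * s * Im z)) * (2 * s * Im z)"
        by (rule lin)
      also have "\<dots> = -1" using n by (simp add: field_simps)
      finally show False using zero_le_power2[of "Re z - s/2"] zero_le_power2[of "Im z"] by linarith
    qed
  qed
  then have "(Re z - s/2)\<^sup>2 \<le> (s/2)\<^sup>2" using k[of 0] by (simp add: power_divide)
  then have "\<bar>Re z - s/2\<bar> \<le> s/2" using abs_le_square_iff[of "Re z - s/2" "s/2"] assms(2) by simp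
  then show "0 \<le> Re z" "Re z \<le> s" by linarith+
qed

text \<open>Norm balls turn out to be weak-star closed, and this carries closedness over to the
  order interval. Forwards, the estimate reduces to \<open>a\<^sup>2 \<le> a\<close>, because the
  centre has real part 1/2; backwards, the disk lemma is applied to \<open>cinner (a x) x\<close>
  with \<open>s = (norm x)\<^sup>2\<close>.\<close>

lemma effects_iff_norm:
  fixes M :: "('h::complex_hilbert \<Rightarrow>\<^sub>L 'h) set"
  assumes "M \<subseteq> bounded_ops"
  shows "a \<in> effects M \<longleftrightarrow>
    a \<in> M \<and> (\<forall>t. norm (a - op_scale (1/2 + \<i> * of_real t) id_blinfun) \<le> sqrt (1/4 + t\<^sup>2))"
proof safe
  assume a: "a \<in> effects M"
  then show "a \<in> M" by (simp add: effects_def)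
  fix t :: real
  show "norm (a - op_scale (1/2 + \<i> * of_real t) id_blinfun) \<le> sqrt (1/4 + t\<^sup>2)"
  proof (rule norm_blinfun_bound)
    fix x
    have im: "Im (cinner (a x) x) = 0" using a by (auto simp: effects_def positive_op_def)
    define c where "c = 1/2 + \<i> * complex_of_real t"
    have c: "Re c = 1/2" "Im c = t" "(cmod c)\<^sup>2 = 1/4 + t\<^sup>2"
      by (simp_all add: c_def cmod_power2 power_divide)
    have "(norm (a x - c *\<^sub>C x))\<^sup>2 = (norm (a x))\<^sup>2 - quad a x + (1/4 + t\<^sup>2) * (norm x)\<^sup>2"
      unfolding norm_diff_square cinner_scaleC_right norm_scaleC power_mult_distrib c using im c by simp
    also have "\<dots> \<le> (sqrt (1/4 + t\<^sup>2) * norm x)\<^sup>2"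
      using effects_norm_square_le[OF a, of x] by (simp add: power_mult_distrib)
    finally have "norm (a x - c *\<^sub>C x) \<le> sqrt (1/4 + t\<^sup>2) * norm x" by (rule power2_le_imp_le) simp
    then show "norm ((a - op_scale (1/2 + \<i> * of_real t) id_blinfun) x) \<le> sqrt (1/4 + t\<^sup>2) * norm x"
      by (simp add: blinfun.diff_left c_def)
  qed simp
next
  assume a: "a \<in> M" and n: "\<forall>t. norm (a - op_scale (1/2 + \<i> * of_real t) id_blinfun) \<le> sqrt (1/4 + t\<^sup>2)"
  have "cmod (cinner (a x) x - (1/2 + \<i> * of_real t) * of_real ((norm x)\<^sup>2)) \<le> sqrt (1/4 + t\<^sup>2) * (norm x)\<^sup>2" for x t
  proof -
    let ?b = "a - op_scale (1/2 + \<i> * of_real t) id_blinfun"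
    have "cinner (a x) x - (1/2 + \<i> * of_real t) * of_real ((norm x)\<^sup>2) = cinner (?b x) x"
      by (simp add: blinfun.diff_left cinner_algebra cinner_self)
    also have "cmod \<dots> \<le> norm (?b x) * norm x" by (rule cinner_cauchy_schwarz)
    also have "\<dots> \<le> (norm ?b * norm x) * norm x" by (intro mult_right_mono norm_blinfun) simp
    also have "\<dots> \<le> (sqrt (1/4 + t\<^sup>2) * norm x) * norm x" using n by (intro mult_right_mono) auto
    finally show ?thesis by (simp add: power2_eq_square mult.assoc)
  qed
  then have "Im (cinner (a x) x) = 0" "0 \<le> quad a x" "quad a x \<le> (norm x)\<^sup>2" for x
    by (rule in_segment_if_in_disks, simp)+
  then show "a \<in> effects M" using a assms by (auto simp: effects_def positive_op_def)
qed

lemma effects_norm_le_1: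
  assumes "a \<in> effects M" shows "norm a \<le> 1"
proof (rule norm_blinfun_bound)
  fix x
  have "(norm (a x))\<^sup>2 \<le> (norm x)\<^sup>2"
    using effects_norm_square_le[OF assms, of x] assms unfolding effects_def
    by (blast intro: order.trans)
  then show "norm (a x) \<le> 1 * norm x" using power2_le_imp_le[of "norm (a x)" "norm x"] by simp
qed simp

section \<open>Algebra, C*-identity and truncation inside a von Neumann algebra\<close>

locale vn_algebra =
  fixes M :: "('h::complex_hilbert \<Rightarrow>\<^sub>L 'h) set"
  assumes vn: "von_neumann_algebra M"
begin

lemma sub: "M \<subseteq> bounded_ops"
  and adj [intro]: "a \<in> M \<Longrightarrow> op_adjoint a \<in> M"
  and bicommutant: "commutant (commutant M) = M"
  using vn by (auto simp: von_neumann_algebra_def)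

lemma scaleC_mem: "a \<in> M \<Longrightarrow> a (c *\<^sub>C x) = c *\<^sub>C a x"
  using sub bounded_ops_scaleC by blast

text \<open>The double commutant condition in the form by which operators obtained from analysis
  (inverses, norm limits, operators of forms) are seen to lie in \<open>M\<close>.\<close>

lemma memI: "T \<in> bounded_ops \<Longrightarrow> (\<And>S x. S \<in> commutant M \<Longrightarrow> T (S x) = S (T x)) \<Longrightarrow> T \<in> M"
  using bicommutant unfolding commutant_def[of "commutant M"] by (auto intro!: blinfun_eqI)

lemma commutant_apply: "S \<in> commutant M \<Longrightarrow> a \<in> M \<Longrightarrow> S (a x) = a (S x)"
  by (auto simp: commutant_def) (metis blinfun_apply_blinfun_compose)

lemma commutant_sub: "commutant M \<subseteq> bounded_ops"
  by (auto simp: commutant_def)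

lemmas subalgebra = commutant_unital_subalgebra[OF commutant_sub, unfolded bicommutant]

lemma id_mem [intro]: "id_blinfun \<in> M"
  and add_mem [intro]: "a \<in> M \<Longrightarrow> b \<in> M \<Longrightarrow> a + b \<in> M"
  and scale_mem [intro]: "a \<in> M \<Longrightarrow> op_scale c a \<in> M"
  and comp_mem [intro]: "a \<in> M \<Longrightarrow> b \<in> M \<Longrightarrow> a o\<^sub>L b \<in> M"
  using subalgebra by blast+

lemma scaleR_mem [intro]: "a \<in> M \<Longrightarrow> r *\<^sub>R a \<in> M"
  by (auto simp: scaleR_op_scale)

lemma zero_mem [intro]: "0 \<in> M"
  using scaleR_mem[OF id_mem, of 0] by simp

lemma minus_mem [intro]: "a \<in> M \<Longrightarrow> - a \<in> M"
  using scaleR_mem[of a "-1"] by simp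

lemma diff_mem [intro]: "a \<in> M \<Longrightarrow> b \<in> M \<Longrightarrow> a - b \<in> M"
  using add_mem[of a "-b"] by auto

lemma sum_mem: "(\<And>i. i \<in> I \<Longrightarrow> f i \<in> M) \<Longrightarrow> sum f I \<in> M"
  by (induction I rule: infinite_finite_induct) auto

lemma cinner_adj: "a \<in> M \<Longrightarrow> cinner (op_adjoint a x) y = cinner x (a y)"
  using op_adjoint sub by blast

lemma cinner_adj': "a \<in> M \<Longrightarrow> cinner x (op_adjoint a y) = cinner (a x) y"
  by (metis cinner_adj cinner_commute)

lemma adj_adj: "a \<in> M \<Longrightarrow> op_adjoint (op_adjoint a) = a"
  by (intro blinfun_eqI cinner_eqI) (simp add: cinner_adj adj cinner_adj')

lemma norm_adj: "a \<in> M \<Longrightarrow> norm (op_adjoint a) = norm a"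
  using norm_op_adjoint_le[of a] norm_op_adjoint_le[of "op_adjoint a"] adj_adj[of a] sub adj[of a]
  by (metis antisym subsetD)

lemma effects_mem: "a \<in> effects M \<Longrightarrow> a \<in> M"
  by (simp add: effects_def)

lemma quad_adj_comp: "a \<in> M \<Longrightarrow> cinner ((op_adjoint a o\<^sub>L a) x) x = of_real ((norm (a x))\<^sup>2)"
  by (simp add: cinner_adj cinner_self)

lemma adj_comp_effect:
  assumes "a \<in> M" "norm a \<le> 1" shows "op_adjoint a o\<^sub>L a \<in> effects M"
proof -
  have "(norm (a x))\<^sup>2 \<le> (norm x)\<^sup>2" for x
    using norm_blinfun[of a x] assms(2) mult_right_mono[of "norm a" 1 "norm x"] by (intro power_mono) auto
  then show ?thesis using assms sub
    by (auto simp: effects_def positive_op_def quad_adj_comp comp_mem adj simp del: blinfun_apply_blinfun_compose)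
qed

text \<open>The C*-identity: \<open>(norm (a x))\<^sup>2\<close> is the quadratic form of
  \<open>op_adjoint a o\<^sub>L a\<close> at \<open>x\<close>.\<close>

lemma norm_adj_comp:
  assumes "a \<in> M" shows "norm (op_adjoint a o\<^sub>L a) = (norm a)\<^sup>2"
proof (rule antisym)
  show "norm (op_adjoint a o\<^sub>L a) \<le> (norm a)\<^sup>2"
    using norm_blinfun_compose[of "op_adjoint a" a] norm_adj[OF assms] by (simp add: power2_eq_square)
  let ?k = "norm (op_adjoint a o\<^sub>L a)"
  have "norm a \<le> sqrt ?k"
  proof (rule norm_blinfun_bound)
    fix x
    have "(norm (a x))\<^sup>2 = cmod (cinner ((op_adjoint a o\<^sub>L a) x) x)"
      unfolding quad_adj_comp[OF assms] by (simp add: norm_power)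
    also have "\<dots> \<le> norm ((op_adjoint a o\<^sub>L a) x) * norm x" by (rule cinner_cauchy_schwarz)
    also have "\<dots> \<le> (?k * norm x) * norm x" by (intro mult_right_mono norm_blinfun) simp
    also have "\<dots> = (sqrt ?k * norm x)\<^sup>2" by (simp add: power_mult_distrib power2_eq_square)
    finally show "norm (a x) \<le> sqrt ?k * norm x" by (rule power2_le_imp_le) simp
  qed simp
  then have "(norm a)\<^sup>2 \<le> (sqrt ?k)\<^sup>2" by (intro power_mono) auto
  then show "(norm a)\<^sup>2 \<le> ?k" by simp
qed

text \<open>Inverts \<open>A = id_blinfun + h\<close> by Banach's fixed point theorem. The real part
  of the form of \<open>A\<close> is at least that of the identity, so
  \<open>z - t *\<^sub>R A z + t *\<^sub>R y\<close> contracts in \<open>z\<close> for small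
  \<open>t\<close>, and its fixed points solve \<open>A z = y\<close>.\<close>

lemma positive_op_resolvent:
  assumes h: "h \<in> M" "positive_op h"
  shows "\<exists>b\<in>M. \<forall>y. b y + h (b y) = y"
proof -
  define A where "A = id_blinfun + h"
  have AM: "A \<in> M" unfolding A_def using h by blast
  have Ax: "A x = x + h x" for x by (simp add: A_def blinfun.add_left)
  have lower: "(norm x)\<^sup>2 \<le> Re (cinner (A x) x)" for x
    using positive_op_nonneg[OF h(2), of x] by (simp add: Ax cinner_algebra)
  define K where "K = norm A + 1"
  have K: "K \<ge> 1" "K > 0" "norm A \<le> K" by (auto simp: K_def intro: add_nonneg_pos)
  \<comment> \<open>The squared contraction factor is at most 1 - 2 t +
    \<open>t\<^sup>2 * K\<^sup>2\<close>. This \<open>t\<close> minimises that bound, with minimum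
    \<open>1 - t\<close>; \<open>K\<close> is at least 1 so that \<open>t\<close> is at most
    1.\<close>
  define t where "t = 1 / K\<^sup>2"
  have t: "t > 0" "t * K\<^sup>2 = 1" using K by (auto simp: t_def)
  have t1: "t \<le> 1" using K by (simp add: t_def field_simps)
  define q where "q = sqrt (1 - t)"
  have q: "0 \<le> q" "q < 1" "q\<^sup>2 = 1 - t" using t t1 by (auto simp: q_def)
  have contr: "norm (z - t *\<^sub>R A z) \<le> q * norm z" for z
  proof -
    have "(norm (A z))\<^sup>2 \<le> (K * norm z)\<^sup>2"
      using norm_blinfun[of A z] K(3) mult_right_mono[of "norm A" K "norm z"] by (intro power_mono) auto
    then have "t\<^sup>2 * (norm (A z))\<^sup>2 \<le> t\<^sup>2 * (K * norm z)\<^sup>2" by (intro mult_left_mono) auto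
    also have "\<dots> = (t * K\<^sup>2) * t * (norm z)\<^sup>2" by (simp add: power2_eq_square)
    finally have 1: "t\<^sup>2 * (norm (A z))\<^sup>2 \<le> t * (norm z)\<^sup>2" using t by simp
    have "(norm (z - t *\<^sub>R A z))\<^sup>2 = (norm z)\<^sup>2 - 2 * (t * Re (cinner (A z) z)) + t\<^sup>2 * (norm (A z))\<^sup>2"
      by (simp add: norm_diff_square cinner_scaleR_right Re_cinner_commute[of z] power_mult_distrib)
    also have "\<dots> \<le> (norm z)\<^sup>2 - 2 * (t * (norm z)\<^sup>2) + t * (norm z)\<^sup>2"
      using 1 mult_left_mono[OF lower[of z], of t] t by linarith
    also have "\<dots> = (q * norm z)\<^sup>2" by (simp add: q power_mult_distrib algebra_simps)
    finally show ?thesis by (rule power2_le_imp_le) (simp add: q)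
  qed
  have ex: "\<exists>!z. A z = y" for y
  proof -
    have "\<exists>!z. z - t *\<^sub>R A z + t *\<^sub>R y = z"
    proof (rule banach_fix_type[OF q(1,2)], intro allI)
      fix u v
      have "(u - t *\<^sub>R A u + t *\<^sub>R y) - (v - t *\<^sub>R A v + t *\<^sub>R y) = (u - v) - t *\<^sub>R A (u - v)"
        by (simp add: blinfun.diff_right algebra_simps)
      then show "dist (u - t *\<^sub>R A u + t *\<^sub>R y) (v - t *\<^sub>R A v + t *\<^sub>R y) \<le> q * dist u v"
        using contr[of "u - v"] by (simp only: dist_norm)
    qed
    moreover have "z - t *\<^sub>R A z + t *\<^sub>R y = z \<longleftrightarrow> A z = y" for z
      using t(1) by (auto simp: algebra_simps)
    ultimately show ?thesis by simp
  qed
  define b where "b y = (THE z. A z = y)" for y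
  have Ab: "A (b y) = y" for y unfolding b_def using theI'[OF ex[of y]] .
  have bI: "A z = y \<Longrightarrow> b y = z" for y z using ex Ab by blast
  have nb: "norm (b y) \<le> norm y" for y
  proof -
    have "(norm (b y))\<^sup>2 \<le> Re (cinner y (b y))" using lower[of "b y"] Ab by simp
    also have "\<dots> \<le> norm y * norm (b y)"
      using abs_Re_le_cmod[of "cinner y (b y)"] cinner_cauchy_schwarz[of y "b y"] by linarith
    finally show ?thesis by (cases "b y = 0") (auto simp: power2_eq_square)
  qed
  have bl: "bounded_linear b"
  proof (rule bounded_linear_intro[where K = 1])
    show "b (x + y) = b x + b y" for x y by (rule bI) (simp add: blinfun.add_right Ab)
    show "b (r *\<^sub>R x) = r *\<^sub>R b x" for r x by (rule bI) (simp add: blinfun.scaleR_right Ab)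
  qed (simp add: nb)
  note Bb = bounded_linear_Blinfun_apply[OF bl]
  have bc: "b (c *\<^sub>C x) = c *\<^sub>C b x" for c x by (rule bI) (simp add: scaleC_mem[OF AM] Ab)
  have "Blinfun b \<in> M"
  proof (rule memI)
    show "Blinfun b \<in> bounded_ops" by (simp add: bounded_ops_def Bb bc)
    fix S x assume "S \<in> commutant M"
    \<comment> \<open>\<open>S\<close> commutes with \<open>A\<close>, so \<open>S (b x)\<close>
      solves the equation that characterises \<open>b (S x)\<close>.\<close>
    then show "Blinfun b (S x) = S (Blinfun b x)"
      unfolding Bb by (intro bI) (metis commutant_apply AM Ab)
  qed
  moreover have "b y + h (b y) = y" for y using Ab[of y] by (simp add: Ax)
  ultimately show ?thesis by (metis Bb)
qed

text \<open>The parallel sum \<open>c = h(1 + h)\<^sup>-\<^sup>1\<close> of \<open>h\<close> and \<open>1\<close>: a truncation of \<open>h\<close> to \<open>[0, 1]\<close>.\<close>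

lemma positive_op_truncation:
  assumes h: "h \<in> M" "positive_op h"
  shows "\<exists>c\<in>effects M. (\<forall>x. quad c x \<le> quad h x) \<and>
    (\<forall>a\<in>effects M. \<forall>l>0. (\<forall>x. l * quad a x \<le> quad h x) \<longrightarrow>
       (\<forall>y. quad a y \<le> quad c y + (norm y)\<^sup>2 / l))"
proof -
  obtain b where bM: "b \<in> M" and b: "\<And>y. b y + h (b y) = y" using positive_op_resolvent[OF h] by metis
  define c where "c = id_blinfun - b"
  have cM: "c \<in> M" unfolding c_def using bM by blast
  have cy: "c y = h (b y)" for y using b[of y] by (simp add: c_def blinfun.diff_left) (metis add_diff_cancel_left')
  have qc: "cinner (c y) y = cinner (h (b y)) (b y) + of_real ((norm (h (b y)))\<^sup>2)" for y
  proof -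
    have "cinner (c y) y = cinner (h (b y)) (b y + h (b y))" using b[of y] by (simp add: cy)
    then show ?thesis by (simp add: cinner_algebra cinner_self)
  qed
  have hp: "Im (cinner (h x) x) = 0" "0 \<le> quad h x" for x using h(2) by (auto simp: positive_op_def)
  have ny: "(norm y)\<^sup>2 = (norm (b y))\<^sup>2 + 2 * quad h (b y) + (norm (h (b y)))\<^sup>2" for y
    using norm_add_square[of "b y" "h (b y)"] b[of y] by (simp add: Re_cinner_commute[of "b y"])
  have c1: "quad c y \<le> (norm y)\<^sup>2" for y unfolding qc ny[of y] using hp(2)[of "b y"] by simp
  have ceff: "c \<in> effects M"
    unfolding effects_def positive_op_def using cM sub c1 by (auto simp: qc hp)
  have ch: "quad c x \<le> quad h x" for x
  proof -
    define z where "z = b x"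
    have x: "x = z + h z" using b[of x] by (simp add: z_def)
    have "cinner (h (h z)) z = cinner (h z) (h z)" by (rule positive_op_selfadjoint[OF h(2)])
    then have "quad h x = quad h z + 2 * (norm (h z))\<^sup>2 + quad h (h z)"
      by (simp add: x blinfun.add_right cinner_algebra)
    then show ?thesis using hp(2)[of "h z"] by (simp add: qc z_def)
  qed
  have "quad a y \<le> quad c y + (norm y)\<^sup>2 / l"
    if a: "a \<in> effects M" and l: "l > 0" and le: "\<And>x. l * quad a x \<le> quad h x" for a l y
  proof -
    define z where "z = b y"
    define w where "w = h z"
    have y: "y = w + z" using b[of y] by (simp add: z_def w_def add.commute)
    have pa: "positive_op a" using a by (simp add: effects_def)
    \<comment> \<open>With \<open>y = w + z\<close> and \<open>w = h z\<close>, positivity of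
      \<open>a\<close> at \<open>w - l z\<close> bounds the cross term and yields
      \<open>l * quad a y \<le> (1 + l) * (quad a w + l * quad a z)\<close>. The two summands are at
      most \<open>(norm w)\<^sup>2\<close> and \<open>quad h z\<close>, whose sum is exactly
      \<open>quad c y\<close>.\<close>
    have "0 \<le> quad a (w - of_real l *\<^sub>C z)" by (rule positive_op_nonneg[OF pa])
    also have "\<dots> = quad a w - 2 * l * Re (cinner (a w) z) + l\<^sup>2 * quad a z"
      by (subst quad_diff_scale[OF pa]) (simp add: mult.assoc)
    finally have 1: "2 * l * Re (cinner (a w) z) \<le> quad a w + l\<^sup>2 * quad a z" by simp
    have "quad a y = quad a w + 2 * Re (cinner (a w) z) + quad a z"
      using quad_diff_scale[OF pa, of w "-1" z] by (simp add: y scaleC_minus1)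
    then have "l * quad a y \<le> (1 + l) * (quad a w + l * quad a z)"
      using 1 by (simp add: power2_eq_square algebra_simps)
    also have "\<dots> \<le> (1 + l) * ((norm w)\<^sup>2 + quad h z)"
      using l a le[of z] by (intro mult_left_mono add_mono) (auto simp: effects_def)
    also have "(norm w)\<^sup>2 + quad h z = quad c y" by (simp add: qc z_def w_def)
    \<comment> \<open>Absorbing the surplus \<open>quad c y\<close> into
      \<open>(norm y)\<^sup>2\<close> is what produces the error term
      \<open>(norm y)\<^sup>2 / l\<close>.\<close>
    also have "(1 + l) * quad c y \<le> l * quad c y + (norm y)\<^sup>2" using c1[of y] by (simp add: algebra_simps)
    finally have "l * quad a y \<le> l * (quad c y + (norm y)\<^sup>2 / l)" using l by (simp add: algebra_simps)
    then show ?thesis using l by simp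
  qed
  then show ?thesis using ceff ch by blast
qed

end

section \<open>Hahn--Banach\<close>

locale complex_subspace = vector_space smul
  for smul :: "complex \<Rightarrow> 'x::ab_group_add \<Rightarrow> 'x" +
  fixes X :: "'x set"
  assumes subspace_X: "subspace X"
begin

lemmas X_zero = subspace_0[OF subspace_X]
  and X_add = subspace_add[OF subspace_X]
  and X_scale = subspace_scale[OF subspace_X]
  and X_neg = subspace_neg[OF subspace_X]
  and X_diff = subspace_diff[OF subspace_X]

definition sublinear :: "('x \<Rightarrow> real) \<Rightarrow> bool" where
  "sublinear q \<longleftrightarrow> (\<forall>x\<in>X. \<forall>y\<in>X. q (x + y) \<le> q x + q y) \<and>
     (\<forall>t>0. \<forall>x\<in>X. q (smul (of_real t) x) = t * q x)"

lemma sublinear_add: "sublinear q \<Longrightarrow> x \<in> X \<Longrightarrow> y \<in> X \<Longrightarrow> q (x + y) \<le> q x + q y"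
  and sublinear_scale: "sublinear q \<Longrightarrow> x \<in> X \<Longrightarrow> t > 0 \<Longrightarrow> q (smul (of_real t) x) = t * q x"
  by (auto simp: sublinear_def)

lemma sublinear_zero: "sublinear q \<Longrightarrow> q 0 = 0"
  using sublinear_scale[of q 0 2] X_zero by simp

lemma sublinear_neg: "sublinear q \<Longrightarrow> x \<in> X \<Longrightarrow> - q (- x) \<le> q x"
  using sublinear_add[of q x "-x"] X_neg[of x] sublinear_zero[of q] by simp

text \<open>A pair \<open>(z, s)\<close> in the cone \<open>K\<close> stands for the constraint \<open>s \<le> g z\<close> on a linear
  functional \<open>g \<le> p\<close>.\<close>

definition constraint_cone :: "('x \<Rightarrow> real) \<Rightarrow> ('x \<times> real) set \<Rightarrow> bool" where
  "constraint_cone p K \<longleftrightarrow> (0, 0) \<in> K \<and>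
     (\<forall>z s z' s'. (z, s) \<in> K \<longrightarrow> (z', s') \<in> K \<longrightarrow> (z + z', s + s') \<in> K) \<and>
     (\<forall>t>0. \<forall>z s. (z, s) \<in> K \<longrightarrow> (smul (of_real t) z, t * s) \<in> K) \<and>
     (\<forall>z s. (z, s) \<in> K \<longrightarrow> z \<in> X \<and> s \<le> p z)"

text \<open>\<open>r\<close> is an infimal convolution of \<open>p\<close> with the constraints. A
  linear \<open>g \<le> r\<close> meets all of them, since
  \<open>- g z = g (- z) \<le> r (- z) \<le> - s\<close>; lower bounds are thus traded for a smaller
  upper bound.\<close>

lemma sublinear_sandwich:
  assumes p: "sublinear p" and K: "constraint_cone p K"
  shows "\<exists>r. sublinear r \<and> (\<forall>x\<in>X. r x \<le> p x) \<and> (\<forall>z s. (z, s) \<in> K \<longrightarrow> r (- z) \<le> - s)"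
proof -
  have K0: "(0, 0) \<in> K" and Kadd: "\<And>z s z' s'. (z, s) \<in> K \<Longrightarrow> (z', s') \<in> K \<Longrightarrow> (z + z', s + s') \<in> K"
    and Ksc: "\<And>t z s. t > 0 \<Longrightarrow> (z, s) \<in> K \<Longrightarrow> (smul (of_real t) z, t * s) \<in> K"
    and KX: "\<And>z s. (z, s) \<in> K \<Longrightarrow> z \<in> X" and Kp: "\<And>z s. (z, s) \<in> K \<Longrightarrow> s \<le> p z"
    using K by (auto simp: constraint_cone_def)
  define r where "r x = (INF k\<in>K. p (x + fst k) - snd k)" for x
  have bdd: "bdd_below ((\<lambda>k. p (x + fst k) - snd k) ` K)" if x: "x \<in> X" for x
  proof (rule bdd_belowI2[of _ "- p (- x)"])
    fix k assume "k \<in> K"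
    then obtain z s where k: "k = (z, s)" "(z, s) \<in> K" by (cases k) auto
    have "p z = p ((x + z) + (- x))" by simp
    also have "\<dots> \<le> p (x + z) + p (- x)"
      by (rule sublinear_add[OF p]) (use x KX k X_add X_neg in auto)
    finally show "- p (- x) \<le> p (x + fst k) - snd k" using Kp k by force
  qed
  have rle: "r x \<le> p (x + z) - s" if "x \<in> X" "(z, s) \<in> K" for x z s
    unfolding r_def using cINF_lower[OF bdd[OF that(1)] that(2)] by simp
  have rge: "c \<le> r x" if "\<And>z s. (z, s) \<in> K \<Longrightarrow> c \<le> p (x + z) - s" for x c
    unfolding r_def by (rule cINF_greatest) (use K0 that in auto)
  have "r (x + y) \<le> r x + r y" if x: "x \<in> X" and y: "y \<in> X" for x y
  proof -
    have 1: "r (x + y) \<le> (p (x + z) - s) + (p (y + z') - s')" if k: "(z, s) \<in> K" "(z', s') \<in> K" for z s z' s'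
    proof -
      have "r (x + y) \<le> p (x + y + (z + z')) - (s + s')" by (rule rle[OF X_add[OF x y] Kadd[OF k]])
      also have "x + y + (z + z') = (x + z) + (y + z')" by simp
      also have "p \<dots> \<le> p (x + z) + p (y + z')"
        by (rule sublinear_add[OF p]) (use x y KX k X_add in auto)
      finally show ?thesis by simp
    qed
    have "r (x + y) - (p (x + z) - s) \<le> r y" if "(z, s) \<in> K" for z s
      by (rule rge) (use 1[OF that] in fastforce)
    then have "r (x + y) - r y \<le> r x" by (intro rge) fastforce
    then show ?thesis by simp
  qed
  moreover have "r (smul (of_real t) x) = t * r x" if x: "x \<in> X" and t: "t > 0" for x t
  proof -
    have le: "r (smul (of_real t) x) \<le> t * r x" if x: "x \<in> X" and t: "t > 0" for x t
    proof -
      have "r (smul (of_real t) x) / t \<le> r x"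
      proof (rule rge)
        fix z s assume k: "(z, s) \<in> K"
        have "r (smul (of_real t) x) \<le> p (smul (of_real t) x + smul (of_real t) z) - t * s"
          by (rule rle[OF X_scale[OF x] Ksc[OF t k]])
        also have "\<dots> = t * (p (x + z) - s)"
          using sublinear_scale[OF p _ t, of "x + z"] X_add[OF x KX[OF k]]
          by (simp add: scale_right_distrib algebra_simps)
        finally show "r (smul (of_real t) x) / t \<le> p (x + z) - s" using t by (simp add: field_simps)
      qed
      then show ?thesis using t by (simp add: field_simps)
    qed
    have "r (smul (of_real (inverse t)) (smul (of_real t) x)) \<le> inverse t * r (smul (of_real t) x)"
      by (rule le) (use t x X_scale in auto)
    moreover have "smul (of_real (inverse t)) (smul (of_real t) x) = x" using t by simp
    ultimately have "t * r x \<le> r (smul (of_real t) x)" using t by (simp add: field_simps)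
    then show ?thesis using le[OF x t] by simp
  qed
  ultimately have "sublinear r" by (auto simp: sublinear_def)
  moreover have "r x \<le> p x" if "x \<in> X" for x using rle[OF that K0] by simp
  moreover have "r (- z) \<le> - s" if "(z, s) \<in> K" for z s
    using rle[OF X_neg[OF KX[OF that]] that] sublinear_zero[OF p] by simp
  ultimately show ?thesis by blast
qed

text \<open>Zorn's lemma: a chain is bounded by its pointwise infimum, which is finite because
  \<open>- p (- x)\<close> lies below every member.\<close>

lemma minimal_sublinear_below:
  assumes p: "sublinear p"
  shows "\<exists>m. sublinear m \<and> (\<forall>x\<in>X. m x \<le> p x) \<and>
    (\<forall>q. sublinear q \<longrightarrow> (\<forall>x\<in>X. q x \<le> m x) \<longrightarrow> (\<forall>x\<in>X. q x = m x))"
proof -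
  define ext where "ext q x = (if x \<in> X then q x else 0)" for q :: "'x \<Rightarrow> real" and x
  define A where "A = {q. sublinear q \<and> (\<forall>x\<in>X. q x \<le> p x) \<and> (\<forall>x. x \<notin> X \<longrightarrow> q x = 0)}"
  \<comment> \<open>The order is reversed, so that Zorn's maximal element is a minimal functional.
    Antisymmetry needs the normalisation to 0 outside \<open>X\<close>.\<close>
  define P where "P q q' \<longleftrightarrow> (\<forall>x. q' x \<le> q x)" for q q' :: "'x \<Rightarrow> real"
  have ext: "sublinear q \<Longrightarrow> (\<forall>x\<in>X. q x \<le> p x) \<Longrightarrow> ext q \<in> A" for q
    by (auto simp: A_def ext_def sublinear_def X_add X_scale)
  have "\<exists>m \<in> A. \<forall>a \<in> A. P m a \<longrightarrow> a = m"
  proof (rule predicate_Zorn)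
    show "partial_order_on A (relation_of P A)"
      by (rule partial_order_on_relation_ofI) (auto simp: P_def fun_eq_iff intro: order.trans antisym)
    fix C assume C: "C \<in> Chains (relation_of P A)"
    have CA: "q \<in> A" if "q \<in> C" for q using C that by (auto simp: Chains_def relation_of_def)
    have tot: "P q q' \<or> P q' q" if "q \<in> C" "q' \<in> C" for q q'
      using C that by (auto simp: Chains_def relation_of_def)
    show "\<exists>u\<in>A. \<forall>a\<in>C. P a u"
    proof (cases "C = {}")
      case True then show ?thesis using ext[OF p] by auto
    next
      case False
      define u where "u x = (INF q\<in>C. q x)" for x
      have bdd: "bdd_below ((\<lambda>q. q x) ` C)" for x
      proof (cases "x \<in> X")
        case True
        show ?thesis
        proof (rule bdd_belowI2[of _ "- p (- x)"])
          fix q assume "q \<in> C"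
          then have "q \<in> A" by (rule CA)
          then show "- p (- x) \<le> q x"
            using sublinear_neg[of q x] True X_neg[of x] by (force simp: A_def)
        qed
      next
        case False
        have "q x = 0" if "q \<in> C" for q using CA[OF that] False by (simp add: A_def)
        then show ?thesis by (intro bdd_belowI2[of _ 0]) (metis order.refl)
      qed
      have ule: "u x \<le> q x" if "q \<in> C" for q x unfolding u_def by (rule cINF_lower[OF bdd that])
      have uge: "c \<le> u x" if "\<And>q. q \<in> C \<Longrightarrow> c \<le> q x" for c x
        unfolding u_def by (rule cINF_greatest[OF False that])
      have uadd: "u (x + y) \<le> u x + u y" if x: "x \<in> X" "y \<in> X" for x y
      proof -
        have 1: "u (x + y) \<le> q x + q' y" if q: "q \<in> C" "q' \<in> C" for q q'
        proof -
          \<comment> \<open>Two members of a chain are comparable, and the smaller one bounds both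
            terms at once.\<close>
          obtain q'' where q'': "q'' \<in> C" "P q q''" "P q' q''"
            using tot[OF q] q by (cases "P q q'") (auto simp: P_def)
          have "u (x + y) \<le> q'' (x + y)" by (rule ule[OF q''(1)])
          also have "\<dots> \<le> q'' x + q'' y" using CA[OF q''(1)] x by (auto simp: A_def sublinear_add)
          finally show ?thesis using q''(2,3) unfolding P_def by (meson add_mono order.trans)
        qed
        have "u (x + y) - q x \<le> u y" if "q \<in> C" for q by (rule uge) (use 1[OF that] in fastforce)
        then have "u (x + y) - u y \<le> u x" by (intro uge) fastforce
        then show ?thesis by simp
      qed
      have usc: "u (smul (of_real t) x) = t * u x" if x: "x \<in> X" and t: "t > 0" for x t
      proof (rule antisym)
        have qs: "q (smul (of_real t) x) = t * q x" if "q \<in> C" for q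
          using CA[OF that] x t by (auto simp: A_def sublinear_scale)
        have "u (smul (of_real t) x) / t \<le> u x"
        proof (rule uge)
          fix q assume q: "q \<in> C"
          show "u (smul (of_real t) x) / t \<le> q x" using ule[OF q, of "smul (of_real t) x"] qs[OF q] t
            by (simp add: field_simps)
        qed
        then show "u (smul (of_real t) x) \<le> t * u x" using t by (simp add: field_simps)
        show "t * u x \<le> u (smul (of_real t) x)"
        proof (rule uge)
          fix q assume q: "q \<in> C"
          show "t * u x \<le> q (smul (of_real t) x)" using ule[OF q, of x] qs[OF q] t by simp
        qed
      qed
      obtain q0 where q0: "q0 \<in> C" using False by blast
      have "u x \<le> p x" if "x \<in> X" for x
        using ule[OF q0, of x] CA[OF q0] that unfolding A_def by force
      moreover have "u x = 0" if "x \<notin> X" for x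
      proof -
        have q: "q x = 0" if "q \<in> C" for q using CA[OF that] \<open>x \<notin> X\<close> by (simp add: A_def)
        show ?thesis using ule[OF q0, of x] uge[of 0 x] q q0 by fastforce
      qed
      ultimately have "u \<in> A" using uadd usc by (auto simp: A_def sublinear_def)
      then show ?thesis using ule by (auto simp: P_def)
    qed
  qed
  then obtain m where m: "m \<in> A" and min: "\<And>a. a \<in> A \<Longrightarrow> P m a \<Longrightarrow> a = m" by blast
  have "q x = m x" if q: "sublinear q" "\<forall>x\<in>X. q x \<le> m x" and x: "x \<in> X" for q x
  proof -
    have "\<forall>x\<in>X. q x \<le> p x" using m q by (auto simp: A_def intro: order.trans)
    then have "ext q = m" using q m by (intro min ext) (auto simp: P_def ext_def A_def)
    then have "ext q x = m x" by simp
    then show ?thesis using x by (simp add: ext_def)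
  qed
  then show ?thesis using m by (auto simp: A_def)
qed

text \<open>With the ray through \<open>y\<close> as constraint cone, the sandwich gives a sublinear
  \<open>r\<close> below \<open>m\<close> with \<open>r (- y) \<le> - m y\<close>, and minimality
  forces \<open>r = m\<close> on \<open>X\<close>. Oddness is what upgrades sublinear to
  linear.\<close>

lemma minimal_sublinear_odd:
  assumes m: "sublinear m" and y: "y \<in> X"
    and min: "\<And>q. sublinear q \<Longrightarrow> (\<forall>x\<in>X. q x \<le> m x) \<Longrightarrow> (\<forall>x\<in>X. q x = m x)"
  shows "m (- y) = - m y"
proof -
  define K where "K = {(smul (of_real t) y, t * m y) | t. t \<ge> 0}"
  have "constraint_cone m K"
    unfolding constraint_cone_def
  proof (intro conjI allI impI)
    show "(0, 0) \<in> K" unfolding K_def by (rule CollectI, rule exI[of _ 0]) simp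
    fix z s assume zs: "(z, s) \<in> K"
    then obtain t where t: "t \<ge> 0" "z = smul (of_real t) y" "s = t * m y" by (auto simp: K_def)
    show "z \<in> X" using t y X_scale by simp
    show "s \<le> m z"
      using t sublinear_scale[OF m y, of t] sublinear_zero[OF m] by (cases "t = 0") auto
    show "(smul (of_real r) z, r * s) \<in> K" if "r > 0" for r
      unfolding K_def by (rule CollectI, rule exI[of _ "r * t"]) (use t that in simp)
    fix z' s' assume "(z', s') \<in> K"
    then obtain t' where t': "t' \<ge> 0" "z' = smul (of_real t') y" "s' = t' * m y" by (auto simp: K_def)
    show "(z + z', s + s') \<in> K"
      unfolding K_def by (rule CollectI, rule exI[of _ "t + t'"])
        (use t t' in \<open>simp add: scale_left_distrib distrib_right\<close>)
  qed
  from sublinear_sandwich[OF m this] obtain r where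
    r: "sublinear r" "\<forall>x\<in>X. r x \<le> m x" "\<And>z s. (z, s) \<in> K \<Longrightarrow> r (- z) \<le> - s" by blast
  have "(y, m y) \<in> K" unfolding K_def by (rule CollectI, rule exI[of _ 1]) simp
  then have "r (- y) \<le> - m y" by (rule r)
  moreover have "r (- y) = m (- y)" using min[OF r(1,2)] y X_neg by blast
  ultimately show ?thesis using sublinear_neg[OF m y] by simp
qed

text \<open>Hahn-Banach with lower bounds built in: a minimal sublinear functional below the
  convolution \<open>r\<close> is odd, hence linear, and the bounds of \<open>r\<close> at
  \<open>- z\<close> become lower bounds at \<open>z\<close>.\<close>

theorem real_sandwich:
  assumes p: "sublinear p" and K: "constraint_cone p K"
  shows "\<exists>g. (\<forall>x\<in>X. \<forall>y\<in>X. g (x + y) = g x + g y) \<and> (\<forall>t. \<forall>x\<in>X. g (smul (of_real t) x) = t * g x) \<and>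
    (\<forall>x\<in>X. g x \<le> p x) \<and> (\<forall>z s. (z, s) \<in> K \<longrightarrow> s \<le> (g z :: real))"
proof -
  obtain r where r: "sublinear r" "\<forall>x\<in>X. r x \<le> p x" "\<And>z s. (z, s) \<in> K \<Longrightarrow> r (- z) \<le> - s"
    using sublinear_sandwich[OF p K] by blast
  obtain g where g: "sublinear g" "\<forall>x\<in>X. g x \<le> r x"
    and min: "\<And>q. sublinear q \<Longrightarrow> (\<forall>x\<in>X. q x \<le> g x) \<Longrightarrow> (\<forall>x\<in>X. q x = g x)"
    using minimal_sublinear_below[OF r(1)] by blast
  have odd: "g (- y) = - g y" if "y \<in> X" for y by (rule minimal_sublinear_odd[OF g(1) that min])
  have "g (x + y) = g x + g y" if x: "x \<in> X" and y: "y \<in> X" for x y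
    using sublinear_add[OF g(1) x y] sublinear_add[OF g(1) X_add[OF x y] X_neg[OF y]] odd[OF y] by simp
  moreover have "g (smul (of_real t) x) = t * g x" if x: "x \<in> X" for t x
  proof -
    consider "t > 0" | "t = 0" | "t < 0" by linarith
    then show ?thesis
    proof cases
      case 3
      have "g (- smul (of_real (- t)) x) = - (- t * g x)"
        using odd[OF X_scale[OF x]] sublinear_scale[OF g(1) x, of "-t"] 3 by simp
      then show ?thesis by (simp add: scale_minus_left)
    qed (use sublinear_scale[OF g(1) x] sublinear_zero[OF g(1)] in auto)
  qed
  moreover have "g x \<le> p x" if "x \<in> X" for x using that g(2) r(2) by (blast intro: order.trans)
  moreover have "s \<le> g z" if "(z, s) \<in> K" for z s
  proof -
    have "z \<in> X" using that K by (auto simp: constraint_cone_def)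
    then show ?thesis using g(2) r(3)[OF that] odd[of z] X_neg[of z] by fastforce
  qed
  ultimately show ?thesis by blast
qed

definition linear_functional :: "('x \<Rightarrow> complex) \<Rightarrow> bool" where
  "linear_functional f \<longleftrightarrow> (\<forall>x\<in>X. \<forall>y\<in>X. f (x + y) = f x + f y) \<and> (\<forall>c. \<forall>x\<in>X. f (smul c x) = c * f x)"

definition seminorm :: "('x \<Rightarrow> real) \<Rightarrow> bool" where
  "seminorm p \<longleftrightarrow> (\<forall>x\<in>X. \<forall>y\<in>X. p (x + y) \<le> p x + p y) \<and> (\<forall>c. \<forall>x\<in>X. p (smul c x) = cmod c * p x)"

lemma seminorm_sublinear: "seminorm p \<Longrightarrow> sublinear p"
  by (auto simp: seminorm_def sublinear_def)

lemma cmod_le_seminorm: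
  assumes f: "linear_functional f" and p: "seminorm p" and re: "\<And>x. x \<in> X \<Longrightarrow> Re (f x) \<le> p x" and x: "x \<in> X"
  shows "cmod (f x) \<le> p x"
proof (cases "f x = 0")
  case True
  have "f (smul (-1) x) = 0" using True f x unfolding linear_functional_def by (metis mult_zero_right)
  then have "0 \<le> p x + p (smul (-1) x)"
    using True re[OF x] re[OF X_scale[OF x], of "-1"] by simp
  moreover have "p (smul (-1) x) = p x" using p x unfolding seminorm_def by (metis mult_1 norm_minus_cancel norm_one)
  ultimately show ?thesis using True p x by (simp add: seminorm_def)
next
  case False
  define c where "c = cnj (f x) / of_real (cmod (f x))"
  have c: "cmod c = 1" using False by (simp add: c_def norm_divide)
  have "c * f x = of_real (cmod (f x))"
    using False by (simp add: c_def mult.commute[of "cnj (f x)"] complex_norm_square[symmetric] power2_eq_square)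
  then have "cmod (f x) = Re (f (smul c x))" using f x by (simp add: linear_functional_def)
  also have "\<dots> \<le> p (smul c x)" by (rule re[OF X_scale[OF x]])
  also have "\<dots> = p x" using p x c by (simp add: seminorm_def)
  finally show ?thesis .
qed

theorem complex_sandwich:
  assumes p: "seminorm p" and K: "constraint_cone p K"
  shows "\<exists>f. linear_functional f \<and> (\<forall>x\<in>X. cmod (f x) \<le> p x) \<and> (\<forall>z s. (z, s) \<in> K \<longrightarrow> s \<le> Re (f z))"
proof -
  obtain g where g1: "\<And>x y. x \<in> X \<Longrightarrow> y \<in> X \<Longrightarrow> g (x + y) = g x + g y"
    and g2: "\<And>t x. x \<in> X \<Longrightarrow> g (smul (of_real t) x) = t * g x"
    and gp: "\<And>x. x \<in> X \<Longrightarrow> g x \<le> p x" and gK: "\<And>z s. (z, s) \<in> K \<Longrightarrow> s \<le> g z"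
    using real_sandwich[OF seminorm_sublinear[OF p] K] by blast
  \<comment> \<open>The complex-linear functional with real part \<open>g\<close>.\<close>
  define f where "f x = Complex (g x) (- g (smul \<i> x))" for x
  have fadd: "f (x + y) = f x + f y" if "x \<in> X" "y \<in> X" for x y
    using that by (simp add: f_def scale_right_distrib g1 X_scale complex_eq_iff)
  have fR: "f (smul (of_real t) x) = of_real t * f x" if "x \<in> X" for t x
  proof -
    have "smul \<i> (smul (of_real t) x) = smul (of_real t) (smul \<i> x)" by (simp add: mult.commute)
    then show ?thesis using that by (simp only: f_def g2 X_scale) (simp add: complex_eq_iff)
  qed
  have fi: "f (smul \<i> x) = \<i> * f x" if "x \<in> X" for x
  proof -
    have "g (smul \<i> (smul \<i> x)) = - g x" using g2[OF that, of "-1"] by simp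
    then show ?thesis by (simp add: f_def complex_eq_iff)
  qed
  have "f (smul c x) = c * f x" if x: "x \<in> X" for c x
  proof -
    have "smul c x = smul (of_real (Re c)) x + smul \<i> (smul (of_real (Im c)) x)"
      by (simp add: scale_left_distrib[symmetric] complex_eq[symmetric])
    also have "f \<dots> = of_real (Re c) * f x + \<i> * (of_real (Im c) * f x)"
      using x by (simp only: fadd fi fR X_scale)
    also have "\<dots> = c * f x" by (subst (3) complex_eq[of c]) (simp add: algebra_simps)
    finally show ?thesis .
  qed
  then have f: "linear_functional f" using fadd by (auto simp: linear_functional_def)
  show ?thesis
  proof (intro exI[of _ f] conjI ballI allI impI f)
    show "cmod (f x) \<le> p x" if "x \<in> X" for x
      by (rule cmod_le_seminorm[OF f p _ that]) (simp add: f_def gp)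
  qed (simp add: f_def gK)
qed

text \<open>The cone is the hypograph of \<open>Re f - q\<close>: a functional \<open>g\<close>
  between it and \<open>p\<close> has \<open>Re (f - g) \<le> q\<close>, so \<open>f - g\<close> is
  the second summand. This later peels off one vector at a time.\<close>

theorem functional_split:
  assumes f: "linear_functional f" and p: "seminorm p" and q: "seminorm q"
    and le: "\<And>x. x \<in> X \<Longrightarrow> cmod (f x) \<le> p x + q x"
  shows "\<exists>g h. linear_functional g \<and> linear_functional h \<and> (\<forall>x\<in>X. f x = g x + h x) \<and>
    (\<forall>x\<in>X. cmod (g x) \<le> p x) \<and> (\<forall>x\<in>X. cmod (h x) \<le> q x)"
proof -
  define K where "K = {(z, s). z \<in> X \<and> s \<le> Re (f z) - q z}"
  have fl: "f (x + y) = f x + f y" "f (smul c x) = c * f x" if "x \<in> X" "y \<in> X" for x y c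
    using f that by (auto simp: linear_functional_def)
  have ql: "q (x + y) \<le> q x + q y" "q (smul c x) = cmod c * q x" if "x \<in> X" "y \<in> X" for x y c
    using q that by (auto simp: seminorm_def)
  have "constraint_cone p K"
    unfolding constraint_cone_def
  proof (intro conjI allI impI)
    show "(0, 0) \<in> K"
      using fl(2)[OF X_zero X_zero, of 0] ql(2)[OF X_zero X_zero, of 0] by (simp add: K_def X_zero)
    fix z s assume zs: "(z, s) \<in> K"
    then show "z \<in> X" by (simp add: K_def)
    then show "s \<le> p z" using zs le[of z] complex_Re_le_cmod[of "f z"] by (simp add: K_def)
    show "(smul (of_real r) z, r * s) \<in> K" if "r > 0" for r
    proof -
      have "r * s \<le> r * (Re (f z) - q z)" using zs that by (intro mult_left_mono) (auto simp: K_def)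
      then show ?thesis
        using fl(2)[OF \<open>z \<in> X\<close> \<open>z \<in> X\<close>] ql(2)[OF \<open>z \<in> X\<close> \<open>z \<in> X\<close>] that X_scale[OF \<open>z \<in> X\<close>]
        by (simp add: K_def right_diff_distrib)
    qed
    fix z' s' assume "(z', s') \<in> K"
    then show "(z + z', s + s') \<in> K" using zs fl(1)[of z z'] ql(1)[of z z'] X_add by (simp add: K_def)
  qed
  from complex_sandwich[OF p this] obtain g where g: "linear_functional g" "\<forall>x\<in>X. cmod (g x) \<le> p x"
    and gK: "\<And>z s. (z, s) \<in> K \<Longrightarrow> s \<le> Re (g z)" by blast
  have h: "linear_functional (\<lambda>x. f x - g x)"
    using f g(1) by (auto simp: linear_functional_def algebra_simps)
  have "cmod (f x - g x) \<le> q x" if "x \<in> X" for x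
  proof (rule cmod_le_seminorm[OF h q _ that])
    fix y assume "y \<in> X"
    then show "Re (f y - g y) \<le> q y" using gK[of y "Re (f y) - q y"] by (simp add: K_def)
  qed
  then show ?thesis using g h by (intro exI[of _ g] exI[of _ "\<lambda>x. f x - g x"]) auto
qed

end

sublocale complex_banach_space \<subseteq> complex_subspace smul X
  by unfold_locales (rule subspace_carrier)

context complex_banach_space
begin

lemma seminorm_N: "seminorm N"
  by (simp add: seminorm_def norm_triangle norm_scale)

lemma dual_spaceI:
  assumes "linear_functional f" "\<And>x. x \<in> X \<Longrightarrow> cmod (f x) \<le> K * N x"
  shows "(\<lambda>x. if x \<in> X then f x else 0) \<in> dual_space smul X N"
  using assms X_add X_scale by (auto simp: dual_space_def linear_functional_def)

text \<open>The constraints live on the half-space of all \<open>v + t x\<close> with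
  \<open>v\<close> in \<open>V\<close> and \<open>t \<ge> 0\<close>, with value
  \<open>t * d\<close>; the distance hypothesis, rescaled by \<open>t\<close>, says precisely that
  they are compatible with \<open>N\<close>.\<close>

theorem separate_from_subspace:
  assumes V: "subspace V" "V \<subseteq> X" and x: "x \<in> X" and d: "0 \<le> d" "\<And>v. v \<in> V \<Longrightarrow> d \<le> N (x + v)"
  shows "\<exists>f\<in>dual_space smul X N. (\<forall>y\<in>X. cmod (f y) \<le> N y) \<and> (\<forall>v\<in>V. f v = 0) \<and> d \<le> Re (f x)"
proof -
  define K where "K = {(v + smul (of_real t) x, t * d) | v t. v \<in> V \<and> t \<ge> 0}"
  have KI: "v \<in> V \<Longrightarrow> t \<ge> 0 \<Longrightarrow> z = v + smul (of_real t) x \<Longrightarrow> s = t * d \<Longrightarrow> (z, s) \<in> K" for v t z s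
    by (auto simp: K_def)
  have "constraint_cone N K"
    unfolding constraint_cone_def
  proof (intro conjI allI impI)
    show "(0, 0) \<in> K" by (rule KI[of 0 0]) (auto simp: subspace_0[OF V(1)])
    fix z s assume zs: "(z, s) \<in> K"
    then obtain v t where t: "t \<ge> 0" "v \<in> V" "z = v + smul (of_real t) x" "s = t * d" by (auto simp: K_def)
    show zX: "z \<in> X" using t V x by (auto intro: X_add X_scale)
    show "s \<le> N z"
    proof (cases "t = 0")
      case False
      then have "t > 0" using t by simp
      have "z = smul (of_real t) (x + smul (of_real (inverse t)) v)"
        using \<open>t > 0\<close> t by (simp add: scale_right_distrib add.commute)
      moreover have "smul (of_real (inverse t)) v \<in> V" using V t subspace_scale by blast
      ultimately show ?thesis
        using d(2) \<open>t > 0\<close> norm_scale[of "x + smul (of_real (inverse t)) v" "of_real t"] x V X_add t by auto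
    qed (use t norm_nonneg[OF zX] in simp)
    show "(smul (of_real r) z, r * s) \<in> K" if "r > 0" for r
      by (rule KI[of "smul (of_real r) v" "r * t"])
        (use t that V subspace_scale in \<open>auto simp: scale_right_distrib\<close>)
    fix z' s' assume "(z', s') \<in> K"
    then obtain v' t' where t': "t' \<ge> 0" "v' \<in> V" "z' = v' + smul (of_real t') x" "s' = t' * d"
      by (auto simp: K_def)
    show "(z + z', s + s') \<in> K"
      by (rule KI[of "v + v'" "t + t'"])
        (use t t' V subspace_add in \<open>auto simp: scale_left_distrib distrib_right\<close>)
  qed
  from complex_sandwich[OF seminorm_N this] obtain f where f: "linear_functional f" "\<forall>x\<in>X. cmod (f x) \<le> N x"
    and fK: "\<And>z s. (z, s) \<in> K \<Longrightarrow> s \<le> Re (f z)" by blast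
  have "f v = 0" if v: "v \<in> V" for v
  proof -
    \<comment> \<open>The constraint only makes \<open>Re f\<close> nonnegative on \<open>V\<close>.
      As \<open>V\<close> is a complex subspace, the multiple of \<open>v\<close> by
      \<open>- cnj (f v)\<close> turns this into
      \<open>- (cmod (f v))\<^sup>2 \<ge> 0\<close>.\<close>
    have "smul (- cnj (f v)) v \<in> V" by (rule subspace_scale[OF V(1) v])
    then have "0 \<le> Re (f (smul (- cnj (f v)) v))" by (intro fK KI[of _ 0]) auto
    also have "f (smul (- cnj (f v)) v) = - cnj (f v) * f v" using f(1) v V unfolding linear_functional_def by blast
    also have "Re (- cnj (f v) * f v) = - (cmod (f v))\<^sup>2" by (simp add: cmod_power2) (simp add: power2_eq_square)
    finally show ?thesis by simp
  qed
  moreover have "d \<le> Re (f x)" by (rule fK, rule KI[of 0 1]) (auto simp: subspace_0[OF V(1)])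
  ultimately show ?thesis
    using dual_spaceI[of f 1] f x V(2) by (intro bexI[of _ "\<lambda>x. if x \<in> X then f x else 0"]) auto
qed

corollary norming_functional:
  assumes "x \<in> X"
  shows "\<exists>f\<in>dual_space smul X N. (\<forall>y\<in>X. cmod (f y) \<le> N y) \<and> N x \<le> cmod (f x)"
  using separate_from_subspace[of "{0}" x "N x"] assms norm_nonneg X_zero complex_Re_le_cmod
  by (force intro: order.trans)

end

section \<open>Weak-star topologies with separately continuous multiplication\<close>

lemma closedin_euclidean_preimage:
  "continuous_map T euclidean f \<Longrightarrow> closed S \<Longrightarrow> closedin T {x \<in> topspace T. f x \<in> S}"
  using closedin_continuous_map_preimage[of T euclidean f S] closed_closedin[of S] by blast

lemma continuous_map_euclidean_compose:
  "continuous_map T euclidean f \<Longrightarrow> continuous_on UNIV h \<Longrightarrow> continuous_map T euclidean (\<lambda>x. h (f x))"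
  using continuous_map_compose[of T euclidean f euclidean h] by (simp add: o_def)

lemma continuous_map_cmult:
  "continuous_map T euclidean f \<Longrightarrow> continuous_map T euclidean (\<lambda>x. c * (f x :: complex))"
  by (erule continuous_map_euclidean_compose) (intro continuous_intros)

section \<open>Dual norm and the Banach-Alaoglu theorem\<close>

context complex_banach_space
begin

lemma dual_space_add: "f \<in> dual_space smul X N \<Longrightarrow> x \<in> X \<Longrightarrow> y \<in> X \<Longrightarrow> f (x + y) = f x + f y"
  and dual_space_scale: "f \<in> dual_space smul X N \<Longrightarrow> x \<in> X \<Longrightarrow> f (smul c x) = c * f x"
  and dual_space_outside: "f \<in> dual_space smul X N \<Longrightarrow> x \<notin> X \<Longrightarrow> f x = 0"
  by (auto simp: dual_space_def)

lemma N_zero: "N 0 = 0"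
  using norm_eq_zero X_zero by blast

lemma bdd_above_dual:
  assumes f: "f \<in> dual_space smul X N"
  shows "bdd_above ((\<lambda>x. cmod (f x)) ` {x \<in> X. N x \<le> 1})"
proof -
  obtain K where K: "\<And>x. x \<in> X \<Longrightarrow> cmod (f x) \<le> K * N x" using f unfolding dual_space_def by blast
  show ?thesis
  proof (rule bdd_aboveI2[of _ _ "\<bar>K\<bar>"])
    fix y assume y: "y \<in> {x \<in> X. N x \<le> 1}"
    then have "cmod (f y) \<le> \<bar>K\<bar> * N y"
      using K[of y] mult_right_mono[OF abs_ge_self[of K] norm_nonneg[of y]] by simp
    also have "\<dots> \<le> \<bar>K\<bar> * 1" using y by (intro mult_left_mono) auto
    finally show "cmod (f y) \<le> \<bar>K\<bar>" by simp
  qed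
qed

lemma dual_norm_bound:
  assumes f: "f \<in> dual_space smul X N" and x: "x \<in> X"
  shows "cmod (f x) \<le> dual_norm X N f * N x"
proof (cases "x = 0")
  case True
  then show ?thesis using dual_space_add[OF f X_zero X_zero] by (simp add: N_zero)
next
  case False
  then have n: "N x > 0" using norm_nonneg[OF x] norm_eq_zero[OF x] by linarith
  let ?y = "smul (of_real (inverse (N x))) x"
  have "?y \<in> {x \<in> X. N x \<le> 1}" using n X_scale[OF x] norm_scale[OF x] by (auto simp: norm_inverse)
  then have "cmod (f ?y) \<le> dual_norm X N f" unfolding dual_norm_def by (rule cSUP_upper[OF _ bdd_above_dual[OF f]])
  then show ?thesis using n by (simp add: dual_space_scale[OF f x] norm_mult norm_divide field_simps)
qed

lemma dual_norm_le:
  assumes "\<And>x. x \<in> X \<Longrightarrow> cmod (f x) \<le> K * N x" "0 \<le> K"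
  shows "dual_norm X N f \<le> K"
  unfolding dual_norm_def
proof (rule cSUP_least)
  show "{x \<in> X. N x \<le> 1} \<noteq> {}" using X_zero N_zero by force
  fix x assume "x \<in> {x \<in> X. N x \<le> 1}"
  then show "cmod (f x) \<le> K" using assms(1)[of x] mult_left_mono[of "N x" 1 K] assms(2) by auto
qed

lemma dual_norm_nonneg: "f \<in> dual_space smul X N \<Longrightarrow> 0 \<le> dual_norm X N f"
proof -
  assume f: "f \<in> dual_space smul X N"
  have "cmod (f 0) \<le> dual_norm X N f" unfolding dual_norm_def
    by (rule cSUP_upper[OF _ bdd_above_dual[OF f]]) (use X_zero N_zero in simp)
  then show ?thesis using norm_ge_zero order.trans by blast
qed

text \<open>Banach-Alaoglu: a Tychonoff product of disks, cut down by the closed conditions of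
  linearity. Coordinates outside \<open>X\<close> have the one-point factor 0, in line with the
  extension of functionals by 0.\<close>

lemma compactin_dual_ball:
  "compactin (product_topology (\<lambda>_. euclidean) UNIV)
     {f \<in> dual_space smul X N. \<forall>x\<in>X. cmod (f x) \<le> r * N x}"
proof -
  let ?P = "product_topology (\<lambda>_::'a. euclidean :: complex topology) UNIV"
  let ?D = "{f \<in> dual_space smul X N. \<forall>x\<in>X. cmod (f x) \<le> r * N x}"
  define B where "B x = (if x \<in> X then cball 0 (r * N x) else {0::complex})" for x
  have comp: "compactin ?P (Pi\<^sub>E UNIV B)" by (auto simp: compactin_PiE B_def)
  have ev: "continuous_map ?P euclidean (\<lambda>f. f x)" for x
    by (rule continuous_map_product_projection) simp
  have eq: "?D = Pi\<^sub>E UNIV B \<inter> (\<Inter>x\<in>X. \<Inter>y\<in>X. {f \<in> topspace ?P. f (x + y) - (f x + f y) \<in> {0}})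
    \<inter> (\<Inter>c. \<Inter>x\<in>X. {f \<in> topspace ?P. f (smul c x) - c * f x \<in> {0}})" (is "_ = ?R")
  proof (rule subset_antisym)
    show "?D \<subseteq> ?R" by (auto simp: dual_space_def B_def PiE_iff)
    show "?R \<subseteq> ?D"
    proof
      fix f assume f: "f \<in> ?R"
      have fB: "f x \<in> B x" for x using f by (auto simp: PiE_iff)
      have "\<forall>x. x \<notin> X \<longrightarrow> f x = 0" "\<forall>x\<in>X. cmod (f x) \<le> r * N x" using fB by (auto simp: B_def dest: spec)
           (metis dist_0_norm mem_cball singletonD fB B_def)+
      moreover have "\<forall>x\<in>X. \<forall>y\<in>X. f (x + y) = f x + f y" "\<forall>c. \<forall>x\<in>X. f (smul c x) = c * f x"
        using f by auto
      ultimately show "f \<in> ?D" by (auto simp: dual_space_def)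
    qed
  qed
  have c1: "closedin ?P (\<Inter>x\<in>X. \<Inter>y\<in>X. {f \<in> topspace ?P. f (x + y) - (f x + f y) \<in> {0}})"
    by (intro closedin_INT closedin_euclidean_preimage continuous_map_diff continuous_map_add ev closed_singleton)
      (use X_zero in auto)
  have c2: "closedin ?P (\<Inter>c. \<Inter>x\<in>X. {f \<in> topspace ?P. f (smul c x) - c * f x \<in> {0}})"
    by (intro closedin_INT closedin_euclidean_preimage continuous_map_diff continuous_map_cmult ev closed_singleton)
      (use X_zero in auto)
  show ?thesis unfolding eq by (rule compact_Int_closedin[OF compact_Int_closedin[OF comp c1] c2])
qed

end

section \<open>The algebra as the dual of a Banach space\<close>

locale vn_predual = vn_algebra M + complex_banach_space smul X N
  for M :: "('h::complex_hilbert \<Rightarrow>\<^sub>L 'h) set"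
    and smul :: "complex \<Rightarrow> 'x::ab_group_add \<Rightarrow> 'x" and X and N +
  fixes j :: "('h \<Rightarrow>\<^sub>L 'h) \<Rightarrow> 'x \<Rightarrow> complex"
  assumes iso: "banach_isomorphism op_scale M norm
      (\<lambda>c f x. c * f x) (dual_space smul X N) (dual_norm X N) j"
begin

definition W :: "('h \<Rightarrow>\<^sub>L 'h) topology" where
  "W = pullback_topology M j (weak_star_on_dual smul X N)"

lemma j_bij: "bij_betw j M (dual_space smul X N)"
  and j_add: "a \<in> M \<Longrightarrow> b \<in> M \<Longrightarrow> j (a + b) x = j a x + j b x"
  and j_scale: "a \<in> M \<Longrightarrow> j (op_scale c a) x = c * j a x"
  using iso by (auto simp: banach_isomorphism_def)

lemma j_dual: "a \<in> M \<Longrightarrow> j a \<in> dual_space smul X N"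
  using j_bij by (auto simp: bij_betw_def)

text \<open>Both constants are made positive and both bounds pointwise, so that later arguments can
  avoid the dual norm of \<open>j a\<close>.\<close>

lemma j_bounds:
  obtains C D where "C > 0" "D > 0" "\<And>a x. a \<in> M \<Longrightarrow> x \<in> X \<Longrightarrow> cmod (j a x) \<le> C * norm a * N x"
    "\<And>a r. a \<in> M \<Longrightarrow> 0 \<le> r \<Longrightarrow> (\<And>x. x \<in> X \<Longrightarrow> cmod (j a x) \<le> r * N x) \<Longrightarrow> norm a \<le> D * r"
proof -
  obtain C' where C': "\<And>a. a \<in> M \<Longrightarrow> dual_norm X N (j a) \<le> C' * norm a"
    using iso unfolding banach_isomorphism_def by blast
  obtain D' where D': "\<And>a. a \<in> M \<Longrightarrow> norm a \<le> D' * dual_norm X N (j a)"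
    using iso unfolding banach_isomorphism_def by blast
  define C where "C = \<bar>C'\<bar> + 1"
  define D where "D = \<bar>D'\<bar> + 1"
  show ?thesis
  proof (rule that[of C D])
    show "C > 0" "D > 0" by (auto simp: C_def D_def)
    show "cmod (j a x) \<le> C * norm a * N x" if "a \<in> M" "x \<in> X" for a x
    proof -
      have "dual_norm X N (j a) \<le> C * norm a"
        using C'[OF that(1)] mult_right_mono[of C' C "norm a"] unfolding C_def by fastforce
      then show ?thesis
        using dual_norm_bound[OF j_dual[OF that(1)] that(2)] mult_right_mono[OF _ norm_nonneg[OF that(2)]]
        by (meson order.trans)
    qed
    show "norm a \<le> D * r" if a: "a \<in> M" and r: "0 \<le> r" and le: "\<And>x. x \<in> X \<Longrightarrow> cmod (j a x) \<le> r * N x" for a r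
    proof -
      have "norm a \<le> D * dual_norm X N (j a)"
        using D'[OF a] mult_right_mono[of D' D "dual_norm X N (j a)"] dual_norm_nonneg[OF j_dual[OF a]]
        unfolding D_def by fastforce
      also have "\<dots> \<le> D * r" by (intro mult_left_mono dual_norm_le le r) (auto simp: D_def)
      finally show ?thesis .
    qed
  qed
qed

lemma topspace_weak_star: "topspace (weak_star_on_dual smul X N) = dual_space smul X N"
  unfolding weak_star_on_dual_def topology_generated_by_topspace using X_zero by auto

lemma topspace_W: "topspace W = M"
  using j_dual by (auto simp: W_def topspace_pullback_topology topspace_weak_star)

lemma continuous_map_eval: "x \<in> X \<Longrightarrow> continuous_map W euclidean (\<lambda>a. j a x)"
proof -
  assume x: "x \<in> X"
  have "continuous_map (weak_star_on_dual smul X N) euclidean (\<lambda>f. f x)"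
    unfolding continuous_map_def
  proof (intro conjI allI impI)
    fix U :: "complex set" assume "openin euclidean U"
    then show "openin (weak_star_on_dual smul X N) {f \<in> topspace (weak_star_on_dual smul X N). f x \<in> U}"
      unfolding topspace_weak_star unfolding weak_star_on_dual_def
      using x by (intro topology_generated_by_Basis) auto
  qed auto
  then show ?thesis unfolding W_def using continuous_map_pullback[of _ _ "\<lambda>f. f x" M j] by (simp add: o_def)
qed

text \<open>Universal property of the initial topology defined by the evaluations at points of
  \<open>X\<close>.\<close>

lemma continuous_map_into_W:
  assumes g: "\<And>t. t \<in> topspace T \<Longrightarrow> g t \<in> M" and c: "\<And>x. x \<in> X \<Longrightarrow> continuous_map T euclidean (\<lambda>t. j (g t) x)"
  shows "continuous_map T W g"
  unfolding W_def
proof (rule continuous_map_pullback')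
  show "continuous_map T (weak_star_on_dual smul X N) (j \<circ> g)"
    unfolding weak_star_on_dual_def
  proof (rule continuous_on_generated_topo)
    fix U assume "U \<in> {{f \<in> dual_space smul X N. f x \<in> U} |x U. x \<in> X \<and> open U}"
    then obtain x V where x: "x \<in> X" "open V" "U = {f \<in> dual_space smul X N. f x \<in> V}" by auto
    have "openin T {t \<in> topspace T. j (g t) x \<in> V}"
      using openin_continuous_map_preimage[OF c[OF x(1)]] x(2) by simp
    moreover have "(j \<circ> g) -` U \<inter> topspace T = {t \<in> topspace T. j (g t) x \<in> V}"
      using x(3) g j_dual by auto
    ultimately show "openin T ((j \<circ> g) -` U \<inter> topspace T)" by simp
  next
    have "(j \<circ> g) ` topspace T \<subseteq> dual_space smul X N" using g j_dual by auto
    then show "(j \<circ> g) ` topspace T \<subseteq> \<Union> {{f \<in> dual_space smul X N. f x \<in> U} |x U. x \<in> X \<and> open U}"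
      using topspace_weak_star unfolding weak_star_on_dual_def by simp
  qed
  show "topspace T \<subseteq> g -` M" using g by auto
qed

text \<open>Balls of the dual norm pulled back along \<open>j\<close>. They are
  \<open>W\<close>-compact, but as \<open>j\<close> need not be isometric they may differ from the
  balls of the operator norm.\<close>

definition dual_ball :: "real \<Rightarrow> ('h \<Rightarrow>\<^sub>L 'h) set" where
  "dual_ball r = {a \<in> M. \<forall>x\<in>X. cmod (j a x) \<le> r * N x}"

lemma closedin_dual_ball: "closedin W (dual_ball r)"
proof -
  have "dual_ball r = (\<Inter>x\<in>X. {a \<in> topspace W. j a x \<in> cball 0 (r * N x)})"
    using X_zero by (auto simp: dual_ball_def topspace_W)
  also have "closedin W \<dots>"
    by (intro closedin_INT closedin_euclidean_preimage continuous_map_eval closed_cball) (use X_zero in auto)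
  finally show ?thesis .
qed

text \<open>The inverse of \<open>j\<close> is continuous from the topology of pointwise convergence
  to \<open>W\<close>, so Banach-Alaoglu carries over.\<close>

lemma compactin_dual_ball_W: "compactin W (dual_ball r)"
proof -
  let ?P = "product_topology (\<lambda>_::'x. euclidean :: complex topology) UNIV"
  let ?D = "{f \<in> dual_space smul X N. \<forall>x\<in>X. cmod (f x) \<le> r * N x}"
  let ?i = "inv_into M j"
  have i: "?i f \<in> M" "j (?i f) = f" if "f \<in> dual_space smul X N" for f
    using that j_bij by (auto simp: bij_betw_def f_inv_into_f inv_into_into)
  have "compactin (subtopology ?P ?D) ?D"
    using compactin_dual_ball by (simp add: compactin_subtopology)
  moreover have "continuous_map (subtopology ?P ?D) W ?i"
  proof (rule continuous_map_into_W)
    show "?i f \<in> M" if "f \<in> topspace (subtopology ?P ?D)" for f using that i by auto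
    fix x assume "x \<in> X"
    have "continuous_map (subtopology ?P ?D) euclidean (\<lambda>f. f x)"
      by (intro continuous_map_from_subtopology continuous_map_product_projection) simp
    then show "continuous_map (subtopology ?P ?D) euclidean (\<lambda>f. j (?i f) x)"
      by (rule continuous_map_eq) (use i in auto)
  qed
  ultimately have "compactin W (?i ` ?D)" by (rule image_compactin)
  moreover have "?i ` ?D = dual_ball r"
  proof safe
    fix f assume "f \<in> dual_space smul X N" "\<forall>x\<in>X. cmod (f x) \<le> r * N x"
    then show "?i f \<in> dual_ball r" using i by (auto simp: dual_ball_def)
  next
    fix a assume a: "a \<in> dual_ball r"
    then have "?i (j a) = a" using j_bij by (auto simp: dual_ball_def bij_betw_def inv_into_f_f)
    moreover have "j a \<in> ?D" using a j_dual by (auto simp: dual_ball_def)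
    ultimately show "a \<in> ?i ` ?D" by (intro image_eqI[where x = "j a"]) simp_all
  qed
  ultimately show ?thesis by simp
qed

lemma continuous_map_affine:
  assumes "b \<in> M" shows "continuous_map W W (\<lambda>a. op_scale c a + b)"
proof (rule continuous_map_into_W)
  show "op_scale c a + b \<in> M" if "a \<in> topspace W" for a using that assms by (auto simp: topspace_W)
  fix x assume x: "x \<in> X"
  have "continuous_map W euclidean (\<lambda>a. c * j a x + j b x)"
    by (intro continuous_map_add continuous_map_cmult continuous_map_eval[OF x]) auto
  then show "continuous_map W euclidean (\<lambda>a. j (op_scale c a + b) x)"
    by (rule continuous_map_eq) (use assms in \<open>auto simp: topspace_W j_add j_scale scale_mem\<close>)
qed

lemma unit_ball_subset_dual_ball:
  obtains r where "{a \<in> M. norm a \<le> 1} \<subseteq> dual_ball r"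
proof -
  obtain C D where C: "C > 0" "\<And>a x. a \<in> M \<Longrightarrow> x \<in> X \<Longrightarrow> cmod (j a x) \<le> C * norm a * N x"
    using j_bounds by metis
  have "cmod (j a x) \<le> C * N x" if a: "a \<in> M" "norm a \<le> 1" "x \<in> X" for a x
    using C(2)[OF a(1,3)] mult_left_mono[OF mult_right_mono[OF a(2) norm_nonneg[OF a(3)]], of C] C(1)
    unfolding mult.assoc by linarith
  then have "{a \<in> M. norm a \<le> 1} \<subseteq> dual_ball C" unfolding dual_ball_def by blast
  then show ?thesis by (rule that)
qed

end

lemma op_adjoint_eqI:
  fixes S T :: "'h::complex_hilbert \<Rightarrow>\<^sub>L 'h"
  assumes "T \<in> bounded_ops" "\<And>x y. cinner (S x) y = cinner x (T y)"
  shows "op_adjoint T = S"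
  by (intro blinfun_eqI cinner_eqI) (simp add: op_adjoint[OF assms(1)] assms(2))

text \<open>With \<open>e = c\<^sup>*c / \<parallel>c\<parallel>\<close> in the bounded semigroup \<open>C\<close>, the iterated squares
  of \<open>e\<close> have norm \<open>\<parallel>c\<parallel>\<^bsup>2^k\<^esup>\<close>.\<close>

lemma (in vn_algebra) norm_le_1_of_bounded_semigroup:
  assumes C: "C \<subseteq> M" "\<And>a. a \<in> C \<Longrightarrow> norm a \<le> K" "\<And>a b. a \<in> C \<Longrightarrow> b \<in> C \<Longrightarrow> a o\<^sub>L b \<in> C"
    and ball: "{a \<in> M. norm a \<le> 1} \<subseteq> C" and c: "c \<in> C"
  shows "norm c \<le> 1"
proof (cases "c = 0")
  case False
  have cM: "c \<in> M" using C c by blast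
  \<comment> \<open>The scalar is attached to the adjoint: that factor then has norm 1 and lies in
    \<open>C\<close>, which is not assumed closed under adjoints or scaling. So \<open>e\<close> is
    a product of two members of \<open>C\<close>.\<close>
  define e where "e = (inverse (norm c) *\<^sub>R op_adjoint c) o\<^sub>L c"
  have e_eq: "e = inverse (norm c) *\<^sub>R (op_adjoint c o\<^sub>L c)"
    unfolding e_def by (intro blinfun_eqI) (simp add: blinfun.scaleR_left)
  have "inverse (norm c) *\<^sub>R op_adjoint c \<in> C"
    using False cM ball norm_adj[OF cM] by (auto simp: scaleR_mem adj)
  then have eC: "e \<in> C" unfolding e_def using C(3) c by blast
  have ne: "norm e = norm c" unfolding e_eq using False norm_adj_comp[OF cM] by (simp add: power2_eq_square)
  have eM: "e \<in> M" using eC C by blast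
  have "op_adjoint e = e"
  proof (rule op_adjoint_eqI)
    show "cinner (e x) y = cinner x (e y)" for x y
      by (simp add: e_eq blinfun.scaleR_left cinner_algebra cinner_adj[OF cM] cinner_adj'[OF cM])
  qed (use eM sub in blast)
  then have sa: "\<exists>f\<in>C. op_adjoint f = f \<and> norm f = norm c ^ (2 ^ k)" for k
  proof (induction k)
    case (Suc k)
    then obtain f where f: "f \<in> C" "op_adjoint f = f" "norm f = norm c ^ (2 ^ k)" by blast
    have fM: "f \<in> M" using f C by blast
    have "op_adjoint (f o\<^sub>L f) = f o\<^sub>L f"
    proof (rule op_adjoint_eqI)
      show "cinner ((f o\<^sub>L f) x) y = cinner x ((f o\<^sub>L f) y)" for x y
        using cinner_adj[OF fM] f(2) by simp
    qed (use fM sub comp_mem in blast)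
    moreover have "norm (f o\<^sub>L f) = norm c ^ (2 ^ Suc k)"
      using norm_adj_comp[OF fM] f by (simp add: power_mult[symmetric] mult.commute)
    ultimately show ?case using C(3)[OF f(1) f(1)] by blast
  qed (use eC ne in auto)
  show ?thesis
  proof (rule ccontr)
    assume "\<not> norm c \<le> 1"
    then have g: "norm c > 1" by simp
    obtain n where n: "K < norm c ^ n" using real_arch_pow[OF g] by blast
    have "norm c ^ n \<le> norm c ^ (2 ^ n)" using g by (intro power_increasing) (auto intro: less_imp_le)
    then show False using sa[of n] C(2) n by force
  qed
qed simp

section \<open>Weak-star compactness of the unit ball and of the order interval\<close>

locale vn_predual_sep = vn_predual M smul X N j
  for M :: "('h::complex_hilbert \<Rightarrow>\<^sub>L 'h) set"
    and smul :: "complex \<Rightarrow> 'x::ab_group_add \<Rightarrow> 'x" and X and N and j +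
  assumes sep: "separately_continuous_mult M W"
begin

lemma continuous_mult:
  assumes "a \<in> M" shows "continuous_map W W (\<lambda>b. a o\<^sub>L b)" "continuous_map W W (\<lambda>b. b o\<^sub>L a)"
  using sep assms by (auto simp: separately_continuous_mult_def)

text \<open>The closure of the unit ball is a bounded semigroup.\<close>

lemma closedin_unit_ball: "closedin W {a \<in> M. norm a \<le> 1}"
proof -
  let ?B = "{a \<in> M. norm a \<le> 1}"
  define C where "C = W closure_of ?B"
  obtain r where r: "?B \<subseteq> dual_ball r" by (rule unit_ball_subset_dual_ball)
  have Cr: "C \<subseteq> dual_ball r" unfolding C_def by (rule closure_of_minimal[OF r closedin_dual_ball])
  have CM: "C \<subseteq> M" using Cr by (auto simp: dual_ball_def)
  have BC: "?B \<subseteq> C" unfolding C_def by (rule closure_of_subset) (auto simp: topspace_W)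
  have Ccl: "W closure_of C = C" unfolding C_def by simp
  have map: "f ` C \<subseteq> C" if "continuous_map W W f" "f ` ?B \<subseteq> C" for f
    using continuous_map_image_closure_subset[OF that(1), of ?B] closure_of_mono[OF that(2), of W] Ccl
    unfolding C_def by blast
  have BB: "a o\<^sub>L b \<in> ?B" if "a \<in> ?B" "b \<in> ?B" for a b
  proof -
    have "norm (a o\<^sub>L b) \<le> 1"
      using norm_blinfun_compose[of a b] mult_mono[of "norm a" 1 "norm b" 1] that by auto
    then show ?thesis using that by auto
  qed
  \<comment> \<open>Separate continuity passes to the closure one factor at a time: first ball times
    closure, then closure times closure.\<close>
  have BCC: "a o\<^sub>L c \<in> C" if "a \<in> ?B" "c \<in> C" for a c
    using map[OF continuous_mult(1), of a] BB BC that by blast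
  have CC: "a o\<^sub>L c \<in> C" if "a \<in> C" "c \<in> C" for a c
    using map[OF continuous_mult(2), of c] BCC CM that by blast
  obtain C' D where D: "D > 0"
    "\<And>a r. a \<in> M \<Longrightarrow> 0 \<le> r \<Longrightarrow> (\<And>x. x \<in> X \<Longrightarrow> cmod (j a x) \<le> r * N x) \<Longrightarrow> norm a \<le> D * r"
    using j_bounds by metis
  \<comment> \<open>Nothing is known about the sign of \<open>r\<close>, hence
    \<open>max r 0\<close>.\<close>
  have bd: "norm a \<le> D * max r 0" if "a \<in> C" for a
  proof (rule D(2))
    show "cmod (j a x) \<le> max r 0 * N x" if x: "x \<in> X" for x
      using \<open>a \<in> C\<close> Cr x mult_right_mono[OF max.cobounded1[of r 0] norm_nonneg[OF x]]
      by (force simp: dual_ball_def)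
  qed (use that CM in auto)
  have "c \<in> ?B" if "c \<in> C" for c
    using norm_le_1_of_bounded_semigroup[OF CM bd CC BC that] that CM by auto
  then have "C = ?B" using BC by blast
  then show ?thesis using closedin_closure_of[of W ?B] unfolding C_def by simp
qed

lemma compactin_unit_ball: "compactin W {a \<in> M. norm a \<le> 1}"
proof -
  obtain r where r: "{a \<in> M. norm a \<le> 1} \<subseteq> dual_ball r" by (rule unit_ball_subset_dual_ball)
  show ?thesis by (rule closed_compactin[OF compactin_dual_ball_W r closedin_unit_ball])
qed

lemma closedin_effects: "closedin W (effects M)"
proof -
  define r where "r t = sqrt (1/4 + t\<^sup>2)" for t :: real
  define c where "c t = op_scale (1/2 + \<i> * of_real t) (id_blinfun :: 'h \<Rightarrow>\<^sub>L 'h)" for t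
  \<comment> \<open>The affine map that takes the ball with centre \<open>c t\<close> and radius
    \<open>r t\<close> to the unit ball.\<close>
  define g where "g t a = op_scale (of_real (inverse (r t))) a + (- (inverse (r t) *\<^sub>R c t))" for t a
  have rpos: "r t > 0" for t unfolding r_def by (simp add: add_pos_nonneg)
  have cM: "c t \<in> M" for t unfolding c_def by blast
  have g: "g t a = inverse (r t) *\<^sub>R (a - c t)" for t a
    unfolding g_def scaleR_op_scale[symmetric] by (simp add: scaleR_diff_right)
  have n: "norm (g t a) \<le> 1 \<longleftrightarrow> norm (a - c t) \<le> r t" for t a
    unfolding g norm_scaleR using rpos[of t] by (simp add: field_simps)
  have "effects M = (\<Inter>t. {a \<in> topspace W. g t a \<in> {a \<in> M. norm a \<le> 1}})"
    using n cM unfolding topspace_W by (auto simp: effects_iff_norm[OF sub] g scaleR_mem diff_mem r_def c_def)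
  also have "closedin W \<dots>"
    unfolding g_def
    by (intro closedin_INT closedin_continuous_map_preimage[OF continuous_map_affine closedin_unit_ball])
      (use cM in auto)
  finally show ?thesis .
qed

lemma compactin_effects: "compactin W (effects M)"
  by (rule closed_compactin[OF compactin_unit_ball _ closedin_effects])
    (auto simp: effects_mem effects_norm_le_1)

text \<open>The inequality says that half of \<open>c + m - q\<close> is again an effect; the factor
  1/2 and \<open>m \<le> 1\<close> keep it below the identity. So an operator inequality is
  \<open>W\<close>-closed even though single quadratic forms are not known to be
  \<open>W\<close>-continuous.\<close>

lemma closedin_effects_le:
  assumes c: "c \<in> effects M" and m: "0 \<le> m" "m \<le> 1"
  shows "closedin W {q \<in> effects M. \<forall>x. quad q x \<le> quad c x + m * (norm x)\<^sup>2}"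
proof -
  define b where "b = (1/2) *\<^sub>R c + (m/2) *\<^sub>R id_blinfun"
  define g where "g q = op_scale (-1/2) q + b" for q
  have cM: "c \<in> M" using c effects_mem by blast
  have bM: "b \<in> M" unfolding b_def using cM by blast
  have cg: "cinner (g q x) x = (cinner (c x) x + of_real (m * (norm x)\<^sup>2) - cinner (q x) x) / 2" for q x
    by (simp add: g_def b_def blinfun.add_left blinfun.scaleR_left cinner_algebra cinner_self field_simps)
  have iff: "g q \<in> effects M \<longleftrightarrow> (\<forall>x. quad q x \<le> quad c x + m * (norm x)\<^sup>2)" if q: "q \<in> effects M" for q
  proof -
    have gM: "g q \<in> M" unfolding g_def using q bM effects_mem by blast
    have "quad (g q) x \<le> (norm x)\<^sup>2" for x
    proof -
      have "m * (norm x)\<^sup>2 \<le> 1 * (norm x)\<^sup>2" using m by (intro mult_right_mono) auto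
      moreover have "quad c x \<le> (norm x)\<^sup>2" "0 \<le> quad q x" using c q by (auto simp: effects_def positive_op_def)
      ultimately show ?thesis by (simp add: cg)
    qed
    moreover have "Im (cinner (g q x) x) = 0" for x
      using c q by (simp add: cg effects_def positive_op_def)
    ultimately show ?thesis using gM sub by (auto simp: effects_def positive_op_def) (auto simp: cg)
  qed
  have "{q \<in> effects M. \<forall>x. quad q x \<le> quad c x + m * (norm x)\<^sup>2}
    = effects M \<inter> {q \<in> topspace W. g q \<in> effects M}"
    using iff by (auto simp: topspace_W effects_mem)
  also have "closedin W \<dots>" unfolding g_def
    by (intro closedin_Int closedin_effects
        closedin_continuous_map_preimage[OF continuous_map_affine[OF bM] closedin_effects])
  finally show ?thesis .
qed

end

section \<open>The normal predual\<close>

lemma mem_dual_spaceI: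
  assumes "\<And>x. x \<notin> X \<Longrightarrow> f x = 0" "\<And>x y. x \<in> X \<Longrightarrow> y \<in> X \<Longrightarrow> f (x + y) = f x + f y"
    "\<And>c x. x \<in> X \<Longrightarrow> f (smul c x) = c * f x" "\<And>x. x \<in> X \<Longrightarrow> cmod (f x) \<le> K * N x"
  shows "f \<in> dual_space smul X N"
  unfolding dual_space_def using assms by blast

text \<open>A Cauchy sequence in the dual norm converges pointwise, uniformly relative to
  \<open>N\<close>; the limit is a bounded functional that \<open>Y\<close> approximates, so
  \<open>closed\<close> applies. Closedness is phrased by pointwise bounds because
  \<open>normal_predual\<close> is.\<close>

lemma (in complex_banach_space) closed_subspace_of_dual:
  assumes Y: "Y \<subseteq> dual_space smul X N" "0 \<in> Y" "\<And>f g. f \<in> Y \<Longrightarrow> g \<in> Y \<Longrightarrow> f + g \<in> Y"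
    "\<And>c f. f \<in> Y \<Longrightarrow> (\<lambda>x. c * f x) \<in> Y"
    and closed: "\<And>f. f \<in> dual_space smul X N \<Longrightarrow>
      (\<And>e. e > 0 \<Longrightarrow> \<exists>g\<in>Y. \<forall>x\<in>X. cmod (f x - g x) \<le> e * N x) \<Longrightarrow> f \<in> Y"
  shows "complex_banach_space (\<lambda>c f x. c * f x) Y (dual_norm X N)"
proof -
  interpret D: vector_space "\<lambda>c f x. c * f x :: complex"
    by unfold_locales (auto simp: fun_eq_iff algebra_simps)
  have sub: "D.subspace Y" using Y by (auto simp: D.subspace_def)
  have diffY: "f - g \<in> Y" if "f \<in> Y" "g \<in> Y" for f g using D.subspace_diff[OF sub] that .
  note bd = dual_norm_bound[OF subsetD[OF Y(1)]]
  have scale_le: "dual_norm X N (\<lambda>x. c * f x) \<le> cmod c * dual_norm X N f" if "f \<in> Y" for c f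
    using bd[OF that] mult_left_mono[OF bd[OF that], of _ "cmod c"] Y(1) that
    by (intro dual_norm_le) (auto simp: norm_mult mult.assoc dual_norm_nonneg)
  show ?thesis
  proof (unfold_locales)
    show "D.subspace Y" by (rule sub)
    fix f assume f: "f \<in> Y"
    then have fd: "f \<in> dual_space smul X N" using Y(1) by blast
    show "0 \<le> dual_norm X N f" by (rule dual_norm_nonneg[OF fd])
    show "(dual_norm X N f = 0) = (f = 0)"
    proof
      assume "dual_norm X N f = 0"
      then have "f x = 0" for x using bd[OF f, of x] dual_space_outside[OF fd, of x] by (cases "x \<in> X") auto
      then show "f = 0" by (auto simp: fun_eq_iff)
    next
      assume "f = 0"
      then show "dual_norm X N f = 0"
        using dual_norm_le[of f 0] dual_norm_nonneg[OF fd] by simp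
    qed
    show "dual_norm X N (\<lambda>x. c * f x) = cmod c * dual_norm X N f" for c
    proof (cases "c = 0")
      case True
      have "0 \<le> dual_norm X N (\<lambda>x. c * f x)" by (rule dual_norm_nonneg) (use Y(1) Y(4)[OF f] in blast)
      then show ?thesis using scale_le[OF f, of c] True by simp
    next
      case False
      have "dual_norm X N (\<lambda>x. inverse c * (c * f x)) \<le> cmod (inverse c) * dual_norm X N (\<lambda>x. c * f x)"
        by (rule scale_le[OF Y(4)[OF f]])
      moreover have "(\<lambda>x. inverse c * (c * f x)) = f" using False by (simp add: fun_eq_iff)
      ultimately have "cmod c * dual_norm X N f \<le> dual_norm X N (\<lambda>x. c * f x)"
        using False by (simp add: norm_divide norm_inverse field_simps)
      then show ?thesis using scale_le[OF f, of c] by simp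
    qed
    fix g assume g: "g \<in> Y"
    show "dual_norm X N (f + g) \<le> dual_norm X N f + dual_norm X N g"
    proof (rule dual_norm_le)
      fix x assume "x \<in> X"
      then show "cmod ((f + g) x) \<le> (dual_norm X N f + dual_norm X N g) * N x"
        using norm_triangle_ineq[of "f x" "g x"] bd[OF f] bd[OF g] by (fastforce simp: distrib_right)
    qed (use dual_norm_nonneg f g Y(1) in \<open>auto intro!: add_nonneg_nonneg\<close>)
  next
    fix s :: "nat \<Rightarrow> _ \<Rightarrow> complex"
    assume s: "\<And>n. s n \<in> Y" and c: "\<forall>e>0. \<exists>n0. \<forall>m\<ge>n0. \<forall>n\<ge>n0. dual_norm X N (s m - s n) < e"
    have sd: "s n \<in> dual_space smul X N" for n using s Y(1) by blast
    have u: "\<exists>n0. \<forall>m\<ge>n0. \<forall>n\<ge>n0. \<forall>x\<in>X. cmod (s m x - s n x) \<le> e * N x" if e: "e > 0" for e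
    proof -
      obtain n0 where n0: "\<And>m n. m \<ge> n0 \<Longrightarrow> n \<ge> n0 \<Longrightarrow> dual_norm X N (s m - s n) < e" using c e by blast
      have "cmod (s m x - s n x) \<le> e * N x" if "m \<ge> n0" "n \<ge> n0" "x \<in> X" for m n x
        using bd[OF diffY[OF s s] that(3), of m n] n0[OF that(1,2)] norm_nonneg[OF that(3)]
          mult_right_mono[of "dual_norm X N (s m - s n)" e "N x"] by simp
      then show ?thesis by blast
    qed
    have "Cauchy (\<lambda>n. s n x)" for x
    proof (cases "x \<in> X")
      case True
      show ?thesis
      proof (rule metric_CauchyI)
        fix e :: real assume e: "e > 0"
        define d where "d = e / (N x + 1)"
        have Nx: "N x + 1 > 0" using norm_nonneg[OF True] by linarith
        have d: "d > 0" "d * N x < e" using e Nx norm_nonneg[OF True] by (auto simp: d_def field_simps)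
        obtain n0 where "\<forall>m\<ge>n0. \<forall>n\<ge>n0. \<forall>x\<in>X. cmod (s m x - s n x) \<le> d * N x" using u[OF d(1)] by blast
        then have "\<forall>m\<ge>n0. \<forall>n\<ge>n0. dist (s m x) (s n x) < e"
          using d(2) True unfolding dist_norm by fastforce
        then show "\<exists>n0. \<forall>m\<ge>n0. \<forall>n\<ge>n0. dist (s m x) (s n x) < e" by blast
      qed
    next
      case False
      have "(\<lambda>n. s n x) = (\<lambda>n. 0)" using dual_space_outside[OF sd False] by (rule ext)
      then show ?thesis by (metis convergent_Cauchy convergent_const)
    qed
    then have "\<forall>x. \<exists>z. (\<lambda>n. s n x) \<longlonglongrightarrow> z" by (simp add: Cauchy_convergent_iff convergent_def)
    then have "\<exists>l. \<forall>x. (\<lambda>n. s n x) \<longlonglongrightarrow> l x" by (rule choice)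
    then obtain l where l: "\<And>x. (\<lambda>n. s n x) \<longlonglongrightarrow> l x" by blast
    have ul: "\<exists>n0. \<forall>n\<ge>n0. \<forall>x\<in>X. cmod (s n x - l x) \<le> e * N x" if e: "e > 0" for e
    proof -
      obtain n0 where n0: "\<And>m n x. m \<ge> n0 \<Longrightarrow> n \<ge> n0 \<Longrightarrow> x \<in> X \<Longrightarrow> cmod (s m x - s n x) \<le> e * N x"
        using u[OF e] by blast
      have "cmod (s n x - l x) \<le> e * N x" if n: "n \<ge> n0" "x \<in> X" for n x
      proof (rule LIMSEQ_le_const2)
        show "(\<lambda>m. cmod (s n x - s m x)) \<longlonglongrightarrow> cmod (s n x - l x)" by (intro tendsto_intros l)
      qed (use n0 n in blast)
      then show ?thesis by blast
    qed
    have ladd: "l (x + y) = l x + l y" if "x \<in> X" "y \<in> X" for x y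
      by (rule LIMSEQ_unique[OF l]) (simp add: dual_space_add[OF sd that] tendsto_add[OF l l])
    have lsc: "l (smul c x) = c * l x" if "x \<in> X" for c x
      by (rule LIMSEQ_unique[OF l]) (simp add: dual_space_scale[OF sd that] tendsto_mult_left[OF l])
    have lout: "l x = 0" if "x \<notin> X" for x
      by (rule LIMSEQ_unique[OF l]) (simp add: dual_space_outside[OF sd that])
    obtain n1 where n1: "\<And>x. x \<in> X \<Longrightarrow> cmod (s n1 x - l x) \<le> 1 * N x" using ul[of 1] by auto
    have "cmod (l x) \<le> (dual_norm X N (s n1) + 1) * N x" if x: "x \<in> X" for x
      using n1[OF x] bd[OF s x, of n1] norm_triangle_ineq4[of "s n1 x" "s n1 x - l x"]
      by (simp add: distrib_right)
    with lout ladd lsc have ld: "l \<in> dual_space smul X N" by (rule mem_dual_spaceI)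
    have lY: "l \<in> Y"
    proof (rule closed[OF ld])
      fix e :: real assume "e > 0"
      then obtain n where "\<forall>x\<in>X. cmod (s n x - l x) \<le> e * N x" using ul by blast
      then show "\<exists>g\<in>Y. \<forall>x\<in>X. cmod (l x - g x) \<le> e * N x"
        using s by (auto simp: norm_minus_commute intro!: bexI[of _ "s n"])
    qed
    have "(\<lambda>n. dual_norm X N (s n - l)) \<longlonglongrightarrow> 0"
    proof (rule LIMSEQ_I)
      fix r :: real assume r: "r > 0"
      then obtain n0 where n0: "\<forall>n\<ge>n0. \<forall>x\<in>X. cmod (s n x - l x) \<le> r/2 * N x" using ul[of "r/2"] by auto
      have "dual_norm X N (s n - l) \<le> r/2" if "n \<ge> n0" for n
        using n0 that r by (intro dual_norm_le) auto
      moreover have "0 \<le> dual_norm X N (s n - l)" for n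
        using diffY[OF s lY] Y(1) by (intro dual_norm_nonneg) auto
      ultimately have "norm (dual_norm X N (s n - l) - 0) < r" if "n \<ge> n0" for n
        using that r by fastforce
      then show "\<exists>no. \<forall>n\<ge>no. norm (dual_norm X N (s n - l) - 0) < r" by blast
    qed
    then show "\<exists>l\<in>Y. (\<lambda>n. dual_norm X N (s n - l)) \<longlonglongrightarrow> 0" using lY by blast
  qed
qed

section \<open>Construction of the normal predual and of its duality with the algebra\<close>

context vn_algebra
begin

text \<open>Complex linearity and commutation with \<open>commutant M\<close> both survive norm
  limits, so \<open>M\<close> is complete.\<close>

lemma complex_banach_space_M: "complex_banach_space op_scale M norm"
proof -
  interpret V: vector_space "op_scale :: complex \<Rightarrow> ('h \<Rightarrow>\<^sub>L 'h) \<Rightarrow> _" by (rule vector_space_op_scale)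
  show ?thesis
  proof (unfold_locales)
    show "V.subspace M" by (auto simp: V.subspace_def)
    show "norm (x + y) \<le> norm x + norm y" for x y :: "'h \<Rightarrow>\<^sub>L 'h" by (rule norm_triangle_ineq)
    fix s :: "nat \<Rightarrow> 'h \<Rightarrow>\<^sub>L 'h"
    assume s: "\<And>n. s n \<in> M" and c: "\<forall>e>0. \<exists>n0. \<forall>m\<ge>n0. \<forall>n\<ge>n0. norm (s m - s n) < e"
    have "Cauchy s" using c by (simp add: Cauchy_def dist_norm)
    then obtain l where l: "s \<longlonglongrightarrow> l" using Cauchy_convergent_iff convergent_def by blast
    have lx: "(\<lambda>n. s n x) \<longlonglongrightarrow> l x" for x by (intro tendsto_intros l)
    have "l \<in> M"
    proof (rule memI)
      have "l (c *\<^sub>C x) = c *\<^sub>C l x" for c x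
      proof (rule cinner_eqI)
        fix z
        have "(\<lambda>n. cinner (s n (c *\<^sub>C x)) z) \<longlonglongrightarrow> cinner (l (c *\<^sub>C x)) z"
          by (intro tendsto_cinner lx tendsto_const)
        moreover have "(\<lambda>n. c * cinner (s n x) z) \<longlonglongrightarrow> c * cinner (l x) z"
          by (intro tendsto_mult_left tendsto_cinner lx tendsto_const)
        ultimately show "cinner (l (c *\<^sub>C x)) z = cinner (c *\<^sub>C l x) z"
          using LIMSEQ_unique by (fastforce simp: scaleC_mem[OF s] cinner_scaleC_left)
      qed
      then show "l \<in> bounded_ops" by (simp add: bounded_ops_def)
      fix S x assume S: "S \<in> commutant M"
      have "(\<lambda>n. S (s n x)) \<longlonglongrightarrow> S (l x)" by (intro tendsto_intros lx)
      then have "(\<lambda>n. s n (S x)) \<longlonglongrightarrow> S (l x)" using commutant_apply[OF S s] by simp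
      then show "l (S x) = S (l x)" using lx LIMSEQ_unique by blast
    qed
    moreover have "(\<lambda>n. norm (s n - l)) \<longlonglongrightarrow> 0" using l by (simp add: LIM_zero tendsto_norm_zero)
    ultimately show "\<exists>l\<in>M. (\<lambda>n. norm (s n - l)) \<longlonglongrightarrow> 0" by blast
  qed (auto simp: norm_op_scale)
qed

interpretation BM: complex_banach_space op_scale M norm by (rule complex_banach_space_M)

text \<open>Lists make addition of such functionals concatenation; the value 0 outside
  \<open>M\<close> follows the convention of \<open>dual_space\<close>.\<close>

definition vsum :: "('h \<times> 'h) list \<Rightarrow> ('h \<Rightarrow>\<^sub>L 'h) \<Rightarrow> complex" where
  "vsum ps a = (if a \<in> M then \<Sum>(x, y)\<leftarrow>ps. cinner (a x) y else 0)"

definition normal_predual :: "(('h \<Rightarrow>\<^sub>L 'h) \<Rightarrow> complex) set" where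
  "normal_predual = {f \<in> dual_space op_scale M norm.
     \<forall>e>0. \<exists>ps. \<forall>a\<in>M. cmod (f a - vsum ps a) \<le> e * norm a}"

lemma vsum_append: "vsum (ps @ qs) = vsum ps + vsum qs"
  by (auto simp: vsum_def fun_eq_iff)

lemma vsum_Cons: "vsum (p # ps) = vsum [p] + vsum ps"
  by (auto simp: vsum_def fun_eq_iff)

lemma vsum_scale: "vsum (map (\<lambda>(x, y). (c *\<^sub>C x, y)) ps) a = c * vsum ps a"
  by (induction ps) (auto simp: vsum_def scaleC_mem cinner_scaleC_left distrib_left)

lemma vsum_norm_le: "\<exists>K. \<forall>a\<in>M. cmod (vsum ps a) \<le> K * norm a"
proof (induction ps)
  case (Cons p ps)
  then obtain K where K: "\<And>a. a \<in> M \<Longrightarrow> cmod (vsum ps a) \<le> K * norm a" by blast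
  obtain x y where p: "p = (x, y)" by (cases p)
  have "cmod (vsum (p # ps) a) \<le> (norm x * norm y + K) * norm a" if a: "a \<in> M" for a
  proof -
    have "cmod (vsum (p # ps) a) \<le> cmod (cinner (a x) y) + cmod (vsum ps a)"
      using a by (simp add: p vsum_def norm_triangle_ineq)
    also have "cmod (cinner (a x) y) \<le> norm (a x) * norm y" by (rule cinner_cauchy_schwarz)
    also have "\<dots> \<le> (norm a * norm x) * norm y" by (intro mult_right_mono norm_blinfun) simp
    finally show ?thesis using K[OF a] by (simp add: algebra_simps)
  qed
  then show ?case by blast
qed (auto simp: vsum_def intro!: exI[of _ 0])

lemma vsum_add: "a \<in> M \<Longrightarrow> b \<in> M \<Longrightarrow> vsum ps (a + b) = vsum ps a + vsum ps b"
  by (induction ps) (auto simp: vsum_def add_mem blinfun.add_left cinner_add_left)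

lemma vsum_op_scale: "a \<in> M \<Longrightarrow> vsum ps (op_scale c a) = c * vsum ps a"
  by (induction ps) (auto simp: vsum_def scale_mem cinner_scaleC_left distrib_left)

lemma vsum_normal: "vsum ps \<in> normal_predual"
proof -
  have "vsum ps \<in> dual_space op_scale M norm"
  proof -
    obtain K where "\<forall>a\<in>M. cmod (vsum ps a) \<le> K * norm a" using vsum_norm_le by blast
    then show ?thesis
      by (intro mem_dual_spaceI[where K = K]) (simp add: vsum_def, auto simp: vsum_add vsum_op_scale)
  qed
  then show ?thesis by (auto simp: normal_predual_def intro!: exI[of _ ps])
qed

lemma normal_dual: "f \<in> normal_predual \<Longrightarrow> f \<in> dual_space op_scale M norm"
  by (simp add: normal_predual_def)

lemma normal_bounded:
  assumes "f \<in> normal_predual"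
  obtains K where "\<forall>a\<in>M. cmod (f a) \<le> K * norm a"
  using normal_dual[OF assms] unfolding dual_space_def by blast

lemma normal_approx:
  assumes "f \<in> normal_predual" "e > 0"
  obtains ps where "\<And>a. a \<in> M \<Longrightarrow> cmod (f a - vsum ps a) \<le> e * norm a"
  using assms unfolding normal_predual_def by blast

lemma complex_banach_space_normal_predual:
  "complex_banach_space (\<lambda>c f x. c * f x) normal_predual (dual_norm M norm)"
proof -
  show ?thesis
  proof (rule BM.closed_subspace_of_dual)
    show "normal_predual \<subseteq> dual_space op_scale M norm" using normal_dual by blast
    have "0 = vsum []" by (auto simp: vsum_def)
    then show "0 \<in> normal_predual" using vsum_normal by metis
  next
    fix f g assume f: "f \<in> normal_predual" and g: "g \<in> normal_predual"
    obtain K where K: "\<forall>a\<in>M. cmod (f a) \<le> K * norm a" by (rule normal_bounded[OF f])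
    obtain L where L: "\<forall>a\<in>M. cmod (g a) \<le> L * norm a" by (rule normal_bounded[OF g])
    have "cmod (f a + g a) \<le> (K + L) * norm a" if "a \<in> M" for a
      using norm_triangle_ineq[of "f a" "g a"] bspec[OF K that] bspec[OF L that] by (simp add: distrib_right)
    then have d: "f + g \<in> dual_space op_scale M norm"
      using normal_dual[OF f] normal_dual[OF g]
      by (intro mem_dual_spaceI[where K = "K + L"]) (auto simp: dual_space_def distrib_left)
    have "\<exists>ps. \<forall>a\<in>M. cmod ((f + g) a - vsum ps a) \<le> e * norm a" if e: "e > 0" for e
    proof -
      obtain ps where ps: "\<And>a. a \<in> M \<Longrightarrow> cmod (f a - vsum ps a) \<le> e/2 * norm a"
        using normal_approx[OF f, of "e/2"] e by auto
      obtain qs where qs: "\<And>a. a \<in> M \<Longrightarrow> cmod (g a - vsum qs a) \<le> e/2 * norm a"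
        using normal_approx[OF g, of "e/2"] e by auto
      have "cmod ((f + g) a - vsum (ps @ qs) a) \<le> e * norm a" if "a \<in> M" for a
        using norm_triangle_ineq[of "f a - vsum ps a" "g a - vsum qs a"] ps[OF that] qs[OF that]
        by (simp add: vsum_append algebra_simps)
      then show ?thesis by blast
    qed
    then show "f + g \<in> normal_predual" using d by (simp add: normal_predual_def)
  next
    fix c f assume f: "f \<in> normal_predual"
    obtain K where K: "\<forall>a\<in>M. cmod (f a) \<le> K * norm a" by (rule normal_bounded[OF f])
    have "cmod (c * f a) \<le> (cmod c * K) * norm a" if "a \<in> M" for a
      using mult_left_mono[OF bspec[OF K that], of "cmod c"] by (simp add: norm_mult mult.assoc)
    then have d: "(\<lambda>a. c * f a) \<in> dual_space op_scale M norm"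
      using normal_dual[OF f] by (intro mem_dual_spaceI[where K = "cmod c * K"]) (auto simp: dual_space_def distrib_left)
    have "\<exists>ps. \<forall>a\<in>M. cmod (c * f a - vsum ps a) \<le> e * norm a" if e: "e > 0" for e
    proof -
      have c1: "cmod c + 1 > 0" by (simp add: add_nonneg_pos)
      obtain ps where ps: "\<And>a. a \<in> M \<Longrightarrow> cmod (f a - vsum ps a) \<le> e / (cmod c + 1) * norm a"
        using normal_approx[OF f, of "e / (cmod c + 1)"] e c1 by auto
      have "cmod (c * f a - vsum (map (\<lambda>(x, y). (c *\<^sub>C x, y)) ps) a) \<le> e * norm a" if "a \<in> M" for a
      proof -
        have "cmod (c * f a - vsum (map (\<lambda>(x, y). (c *\<^sub>C x, y)) ps) a) = cmod c * cmod (f a - vsum ps a)"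
          by (simp add: vsum_scale norm_mult[symmetric] right_diff_distrib)
        also have "\<dots> \<le> (cmod c + 1) * (e / (cmod c + 1) * norm a)"
          using ps[OF that] by (intro mult_mono) auto
        finally show ?thesis using c1 by simp
      qed
      then show ?thesis by blast
    qed
    then show "(\<lambda>a. c * f a) \<in> normal_predual" using d by (simp add: normal_predual_def)
  next
    fix f assume f: "f \<in> dual_space op_scale M norm"
      and ap: "\<And>e. e > 0 \<Longrightarrow> \<exists>g\<in>normal_predual. \<forall>x\<in>M. cmod (f x - g x) \<le> e * norm x"
    have "\<exists>ps. \<forall>a\<in>M. cmod (f a - vsum ps a) \<le> e * norm a" if e: "e > 0" for e
    proof -
      obtain g where g: "g \<in> normal_predual" "\<And>a. a \<in> M \<Longrightarrow> cmod (f a - g a) \<le> e/2 * norm a"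
        using ap[of "e/2"] e by auto
      obtain ps where ps: "\<And>a. a \<in> M \<Longrightarrow> cmod (g a - vsum ps a) \<le> e/2 * norm a"
        using normal_approx[OF g(1), of "e/2"] e by auto
      have "cmod (f a - vsum ps a) \<le> e * norm a" if "a \<in> M" for a
        using norm_triangle_ineq[of "f a - g a" "g a - vsum ps a"] ps[OF that] g(2)[OF that]
        by (simp add: algebra_simps)
      then show ?thesis by blast
    qed
    then show "f \<in> normal_predual" using f by (simp add: normal_predual_def)
  qed
qed

interpretation P: complex_banach_space "\<lambda>c f x. c * f x" normal_predual "dual_norm M norm"
  by (rule complex_banach_space_normal_predual)

text \<open>The canonical map into the bidual, restricted to the normal predual and extended by
  0.\<close>

definition evaluation :: "('h \<Rightarrow>\<^sub>L 'h) \<Rightarrow> (('h \<Rightarrow>\<^sub>L 'h) \<Rightarrow> complex) \<Rightarrow> complex" where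
  "evaluation a f = (if f \<in> normal_predual then f a else 0)"

lemma dual_norm_vsum_single: "dual_norm M norm (vsum [(x, y)]) \<le> norm x * norm y"
proof -
  show ?thesis
  proof (rule BM.dual_norm_le)
    fix a assume a: "a \<in> M"
    have "cmod (cinner (a x) y) \<le> norm (a x) * norm y" by (rule cinner_cauchy_schwarz)
    also have "\<dots> \<le> (norm a * norm x) * norm y" by (intro mult_right_mono norm_blinfun) simp
    finally show "cmod (vsum [(x, y)] a) \<le> norm x * norm y * norm a" using a by (simp add: vsum_def mult_ac)
  qed simp
qed

text \<open>A functional on the normal predual is evaluation at the operator representing its
  sesquilinear form on vector functionals, which commutes with the commutant.\<close>

lemma functional_on_normal_predual:
  assumes G: "G \<in> dual_space (\<lambda>c f x. c * f x) normal_predual (dual_norm M norm)"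
  shows "\<exists>T\<in>M. evaluation T = G"
proof -
  note Gadd = P.dual_space_add[OF G] and Gsc = P.dual_space_scale[OF G]
  define K where "K = dual_norm normal_predual (dual_norm M norm) G"
  have K0: "K \<ge> 0" unfolding K_def by (rule P.dual_norm_nonneg[OF G])
  have GK: "cmod (G f) \<le> K * dual_norm M norm f" if "f \<in> normal_predual" for f
    unfolding K_def by (rule P.dual_norm_bound[OF G that])
  have "\<exists>T\<in>bounded_ops. \<forall>x y. cinner (blinfun_apply T x) y = G (vsum [(x, y)])"
  proof (rule sesquilinear_bounded_representation[where C = K])
    fix x x' y y' :: 'h and c
    have "vsum [(x + x', y)] = vsum [(x, y)] + vsum [(x', y)]"
      by (auto simp: vsum_def fun_eq_iff blinfun.add_right cinner_add_left)
    then show "G (vsum [(x + x', y)]) = G (vsum [(x, y)]) + G (vsum [(x', y)])"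
      using Gadd[OF vsum_normal vsum_normal] by simp
    have "vsum [(x, y + y')] = vsum [(x, y)] + vsum [(x, y')]"
      by (auto simp: vsum_def fun_eq_iff cinner_add_right)
    then show "G (vsum [(x, y + y')]) = G (vsum [(x, y)]) + G (vsum [(x, y')])"
      using Gadd[OF vsum_normal vsum_normal] by simp
    have "vsum [(c *\<^sub>C x, y)] = (\<lambda>a. c * vsum [(x, y)] a)"
      by (auto simp: vsum_def fun_eq_iff scaleC_mem cinner_scaleC_left)
    then show "G (vsum [(c *\<^sub>C x, y)]) = c * G (vsum [(x, y)])" using Gsc[OF vsum_normal] by simp
    have "vsum [(x, c *\<^sub>C y)] = (\<lambda>a. cnj c * vsum [(x, y)] a)"
      by (auto simp: vsum_def fun_eq_iff cinner_scaleC_right)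
    then show "G (vsum [(x, c *\<^sub>C y)]) = cnj c * G (vsum [(x, y)])" using Gsc[OF vsum_normal] by simp
    show "cmod (G (vsum [(x, y)])) \<le> K * norm x * norm y"
      using GK[OF vsum_normal, of "[(x, y)]"] mult_left_mono[OF dual_norm_vsum_single K0, of x y]
      by (simp add: mult.assoc)
  qed (rule K0)
  then obtain T where T: "T \<in> bounded_ops" "\<And>x y. cinner (blinfun_apply T x) y = G (vsum [(x, y)])" by blast
  have TM: "T \<in> M"
  proof (rule memI[OF T(1)])
    fix S x assume S: "S \<in> commutant M"
    then have Sb: "S \<in> bounded_ops" using commutant_sub by blast
    have S': "cinner x (op_adjoint S y) = cinner (S x) y" for x y
      by (metis cinner_commute op_adjoint(1)[OF Sb])
    show "T (S x) = S (T x)"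
    proof (rule cinner_eqI)
      fix y
      \<comment> \<open>\<open>S\<close> commutes with every member of \<open>M\<close>, so moving
        it to the other vector does not change the functional on \<open>M\<close>, and
        \<open>G\<close> cannot tell the two apart.\<close>
      have "vsum [(S x, y)] = vsum [(x, op_adjoint S y)]"
        by (auto simp: vsum_def fun_eq_iff S' commutant_apply[OF S])
      then have "cinner (T (S x)) y = cinner (T x) (op_adjoint S y)" by (simp add: T)
      then show "cinner (T (S x)) y = cinner (S (T x)) y" by (simp add: S')
    qed
  qed
  have Gv: "G (vsum ps) = vsum ps T" for ps
  proof (induction ps)
    case Nil
    have "(0 :: ('h \<Rightarrow>\<^sub>L 'h) \<Rightarrow> complex) = vsum []" by (auto simp: vsum_def)
    then show ?case using Gsc[OF vsum_normal, of 0 "[]"] by (simp add: vsum_def)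
  next
    case (Cons p ps)
    obtain x y where p: "p = (x, y)" by (cases p)
    have "G (vsum (p # ps)) = G (vsum [p]) + G (vsum ps)"
      by (subst vsum_Cons) (rule Gadd[OF vsum_normal vsum_normal])
    also have "\<dots> = vsum (p # ps) T" unfolding Cons p T(2)[symmetric] using TM by (simp add: vsum_def)
    finally show ?case .
  qed
  have "evaluation T f = G f" for f
  proof (cases "f \<in> normal_predual")
    case f: True
    \<comment> \<open>\<open>G\<close> and evaluation at \<open>T\<close> agree on all
      \<open>vsum ps\<close>; norm approximation extends this to the whole predual.\<close>
    have "cmod (G f - f T) \<le> e * (K + norm T)" if e: "e > 0" for e
    proof -
      obtain ps where ps: "\<And>a. a \<in> M \<Longrightarrow> cmod (f a - vsum ps a) \<le> e * norm a"
        using normal_approx[OF f e] by metis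
      have fv: "f - vsum ps \<in> normal_predual" by (rule P.X_diff[OF f vsum_normal])
      have "dual_norm M norm (f - vsum ps) \<le> e" using ps e by (intro BM.dual_norm_le) auto
      then have "cmod (G (f - vsum ps)) \<le> K * e" using GK[OF fv] K0 mult_left_mono by (meson order.trans)
      moreover have "G f = G (f - vsum ps) + vsum ps T" using Gadd[OF fv vsum_normal, of ps] Gv by simp
      ultimately show ?thesis
        using ps[OF TM] norm_triangle_ineq4[of "G (f - vsum ps)" "f T - vsum ps T"] by (simp add: algebra_simps)
    qed
    note le = this
    have k: "K + norm T + 1 > 0" using K0 by (simp add: add_nonneg_pos)
    have "cmod (G f - f T) \<le> 0"
    proof (rule field_le_epsilon)
      fix e :: real assume e: "e > 0"
      have "cmod (G f - f T) \<le> e / (K + norm T + 1) * (K + norm T)" using e k by (intro le) simp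
      also have "\<dots> \<le> e" using e k by (simp add: field_simps)
      finally show "cmod (G f - f T) \<le> 0 + e" by simp
    qed
    then show ?thesis using f by (simp add: evaluation_def)
  next
    case False
    then show ?thesis using P.dual_space_outside[OF G] by (simp add: evaluation_def)
  qed
  then show ?thesis using TM by blast
qed

text \<open>Evaluation is isometric: the functional of the pair \<open>x\<close>, \<open>y\<close>
  has norm at most \<open>norm x * norm y\<close>, and these functionals alone recover the operator
  norm. Surjectivity is \<open>functional_on_normal_predual\<close>.\<close>

lemma normal_vn_predual:
  "vn_predual M (\<lambda>c f x. c * f x) normal_predual (dual_norm M norm) evaluation"
proof -
  let ?n = "dual_norm normal_predual (dual_norm M norm)"
  let ?D = "dual_space (\<lambda>c f x. c * f x) normal_predual (dual_norm M norm)"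
  have ev_bound: "cmod (evaluation a f) \<le> norm a * dual_norm M norm f" if "a \<in> M" "f \<in> normal_predual" for a f
    using BM.dual_norm_bound[OF normal_dual[OF that(2)] that(1)] that by (simp add: evaluation_def mult.commute)
  have evD: "evaluation a \<in> ?D" if a: "a \<in> M" for a
    using ev_bound[OF a] P.X_add P.X_scale by (intro mem_dual_spaceI) (auto simp: evaluation_def)
  have le: "norm a \<le> ?n (evaluation a)" if a: "a \<in> M" for a
  proof (rule norm_blinfun_bound)
    show n0: "0 \<le> ?n (evaluation a)" by (rule P.dual_norm_nonneg[OF evD[OF a]])
    fix x
    show "norm (a x) \<le> ?n (evaluation a) * norm x"
    proof (rule norm_le_cinnerI)
      fix y
      have "cmod (cinner (a x) y) = cmod (evaluation a (vsum [(x, y)]))"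
        using a vsum_normal[of "[(x, y)]"] by (simp add: evaluation_def vsum_def)
      also have "\<dots> \<le> ?n (evaluation a) * dual_norm M norm (vsum [(x, y)])"
        by (rule P.dual_norm_bound[OF evD[OF a] vsum_normal])
      also have "\<dots> \<le> ?n (evaluation a) * (norm x * norm y)"
        by (rule mult_left_mono[OF dual_norm_vsum_single n0])
      finally show "cmod (cinner (a x) y)
          \<le> ?n (evaluation a) * norm x * norm y"
        by (simp add: mult.assoc)
    qed (use n0 in simp)
  qed
  have inj: "inj_on evaluation M"
  proof (rule inj_onI)
    fix a b assume a: "a \<in> M" and b: "b \<in> M" and eq: "evaluation a = evaluation b"
    show "a = b"
    proof (intro blinfun_eqI cinner_eqI)
      fix x y
      show "cinner (a x) y = cinner (b x) y"
        using fun_cong[OF eq, of "vsum [(x, y)]"] vsum_normal[of "[(x, y)]"] a b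
        by (simp add: evaluation_def vsum_def)
    qed
  qed
  have bij: "bij_betw evaluation M ?D"
    unfolding bij_betw_def
  proof (intro conjI inj subset_antisym)
    show "evaluation ` M \<subseteq> ?D" using evD by blast
    show "?D \<subseteq> evaluation ` M" using functional_on_normal_predual by blast
  qed
  have "banach_isomorphism op_scale M norm (\<lambda>c f x. c * f x) ?D
      ?n evaluation"
    unfolding banach_isomorphism_def
  proof (intro conjI ballI allI exI[of _ 1] bij)
    fix a assume a: "a \<in> M"
    show "evaluation (a + b) = evaluation a + evaluation b" if "b \<in> M" for b
      using BM.dual_space_add[OF normal_dual a that] by (auto simp: evaluation_def fun_eq_iff)
    show "evaluation (op_scale c a) = (\<lambda>f. c * evaluation a f)" for c
      using BM.dual_space_scale[OF normal_dual a] by (auto simp: evaluation_def fun_eq_iff)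
    show "?n (evaluation a) \<le> 1 * norm a"
      using ev_bound[OF a] by (intro P.dual_norm_le) auto
    show "norm a \<le> 1 * ?n (evaluation a)" using le[OF a] by simp
  qed
  then show ?thesis by unfold_locales
qed

text \<open>Treats left and right multiplication together: a bounded linear map that pulls sums of
  vector functionals back to such sums also preserves their norm limits.\<close>

lemma normal_compose:
  assumes f: "f \<in> normal_predual"
    and g: "\<And>b. b \<in> M \<Longrightarrow> g b \<in> M" "\<And>b c. b \<in> M \<Longrightarrow> c \<in> M \<Longrightarrow> g (b + c) = g b + g c"
      "\<And>k b. b \<in> M \<Longrightarrow> g (op_scale k b) = op_scale k (g b)"
      "\<And>b. b \<in> M \<Longrightarrow> norm (g b) \<le> C * norm b" and C: "0 < C"
    and v: "\<And>ps. \<exists>qs. \<forall>b\<in>M. vsum ps (g b) = vsum qs b"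
  shows "(\<lambda>b. if b \<in> M then f (g b) else 0) \<in> normal_predual" (is "?l \<in> _")
proof -
  note fd = normal_dual[OF f]
  obtain K where K: "\<forall>a\<in>M. cmod (f a) \<le> K * norm a" by (rule normal_bounded[OF f])
  have K': "cmod (f b) \<le> \<bar>K\<bar> * norm b" if "b \<in> M" for b
    using bspec[OF K that] mult_right_mono[OF abs_ge_self[of K] norm_ge_zero[of b]] by linarith
  have d: "?l \<in> dual_space op_scale M norm"
  proof (rule mem_dual_spaceI[where K = "\<bar>K\<bar> * C"])
    fix b assume b: "b \<in> M"
    show "cmod (?l b) \<le> \<bar>K\<bar> * C * norm b"
      using K'[OF g(1)[OF b]] mult_left_mono[OF g(4)[OF b], of "\<bar>K\<bar>"] b by (simp add: mult.assoc)
  qed (auto simp: g BM.dual_space_add[OF fd] BM.dual_space_scale[OF fd] add_mem scale_mem)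
  have "\<exists>ps. \<forall>b\<in>M. cmod (?l b - vsum ps b) \<le> e * norm b" if e: "e > 0" for e
  proof -
    obtain ps where ps: "\<And>b. b \<in> M \<Longrightarrow> cmod (f b - vsum ps b) \<le> e / C * norm b"
      using normal_approx[OF f, of "e / C"] e C by auto
    obtain qs where qs: "\<And>b. b \<in> M \<Longrightarrow> vsum ps (g b) = vsum qs b" using v by blast
    have "cmod (?l b - vsum qs b) \<le> e * norm b" if b: "b \<in> M" for b
    proof -
      have "cmod (?l b - vsum qs b) \<le> e / C * norm (g b)" using ps[OF g(1)[OF b]] qs[OF b] b by simp
      also have "\<dots> \<le> e / C * (C * norm b)" using e C by (intro mult_left_mono g(4)[OF b]) simp
      finally show ?thesis using C by simp
    qed
    then show ?thesis by blast
  qed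
  then show ?thesis using d by (simp add: normal_predual_def)
qed

lemma vsum_adj_comp:
  assumes "a \<in> M" "b \<in> M"
  shows "vsum ps (op_adjoint a o\<^sub>L b) = vsum (map (\<lambda>(x, y). (x, a y)) ps) b"
  using assms by (simp add: vsum_def comp_mem adj cinner_adj o_def case_prod_unfold)

lemma normal_mult:
  assumes f: "f \<in> normal_predual" and a: "a \<in> M"
  shows "(\<lambda>b. if b \<in> M then f (a o\<^sub>L b) else 0) \<in> normal_predual"
    and "(\<lambda>b. if b \<in> M then f (b o\<^sub>L a) else 0) \<in> normal_predual"
proof -
  have alg: "a o\<^sub>L (b + c) = (a o\<^sub>L b) + (a o\<^sub>L c)" "(b + c) o\<^sub>L a = (b o\<^sub>L a) + (c o\<^sub>L a)"
    "a o\<^sub>L op_scale k b = op_scale k (a o\<^sub>L b)" "op_scale k b o\<^sub>L a = op_scale k (b o\<^sub>L a)" for b c k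
    by (auto intro!: blinfun_eqI simp: blinfun.add_left blinfun.add_right scaleC_mem[OF a])
  \<comment> \<open>The \<open>+ 1\<close> keeps the constant positive when \<open>a = 0\<close>,
    since the approximation error is divided by it.\<close>
  have n: "norm (a o\<^sub>L b) \<le> (norm a + 1) * norm b" "norm (b o\<^sub>L a) \<le> (norm a + 1) * norm b" for b
    using norm_blinfun_compose[of a b] norm_blinfun_compose[of b a] norm_ge_zero[of b]
    by (simp_all only: distrib_right mult.commute[of "norm b"] mult_1)
  have C: "0 < norm a + 1" by (simp add: add_nonneg_pos)
  have "vsum ps (a o\<^sub>L b) = vsum (map (\<lambda>(x, y). (x, op_adjoint a y)) ps) b" if "b \<in> M" for ps b
    using vsum_adj_comp[OF adj[OF a] that] by (simp add: adj_adj[OF a])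
  then show "(\<lambda>b. if b \<in> M then f (a o\<^sub>L b) else 0) \<in> normal_predual"
    by (intro normal_compose[OF f _ _ _ n(1) C]) (use a in \<open>auto simp: alg\<close>)
  have "vsum ps (b o\<^sub>L a) = vsum (map (\<lambda>(x, y). (a x, y)) ps) b" if "b \<in> M" for ps b
    using that a by (simp add: vsum_def comp_mem o_def case_prod_unfold)
  then show "(\<lambda>b. if b \<in> M then f (b o\<^sub>L a) else 0) \<in> normal_predual"
    by (intro normal_compose[OF f _ _ _ n(2) C]) (use a in \<open>auto simp: alg\<close>)
qed

text \<open>The existence half: both multiplications are transposes of maps of the normal predual.
  It also makes every compactness result of the locale available for the normal topology.\<close>

lemma normal_vn_predual_sep:
  "vn_predual_sep M (\<lambda>c f x. c * f x) normal_predual (dual_norm M norm) evaluation"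
proof -
  interpret vn_predual M "\<lambda>c f x. c * f x" normal_predual "dual_norm M norm" evaluation
    by (rule normal_vn_predual)
  have ev: "continuous_map W euclidean (\<lambda>b. f b)" if "f \<in> normal_predual" for f
    using continuous_map_eval[OF that] that by (simp add: evaluation_def)
  show ?thesis
  proof (unfold_locales, unfold separately_continuous_mult_def, intro ballI conjI)
    fix a assume a: "a \<in> M"
    show "continuous_map W W (\<lambda>b. a o\<^sub>L b)"
    proof (rule continuous_map_into_W)
      fix f assume f: "f \<in> normal_predual"
      show "continuous_map W euclidean (\<lambda>b. evaluation (a o\<^sub>L b) f)"
        by (rule continuous_map_eq[OF ev[OF normal_mult(1)[OF f a]]]) (use f in \<open>auto simp: topspace_W evaluation_def\<close>)
    qed (use a in \<open>auto simp: topspace_W\<close>)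
    show "continuous_map W W (\<lambda>b. b o\<^sub>L a)"
    proof (rule continuous_map_into_W)
      fix f assume f: "f \<in> normal_predual"
      show "continuous_map W euclidean (\<lambda>b. evaluation (b o\<^sub>L a) f)"
        by (rule continuous_map_eq[OF ev[OF normal_mult(2)[OF f a]]]) (use f in \<open>auto simp: topspace_W evaluation_def\<close>)
    qed (use a in \<open>auto simp: topspace_W\<close>)
  qed
qed

text \<open>Truncate the finite partial sums of the weighted effects and use compactness of the order
  interval in the normal topology.\<close>

lemma effects_common_bound:
  assumes G: "\<And>a l. (a, l) \<in> G \<Longrightarrow> a \<in> effects M \<and> l > 0" and F: "finite F"
    and s: "\<And>G0. finite G0 \<Longrightarrow> G0 \<subseteq> G \<Longrightarrow> (\<Sum>(a, l)\<in>G0. \<Sum>x\<in>F. l * quad a x) \<le> s"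
  shows "\<exists>c\<in>effects M. (\<Sum>x\<in>F. quad c x) \<le> s \<and>
    (\<forall>a l. (a, l) \<in> G \<longrightarrow> (\<forall>x. quad a x \<le> quad c x + (norm x)\<^sup>2 / l))"
proof -
  interpret vn_predual_sep M "\<lambda>c f x. c * f x" normal_predual "dual_norm M norm" evaluation
    by (rule normal_vn_predual_sep)
  \<comment> \<open>Here \<open>W\<close> denotes the normal topology, in which quadratic forms are
    continuous; that is why the common bound is sought there.\<close>
  have q: "continuous_map W euclidean (\<lambda>c. quad c x)" for x
  proof -
    have "continuous_map W euclidean (\<lambda>c. evaluation c (vsum [(x, x)]))"
      by (rule continuous_map_eval[OF vsum_normal])
    then have "continuous_map W euclidean (\<lambda>c. Re (evaluation c (vsum [(x, x)])))"
      by (rule continuous_map_euclidean_compose) (intro continuous_intros)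
    then show ?thesis
      by (rule continuous_map_eq) (use vsum_normal[of "[(x, x)]"] in \<open>auto simp: topspace_W evaluation_def vsum_def\<close>)
  qed
  define E where "E = {c \<in> topspace W. (\<Sum>x\<in>F. quad c x) \<in> {..s}}"
  define A where "A p = (\<Inter>x. {c \<in> topspace W. quad c x \<in> {quad (fst p) x - (norm x)\<^sup>2 / snd p..}})" for p
  have "closedin W E" unfolding E_def
    by (intro closedin_euclidean_preimage continuous_map_sum q) (auto simp: F)
  moreover have "closedin W (A p)" for p unfolding A_def
    by (intro closedin_INT closedin_euclidean_preimage q) auto
  ultimately have cl: "\<forall>C\<in>insert E (A ` G). closedin W C" by auto
  have fip: "effects M \<inter> \<Inter>\<F> \<noteq> {}" if fin: "finite \<F>" and sub': "\<F> \<subseteq> insert E (A ` G)" for \<F>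
  proof -
    have "finite (\<F> - {E})" "\<F> - {E} \<subseteq> A ` G" using fin sub' by auto
    then obtain G0 where G0: "G0 \<subseteq> G" "finite G0" "\<F> - {E} = A ` G0"
      using finite_subset_image by metis
    define h where "h = (\<Sum>p\<in>G0. snd p *\<^sub>R fst p)"
    have pG: "fst p \<in> effects M" "snd p > 0" if "p \<in> G0" for p
      using G[of "fst p" "snd p"] that G0(1) by auto
    have hM: "h \<in> M" unfolding h_def using pG effects_mem by (intro sum_mem) blast
    have hx: "cinner (h x) x = (\<Sum>p\<in>G0. of_real (snd p) * cinner (blinfun_apply (fst p) x) x)" for x
      by (simp add: h_def blinfun.sum_left cinner_sum_left blinfun.scaleR_left cinner_scaleR_left)
    have eff: "Im (cinner (blinfun_apply (fst p) x) x) = 0" "0 \<le> quad (fst p) x" if "p \<in> G0" for p x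
      using pG(1)[OF that] by (auto simp: effects_def positive_op_def)
    have qh: "quad h x = (\<Sum>p\<in>G0. snd p * quad (fst p) x)" for x by (simp add: hx)
    have nn: "0 \<le> snd p * quad (fst p) x" if "p \<in> G0" for p x
      using eff(2)[OF that, of x] pG(2)[OF that] by simp
    have "positive_op h"
      unfolding positive_op_def
    proof (intro conjI allI)
      show "h \<in> bounded_ops" using hM sub by blast
      show "Im (cinner (h x) x) = 0" for x using eff(1) by (simp add: hx)
      show "0 \<le> quad h x" for x unfolding qh by (rule sum_nonneg) (rule nn)
    qed
    \<comment> \<open>Each weighted effect lies below \<open>h\<close>, so the truncation dominates
      it up to \<open>(norm y)\<^sup>2 / l\<close>, while \<open>quad c x \<le> quad h x\<close>
      keeps the sum over \<open>F\<close> at most \<open>s\<close>.\<close>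
    from positive_op_truncation[OF hM this] obtain c where c: "c \<in> effects M" "\<And>x. quad c x \<le> quad h x"
      "\<And>a l y. a \<in> effects M \<Longrightarrow> l > 0 \<Longrightarrow> (\<And>x. l * quad a x \<le> quad h x) \<Longrightarrow>
         quad a y \<le> quad c y + (norm y)\<^sup>2 / l" by blast
    have cM: "c \<in> topspace W" using c(1) by (simp add: topspace_W effects_mem)
    have "(\<Sum>x\<in>F. quad c x) \<le> (\<Sum>x\<in>F. quad h x)" by (intro sum_mono c)
    also have "\<dots> = (\<Sum>p\<in>G0. \<Sum>x\<in>F. snd p * quad (fst p) x)" unfolding qh by (rule sum.swap)
    also have "\<dots> \<le> s" using s[OF G0(2,1)] by (simp add: case_prod_unfold)
    finally have "c \<in> E" using cM by (simp add: E_def)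
    moreover have "c \<in> A p" if p: "p \<in> G0" for p
    proof -
      have "snd p * quad (fst p) x \<le> quad h x" for x unfolding qh
        by (rule member_le_sum[OF p _ G0(2)]) (use nn in blast)
      then have "quad (fst p) y \<le> quad c y + (norm y)\<^sup>2 / snd p" for y using c(3) pG[OF p] by blast
      then show ?thesis using cM by (simp add: A_def algebra_simps)
    qed
    ultimately have "c \<in> \<Inter>\<F>" using G0(3) by blast
    then show ?thesis using c(1) by blast
  qed
  have "effects M \<inter> \<Inter>(insert E (A ` G)) \<noteq> {}"
    using compactin_effects cl fip unfolding compactin_fip by blast
  then obtain c where c: "c \<in> effects M" "c \<in> E" "\<And>p. p \<in> G \<Longrightarrow> c \<in> A p" by blast
  have "quad a x \<le> quad c x + (norm x)\<^sup>2 / l" if "(a, l) \<in> G" for a l x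
    using c(3)[OF that] by (simp add: A_def algebra_simps)
  then show ?thesis using c by (auto simp: E_def)
qed

end

section \<open>Weak-star continuous functionals are normal\<close>

context vn_predual_sep
begin

section \<open>Polar decomposition and positivity of weak-star continuous functionals\<close>

definition W_linear :: "(('h \<Rightarrow>\<^sub>L 'h) \<Rightarrow> complex) \<Rightarrow> bool" where
  "W_linear \<phi> \<longleftrightarrow> (\<forall>a\<in>M. \<forall>b\<in>M. \<phi> (a + b) = \<phi> a + \<phi> b) \<and>
     (\<forall>c. \<forall>a\<in>M. \<phi> (op_scale c a) = c * \<phi> a) \<and> continuous_map W euclidean \<phi>"

lemma W_linear_add: "W_linear \<phi> \<Longrightarrow> a \<in> M \<Longrightarrow> b \<in> M \<Longrightarrow> \<phi> (a + b) = \<phi> a + \<phi> b"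
  and W_linear_scale: "W_linear \<phi> \<Longrightarrow> a \<in> M \<Longrightarrow> \<phi> (op_scale c a) = c * \<phi> a"
  and W_linear_continuous: "W_linear \<phi> \<Longrightarrow> continuous_map W euclidean \<phi>"
  by (auto simp: W_linear_def)

lemma W_linear_zero: "W_linear \<phi> \<Longrightarrow> \<phi> 0 = 0"
  using W_linear_add[of \<phi> 0 0] zero_mem by simp

lemma W_linear_attains_norm:
  assumes f: "W_linear \<phi>"
  obtains a s where "a \<in> M" "norm a \<le> 1" "0 \<le> s" "\<phi> a = of_real s" "\<forall>b\<in>M. cmod (\<phi> b) \<le> s * norm b"
proof -
  let ?B = "{a \<in> M. norm a \<le> 1}"
  have "continuous_map W euclidean (\<lambda>a. cmod (\<phi> a))"
    by (rule continuous_map_euclidean_compose[OF W_linear_continuous[OF f]]) (intro continuous_intros)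
  from image_compactin[OF compactin_unit_ball this] have "compact ((\<lambda>a. cmod (\<phi> a)) ` ?B)"
    by (simp add: compactin_euclidean_iff)
  moreover have "0 \<in> ?B" using zero_mem by simp
  ultimately obtain a0 where a0: "a0 \<in> M" "norm a0 \<le> 1"
    "\<And>b. b \<in> M \<Longrightarrow> norm b \<le> 1 \<Longrightarrow> cmod (\<phi> b) \<le> cmod (\<phi> a0)"
    using compact_attains_sup[of "(\<lambda>a. cmod (\<phi> a)) ` ?B"] by blast
  define s where "s = cmod (\<phi> a0)"
  \<comment> \<open>A phase that makes the value at the maximiser real and nonnegative.\<close>
  define c where "c = (if \<phi> a0 = 0 then 1 else cnj (\<phi> a0) / of_real s)"
  have c: "cmod c = 1" by (simp add: c_def s_def norm_divide)
  have "c * \<phi> a0 = of_real s"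
    by (simp add: c_def s_def mult.commute[of "cnj (\<phi> a0)"] complex_norm_square[symmetric] power2_eq_square)
  moreover have "cmod (\<phi> b) \<le> s * norm b" if b: "b \<in> M" for b
  proof (cases "b = 0")
    case False
    let ?b = "op_scale (of_real (inverse (norm b))) b"
    have "cmod (\<phi> ?b) \<le> s" unfolding s_def
      by (rule a0(3)) (use b False in \<open>auto simp: norm_op_scale norm_inverse\<close>)
    then show ?thesis using False
      by (simp add: W_linear_scale[OF f b] norm_mult norm_inverse norm_divide field_simps)
  qed (simp add: W_linear_zero[OF f])
  ultimately show ?thesis using a0 c
    by (intro that[of "op_scale c a0" s]) (auto simp: s_def norm_op_scale W_linear_scale[OF f])
qed

text \<open>If \<open>\<phi>\<close> attains its norm at \<open>a\<close>, then \<open>\<phi>((1 - aa\<^sup>*)b) = 0\<close>: perturbing \<open>a\<close> in these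
  directions increases its norm only to second order.\<close>

lemma norm_perturbation_le:
  assumes a: "a \<in> M" "norm a \<le> 1" and b: "b \<in> M"
  shows "norm (a + ((id_blinfun - (a o\<^sub>L op_adjoint a)) o\<^sub>L b)) \<le> sqrt (1 + (norm b)\<^sup>2)"
proof -
  define e where "e = id_blinfun - (a o\<^sub>L op_adjoint a)"
  have ce: "cinner (e y) z = cinner y z - cinner (op_adjoint a y) (op_adjoint a z)" for y z
    by (simp add: e_def blinfun.diff_left cinner_algebra cinner_adj'[OF a(1)])
  have "norm (op_adjoint a y) \<le> norm y" for y
    using norm_blinfun[of "op_adjoint a" y] norm_adj[OF a(1)] a(2) mult_right_mono[of "norm a" 1 "norm y"] by simp
  then have "(norm (op_adjoint a y))\<^sup>2 \<le> (norm y)\<^sup>2" for y by (intro power_mono) auto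
  moreover have eM: "e \<in> M" unfolding e_def using a by blast
  ultimately have eff: "e \<in> effects M" using sub by (auto simp: effects_def positive_op_def ce cinner_self)
  have sa: "cinner (e y) z = cinner y (e z)" for y z
    using eff by (intro positive_op_selfadjoint) (simp add: effects_def)
  \<comment> \<open>For the effect \<open>e\<close> this is \<open>e\<^sup>2 \<le> e\<close>: the
    squared norms of \<open>op_adjoint a y\<close> and \<open>e y\<close> add up to at most that of
    \<open>y\<close>.\<close>
  have e2: "(norm (e y))\<^sup>2 \<le> (norm y)\<^sup>2 - (norm (op_adjoint a y))\<^sup>2" for y
    using effects_norm_square_le[OF eff, of y] by (simp add: ce)
  show ?thesis unfolding e_def[symmetric]
  proof (rule norm_blinfun_bound)
    fix x
    define y where "y = (a + (e o\<^sub>L b)) x"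
    define u v where "u = norm (op_adjoint a y)" and "v = norm (e y)"
    have "cinner y y = cinner x (op_adjoint a y) + cinner (b x) (e y)"
      by (subst (1) y_def) (simp add: blinfun.add_left cinner_add_left sa cinner_adj'[OF a(1)])
    then have "(norm y)\<^sup>2 = Re (cinner x (op_adjoint a y)) + Re (cinner (b x) (e y))"
      by (metis Re_cinner_self plus_complex.simps(1))
    also have "\<dots> \<le> norm x * u + norm (b x) * v"
      using cinner_cauchy_schwarz[of x "op_adjoint a y"] cinner_cauchy_schwarz[of "b x" "e y"]
        complex_Re_le_cmod[of "cinner x (op_adjoint a y)"] complex_Re_le_cmod[of "cinner (b x) (e y)"]
      unfolding u_def v_def by linarith
    also have "\<dots> \<le> norm x * u + (norm b * norm x) * v"
      by (intro add_left_mono mult_right_mono norm_blinfun) (simp add: v_def)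
    also have "\<dots> = norm x * (u + norm b * v)" by (simp add: algebra_simps)
    also have "\<dots> \<le> norm x * (sqrt (1 + (norm b)\<^sup>2) * norm y)"
    proof (intro mult_left_mono)
      \<comment> \<open>Cauchy-Schwarz in the plane for the vectors \<open>(1, norm b)\<close> and
        \<open>(u, v)\<close>.\<close>
      have "0 \<le> (norm b * u - v)\<^sup>2" by simp
      then have "(u + norm b * v)\<^sup>2 \<le> (1 + (norm b)\<^sup>2) * (u\<^sup>2 + v\<^sup>2)"
        by (simp add: power2_eq_square algebra_simps)
      also have "\<dots> \<le> (1 + (norm b)\<^sup>2) * (norm y)\<^sup>2"
        using e2[of y] by (intro mult_left_mono) (auto simp: u_def v_def)
      also have "\<dots> = (sqrt (1 + (norm b)\<^sup>2) * norm y)\<^sup>2" by (simp add: power_mult_distrib)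
      finally show "u + norm b * v \<le> sqrt (1 + (norm b)\<^sup>2) * norm y" by (rule power2_le_imp_le) simp
    qed simp
    finally have "norm y * norm y \<le> (sqrt (1 + (norm b)\<^sup>2) * norm x) * norm y"
      by (simp add: power2_eq_square mult_ac)
    then show "norm ((a + (e o\<^sub>L b)) x) \<le> sqrt (1 + (norm b)\<^sup>2) * norm x"
      unfolding y_def[symmetric] by (cases "y = 0") (auto simp: mult_le_cancel_right)
  qed simp
qed

lemma W_linear_vanishes:
  assumes f: "W_linear \<phi>" and a: "a \<in> M" "norm a \<le> 1" and s: "0 \<le> s" "\<phi> a = of_real s"
    and le: "\<And>b. b \<in> M \<Longrightarrow> cmod (\<phi> b) \<le> s * norm b" and b: "b \<in> M"
  shows "\<phi> ((id_blinfun - (a o\<^sub>L op_adjoint a)) o\<^sub>L b) = 0"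
proof (rule ccontr)
  define e where "e = id_blinfun - (a o\<^sub>L op_adjoint a)"
  have eM: "e \<in> M" unfolding e_def using a by blast
  define w where "w = \<phi> (e o\<^sub>L b)"
  assume "\<phi> ((id_blinfun - (a o\<^sub>L op_adjoint a)) o\<^sub>L b) \<noteq> 0"
  then have w: "w \<noteq> 0" by (simp add: w_def e_def)
  define r where "r = (cmod w)\<^sup>2"
  have r: "r > 0" using w by (simp add: r_def)
  have s0: "s > 0" using le[OF comp_mem[OF eM b]] w s by (cases "s = 0") (auto simp: w_def)
  define K where "K = r * (norm b)\<^sup>2"
  have K: "K \<ge> 0" using r by (simp add: K_def)
  have *: "2 * s * r \<le> s\<^sup>2 * K * t" if t: "t > 0" for t
  proof -
    \<comment> \<open>This phase makes the gain of the functional the positive number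
      \<open>t * r\<close>, of first order in \<open>t\<close>, against a norm increase of second
      order.\<close>
    define k where "k = of_real t * cnj w"
    have kb: "op_scale k b \<in> M" using b by blast
    have comp: "e o\<^sub>L op_scale k b = op_scale k (e o\<^sub>L b)"
      by (rule blinfun_eqI) (simp add: scaleC_mem[OF eM])
    have "\<phi> (a + (e o\<^sub>L op_scale k b)) = of_real s + k * w"
      using W_linear_add[OF f a(1) comp_mem[OF eM kb]] W_linear_scale[OF f comp_mem[OF eM b]] s
      by (simp add: comp w_def)
    also have "k * w = of_real (t * r)"
      by (simp add: k_def r_def mult.assoc mult.commute[of "cnj w"] complex_norm_square[symmetric])
    finally have "cmod (\<phi> (a + (e o\<^sub>L op_scale k b))) = s + t * r"
      using s t r by (metis abs_of_nonneg add_nonneg_nonneg less_imp_le mult_nonneg_nonneg norm_of_real of_real_add)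
    then have "s + t * r \<le> s * norm (a + (e o\<^sub>L op_scale k b))"
      using le[OF add_mem[OF a(1) comp_mem[OF eM kb]]] by simp
    also have "\<dots> \<le> s * sqrt (1 + (norm (op_scale k b))\<^sup>2)"
      using norm_perturbation_le[OF a kb] s unfolding e_def by (intro mult_left_mono)
    also have "(norm (op_scale k b))\<^sup>2 = t\<^sup>2 * K"
      by (simp add: norm_op_scale k_def norm_mult K_def r_def power_mult_distrib)
    finally have "(s + t * r)\<^sup>2 \<le> (s * sqrt (1 + t\<^sup>2 * K))\<^sup>2" using s t r by (intro power_mono) auto
    also have "\<dots> = s\<^sup>2 + s\<^sup>2 * t\<^sup>2 * K" using K by (simp add: power_mult_distrib algebra_simps)
    finally have "t * (2 * s * r) + (t * r)\<^sup>2 \<le> t * (s\<^sup>2 * K * t)" by (simp add: power2_eq_square algebra_simps)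
    then have "t * (2 * s * r) \<le> t * (s\<^sup>2 * K * t)" using zero_le_power2[of "t * r"] by linarith
    then show ?thesis using t by simp
  qed
  have k: "s * K + 1 > 0" using s K by (simp add: add_nonneg_pos)
  \<comment> \<open>The inequality \<open>*\<close> fails for small \<open>t\<close>; at this one
    its right-hand side is at most \<open>s * r\<close>.\<close>
  have "2 * s * r \<le> s\<^sup>2 * K * (r / (s * K + 1))" using r k by (intro *) simp
  also have "\<dots> = s * r * (s * K / (s * K + 1))" by (simp add: power2_eq_square)
  also have "\<dots> \<le> s * r * 1" using s0 r k by (intro mult_left_mono) auto
  finally show False using s0 r by simp
qed

lemma W_linear_mult: "W_linear \<phi> \<Longrightarrow> a \<in> M \<Longrightarrow> W_linear (\<lambda>b. \<phi> (a o\<^sub>L b))"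
proof -
  assume f: "W_linear \<phi>" and a: "a \<in> M"
  have alg: "a o\<^sub>L (b + c) = (a o\<^sub>L b) + (a o\<^sub>L c)" "a o\<^sub>L op_scale k b = op_scale k (a o\<^sub>L b)" for b c k
    by (auto intro!: blinfun_eqI simp: blinfun.add_left blinfun.add_right scaleC_mem[OF a])
  have "continuous_map W euclidean (\<phi> \<circ> (\<lambda>b. a o\<^sub>L b))"
    by (rule continuous_map_compose[OF continuous_mult(1)[OF a] W_linear_continuous[OF f]])
  then show ?thesis using a
    by (auto simp: W_linear_def alg W_linear_add[OF f] W_linear_scale[OF f] comp_mem o_def)
qed

text \<open>A functional of norm \<open>s = \<psi> 1\<close> is positive.\<close>

definition W_positive :: "(('h \<Rightarrow>\<^sub>L 'h) \<Rightarrow> complex) \<Rightarrow> real \<Rightarrow> bool" where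
  "W_positive \<psi> s \<longleftrightarrow> W_linear \<psi> \<and> 0 \<le> s \<and> \<psi> id_blinfun = of_real s \<and> (\<forall>b\<in>M. cmod (\<psi> b) \<le> s * norm b)"

text \<open>With \<open>a\<close> a point of the unit ball where the norm is attained, \<psi> is
  \<phi> after left multiplication by \<open>a\<close>; it recovers \<phi> because \<phi> vanishes
  on the part of \<open>b\<close> cut out by \<open>id_blinfun - (a o\<^sub>L op_adjoint a)\<close>.
  Only contractivity of \<open>a\<close> is recorded.\<close>

lemma W_linear_polar:
  assumes f: "W_linear \<phi>"
  obtains \<psi> s a where "W_positive \<psi> s" "a \<in> M" "norm a \<le> 1" "\<forall>b\<in>M. \<phi> b = \<psi> (op_adjoint a o\<^sub>L b)"
proof -
  obtain a s where a: "a \<in> M" "norm a \<le> 1" and s: "0 \<le> s" "\<phi> a = of_real s"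
    and "\<forall>b\<in>M. cmod (\<phi> b) \<le> s * norm b" by (rule W_linear_attains_norm[OF f])
  then have le: "\<And>b. b \<in> M \<Longrightarrow> cmod (\<phi> b) \<le> s * norm b" by blast
  have "cmod (\<phi> (a o\<^sub>L b)) \<le> s * norm b" if b: "b \<in> M" for b
  proof -
    have "norm (a o\<^sub>L b) \<le> norm b"
      using norm_blinfun_compose[of a b] mult_right_mono[OF a(2), of "norm b"] by simp
    then show ?thesis using le[OF comp_mem[OF a(1) b]] mult_left_mono[OF _ s(1)] by (meson order.trans)
  qed
  moreover have "a o\<^sub>L id_blinfun = a" by (rule blinfun_eqI) simp
  ultimately have p: "W_positive (\<lambda>b. \<phi> (a o\<^sub>L b)) s"
    using W_linear_mult[OF f a(1)] s by (simp add: W_positive_def)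
  have "\<phi> b = \<phi> (a o\<^sub>L (op_adjoint a o\<^sub>L b))" if b: "b \<in> M" for b
  proof -
    let ?e = "(id_blinfun - (a o\<^sub>L op_adjoint a)) o\<^sub>L b"
    have "b = ?e + (a o\<^sub>L (op_adjoint a o\<^sub>L b))" by (rule blinfun_eqI) (simp add: blinfun.add_left blinfun.diff_left)
    then have "\<phi> b = \<phi> (?e + (a o\<^sub>L (op_adjoint a o\<^sub>L b)))" by simp
    also have "\<dots> = \<phi> ?e + \<phi> (a o\<^sub>L (op_adjoint a o\<^sub>L b))"
      by (rule W_linear_add[OF f]) (use a b in auto)
    finally show ?thesis using W_linear_vanishes[OF f a s le b] by simp
  qed
  then show ?thesis using that[OF p a] by blast
qed

text \<open>An effect lies in all the balls of \<open>effects_iff_norm\<close>. The bound on \<psi>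
  and its value \<open>s\<close> at the identity map them into the disks of
  \<open>in_segment_if_in_disks\<close>.\<close>

lemma W_positive_effects:
  assumes p: "W_positive \<psi> s" and q: "q \<in> effects M"
  shows "Im (\<psi> q) = 0" "0 \<le> Re (\<psi> q)" "Re (\<psi> q) \<le> s"
proof -
  have f: "W_linear \<psi>" and s: "0 \<le> s" "\<psi> id_blinfun = of_real s"
    and le: "\<And>b. b \<in> M \<Longrightarrow> cmod (\<psi> b) \<le> s * norm b" using p by (auto simp: W_positive_def)
  have qM: "q \<in> M" by (rule effects_mem[OF q])
  have "cmod (\<psi> q - (1/2 + \<i> * of_real t) * of_real s) \<le> sqrt (1/4 + t\<^sup>2) * s" for t
  proof -
    define c where "c = 1/2 + \<i> * complex_of_real t"
    have "q - op_scale c id_blinfun = q + op_scale (- c) id_blinfun"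
      by (rule blinfun_eqI) (simp add: blinfun.diff_left blinfun.add_left cinner_algebra cinner_eqI)
    then have "\<psi> (q - op_scale c id_blinfun) = \<psi> q + (- c) * \<psi> id_blinfun"
      by (simp only: W_linear_add[OF f qM scale_mem[OF id_mem]] W_linear_scale[OF f id_mem])
    then have "\<psi> (q - op_scale c id_blinfun) = \<psi> q - c * of_real s" by (simp add: s(2))
    moreover have "cmod (\<psi> (q - op_scale c id_blinfun)) \<le> s * norm (q - op_scale c id_blinfun)"
      by (rule le) (use qM in auto)
    moreover have "norm (q - op_scale c id_blinfun) \<le> sqrt (1/4 + t\<^sup>2)"
      using q effects_iff_norm[OF sub] by (simp add: c_def)
    ultimately show ?thesis using mult_left_mono[OF _ s(1)] unfolding c_def[symmetric]
      by (metis mult.commute order.trans)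
  qed
  from in_segment_if_in_disks[OF this s(1)]
  show "Im (\<psi> q) = 0" "0 \<le> Re (\<psi> q)" "Re (\<psi> q) \<le> s" by simp_all
qed

lemma W_positive_square:
  assumes p: "W_positive \<psi> s" and b: "b \<in> M"
  shows "Im (\<psi> (op_adjoint b o\<^sub>L b)) = 0" "0 \<le> Re (\<psi> (op_adjoint b o\<^sub>L b))"
proof -
  have f: "W_linear \<psi>" using p by (simp add: W_positive_def)
  \<comment> \<open>Division by \<open>r\<close> brings \<open>op_adjoint b o\<^sub>L b\<close> into
    the order interval; the \<open>+ 1\<close> covers \<open>b = 0\<close>.\<close>
  define r where "r = (norm b + 1)\<^sup>2"
  have "norm b + 1 > 0" by (simp add: add_nonneg_pos)
  then have r: "r > 0" by (simp add: r_def)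
  have bbM: "op_adjoint b o\<^sub>L b \<in> M" using b by blast
  define q where "q = op_scale (of_real (inverse r)) (op_adjoint b o\<^sub>L b)"
  have cq: "cinner (q x) x = of_real (inverse r * (norm (b x))\<^sup>2)" for x
    using quad_adj_comp[OF b, of x] by (simp add: q_def cinner_scaleC_left)
  have "inverse r * (norm (b x))\<^sup>2 \<le> (norm x)\<^sup>2" for x
  proof -
    have "norm (b x) \<le> (norm b + 1) * norm x"
      using norm_blinfun[of b x] norm_ge_zero[of x] unfolding distrib_right by linarith
    then have "(norm (b x))\<^sup>2 \<le> r * (norm x)\<^sup>2"
      unfolding r_def power_mult_distrib[symmetric] by (intro power_mono) auto
    then show ?thesis using r by (simp add: field_simps)
  qed
  moreover have "q \<in> M" unfolding q_def using bbM by blast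
  moreover have "Im (cinner (q x) x) = 0" "quad q x = inverse r * (norm (b x))\<^sup>2" for x
    by (simp_all only: cq Im_complex_of_real Re_complex_of_real)
  ultimately have "q \<in> effects M" using sub r by (auto simp: effects_def positive_op_def)
  from W_positive_effects[OF p this] have q: "Im (\<psi> q) = 0" "0 \<le> Re (\<psi> q)" by auto
  have "\<psi> q = of_real (inverse r) * \<psi> (op_adjoint b o\<^sub>L b)"
    unfolding q_def by (rule W_linear_scale[OF f bbM])
  then have "Im (\<psi> q) = inverse r * Im (\<psi> (op_adjoint b o\<^sub>L b))" "Re (\<psi> q) = inverse r * Re (\<psi> (op_adjoint b o\<^sub>L b))"
    by (simp_all del: of_real_inverse)
  then show "Im (\<psi> (op_adjoint b o\<^sub>L b)) = 0" "0 \<le> Re (\<psi> (op_adjoint b o\<^sub>L b))"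
    using q r by (auto simp: zero_le_mult_iff)
qed

text \<open>Positivity at \<open>b = a - l\<close> times the identity gives a quadratic polynomial
  in \<open>l\<close>, to which the discriminant lemma applies.\<close>

lemma W_positive_cauchy_schwarz:
  assumes p: "W_positive \<psi> s" and a: "a \<in> M"
  shows "(cmod (\<psi> a))\<^sup>2 \<le> Re (\<psi> (op_adjoint a o\<^sub>L a)) * s"
proof -
  have f: "W_linear \<psi>" and s: "0 \<le> s" "\<psi> id_blinfun = of_real s" using p by (auto simp: W_positive_def)
  define A where "A = \<psi> (op_adjoint a o\<^sub>L a)"
  have aa: "op_adjoint a \<in> M" "op_adjoint a o\<^sub>L a \<in> M" using a by auto
  have expand: "Im (A - l * \<psi> (op_adjoint a) - cnj l * \<psi> a + of_real ((cmod l)\<^sup>2 * s)) = 0 \<and>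
      0 \<le> Re (A - l * \<psi> (op_adjoint a) - cnj l * \<psi> a + of_real ((cmod l)\<^sup>2 * s))" for l
  proof -
    define b where "b = a + op_scale (- l) id_blinfun"
    have bM: "b \<in> M" unfolding b_def using a by blast
    have "op_adjoint b = op_adjoint a + op_scale (- cnj l) id_blinfun"
      by (rule op_adjoint_eqI)
        (use bM sub in \<open>auto simp: b_def blinfun.add_left cinner_algebra cinner_adj[OF a]\<close>)
    then have "op_adjoint b o\<^sub>L b = (op_adjoint a o\<^sub>L a) + (op_scale (- l) (op_adjoint a)
        + (op_scale (- cnj l) a + op_scale (of_real ((cmod l)\<^sup>2)) id_blinfun))"
      by (intro blinfun_eqI)
        (simp add: b_def blinfun.add_left blinfun.add_right scaleC_mem[OF aa(1)] scaleC_add_right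
          scaleC_scaleC complex_norm_square mult.commute add.assoc del: of_real_power)
    also have "\<psi> \<dots> = A + (- l * \<psi> (op_adjoint a) + (- cnj l * \<psi> a + of_real ((cmod l)\<^sup>2) * of_real s))"
      using a aa by (simp add: W_linear_add[OF f] W_linear_scale[OF f] add_mem scale_mem id_mem A_def s(2)
          del: of_real_power)
    finally have "\<psi> (op_adjoint b o\<^sub>L b) = A - l * \<psi> (op_adjoint a) - cnj l * \<psi> a + of_real ((cmod l)\<^sup>2 * s)"
      by simp
    then show ?thesis using W_positive_square[OF p bM] by simp
  qed
  have "Im A = 0" using W_positive_square[OF p a] by (simp add: A_def)
  \<comment> \<open>That \<psi> respects adjoints is deduced from the polynomial being real:
    \<open>l = 1\<close> compares imaginary parts and \<open>l = \<i>\<close> real parts.\<close>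
  then have h: "\<psi> (op_adjoint a) = cnj (\<psi> a)"
    using expand[of 1] expand[of \<i>] by (simp add: complex_eq_iff)
  have "(cmod (\<psi> a))\<^sup>2 \<le> Re A * s"
  proof (rule psd_quadratic_discriminant[OF _ s(1)])
    fix l
    show "0 \<le> Re A - 2 * Re (cnj l * \<psi> a) + (cmod l)\<^sup>2 * s"
      using expand[of l] by (simp add: h del: of_real_mult of_real_power)
  qed
  then show ?thesis by (simp add: A_def)
qed

section \<open>Positive functionals are small on effects that are small at finitely many
  vectors\<close>

lemma effects_eq_0: "q \<in> effects M \<Longrightarrow> (\<And>x. quad q x \<le> 0) \<Longrightarrow> q = 0"
proof (rule blinfun_eqI)
  fix x assume q: "q \<in> effects M" "\<And>x. quad q x \<le> 0"
  have "(norm (q x))\<^sup>2 \<le> 0" using effects_norm_square_le[OF q(1), of x] q(2)[of x] by linarith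
  then show "blinfun_apply q x = blinfun_apply 0 x" by simp
qed

lemma sum_nonneg_0_le:
  fixes f :: "'i \<Rightarrow> real"
  assumes "finite F" "\<And>x. x \<in> F \<Longrightarrow> 0 \<le> f x" "sum f F \<le> 0" "x \<in> F"
  shows "f x = 0"
  using sum_nonneg_0[of F f x] sum_nonneg[of F f] assms by fastforce

lemma effects_quad_nonneg: "q \<in> effects M \<Longrightarrow> 0 \<le> quad q x"
  by (simp add: effects_def positive_op_nonneg)

text \<open>The set below has a largest element \<open>c\<close>, so it is the order interval \<open>[0, c]\<close>.\<close>

lemma closedin_effects_vanishing:
  assumes F: "finite F"
  shows "closedin W {q \<in> effects M. \<forall>x\<in>F. quad q x = 0}" (is "closedin W ?D")
proof -
  \<comment> \<open>Every effect in the set occurs with arbitrarily large weight, so the errors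
    \<open>(norm x)\<^sup>2 / l\<close> disappear in the limit; the weighted sums over
    \<open>F\<close> remain 0.\<close>
  define G where "G = {(q, real (Suc n)) | q n. q \<in> ?D}"
  have "\<exists>c\<in>effects M. (\<Sum>x\<in>F. quad c x) \<le> 0 \<and>
    (\<forall>a l. (a, l) \<in> G \<longrightarrow> (\<forall>x. quad a x \<le> quad c x + (norm x)\<^sup>2 / l))"
  proof (rule effects_common_bound[OF _ F])
    show "a \<in> effects M \<and> l > 0" if "(a, l) \<in> G" for a l using that by (auto simp: G_def)
    show "(\<Sum>(a, l)\<in>G0. \<Sum>x\<in>F. l * quad a x) \<le> 0" if "G0 \<subseteq> G" for G0
      by (rule sum_nonpos) (use that in \<open>fastforce simp: G_def\<close>)
  qed
  then obtain c where c: "c \<in> effects M" "(\<Sum>x\<in>F. quad c x) \<le> 0"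
    and b: "\<And>q n x. q \<in> ?D \<Longrightarrow> quad q x \<le> quad c x + (norm x)\<^sup>2 / real (Suc n)"
    unfolding G_def by blast
  have c0: "quad c x = 0" if "x \<in> F" for x
    using sum_nonneg_0_le[OF F _ c(2) that] effects_quad_nonneg[OF c(1)] by blast
  have qc: "quad q x \<le> quad c x" if "q \<in> ?D" for q x
  proof (rule LIMSEQ_le_const)
    have "(\<lambda>n. quad c x + (norm x)\<^sup>2 * inverse (real (Suc n))) \<longlonglongrightarrow> quad c x + (norm x)\<^sup>2 * 0"
      by (intro tendsto_intros LIMSEQ_inverse_real_of_nat)
    then show "(\<lambda>n. quad c x + (norm x)\<^sup>2 / real (Suc n)) \<longlonglongrightarrow> quad c x" by (simp add: divide_inverse)
  qed (use b[OF that] in blast)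
  have "?D = {q \<in> effects M. \<forall>x. quad q x \<le> quad c x + 0 * (norm x)\<^sup>2}"
  proof (intro subset_antisym subsetI)
    fix q assume "q \<in> {q \<in> effects M. \<forall>x. quad q x \<le> quad c x + 0 * (norm x)\<^sup>2}"
    then have q: "q \<in> effects M" "\<And>x. quad q x \<le> quad c x" by auto
    have "quad q x = 0" if "x \<in> F" for x
      using q(2)[of x] c0[OF that] effects_quad_nonneg[OF q(1), of x] by linarith
    then show "q \<in> ?D" using q(1) by blast
  qed (use qc in auto)
  then show ?thesis using closedin_effects_le[OF c(1), of 0] by simp
qed

lemma closedin_Re_ge: "W_linear \<psi> \<Longrightarrow> closedin W {q \<in> topspace W. Re (\<psi> q) \<in> {e..}}"
  by (intro closedin_euclidean_preimage continuous_map_euclidean_compose[where h = Re]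
      W_linear_continuous continuous_intros) auto

text \<open>Otherwise the closed sets \<open>D F\<close> have the finite intersection property. A
  common point has zero quadratic form, so it is 0, yet \<psi> is at least \<open>e\<close>
  there.\<close>

lemma W_positive_small_on_vanishing:
  assumes p: "W_positive \<psi> s" and e: "e > 0"
  shows "\<exists>F. finite F \<and> (\<forall>q\<in>effects M. (\<forall>x\<in>F. quad q x = 0) \<longrightarrow> Re (\<psi> q) < e)"
proof (rule ccontr)
  assume neg: "\<not> ?thesis"
  have f: "W_linear \<psi>" using p by (simp add: W_positive_def)
  define D where "D F = {q \<in> effects M. \<forall>x\<in>F. quad q x = 0} \<inter> {q \<in> topspace W. Re (\<psi> q) \<in> {e..}}" for F
  have ne: "D F \<noteq> {}" if "finite F" for F
  proof -
    have "\<not> (\<forall>q\<in>effects M. (\<forall>x\<in>F. quad q x = 0) \<longrightarrow> Re (\<psi> q) < e)"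
      by (rule notI) (use neg that in \<open>iprover\<close>)
    then obtain q where "q \<in> effects M" "\<forall>x\<in>F. quad q x = 0" "\<not> Re (\<psi> q) < e" by blast
    then show ?thesis by (auto simp: D_def topspace_W effects_mem not_less)
  qed
  have "effects M \<inter> \<Inter>(D ` {F. finite F}) \<noteq> {}"
  proof (rule compactin_effects[unfolded compactin_fip, THEN conjunct2, rule_format], intro conjI ballI allI impI)
    fix C assume "C \<in> D ` {F. finite F}"
    then show "closedin W C" unfolding D_def
      using closedin_effects_vanishing closedin_Re_ge[OF f] by blast
  next
    fix \<F> assume "finite \<F> \<and> \<F> \<subseteq> D ` {F. finite F}"
    then obtain \<G> where G: "\<G> \<subseteq> {F. finite F}" "finite \<G>" "\<F> = D ` \<G>" using finite_subset_image by metis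
    then have "D (\<Union>\<G>) \<noteq> {}" by (intro ne) auto
    moreover have "D (\<Union>\<G>) \<subseteq> effects M \<inter> \<Inter>\<F>" by (auto simp: D_def G(3))
    ultimately show "effects M \<inter> \<Inter>\<F> \<noteq> {}" by blast
  qed
  then obtain q where q: "q \<in> effects M" "\<And>F. finite F \<Longrightarrow> q \<in> D F" by blast
  have "quad q x \<le> 0" for x using q(2)[of "{x}"] by (simp add: D_def)
  then have "q = 0" by (rule effects_eq_0[OF q(1)])
  moreover have "e \<le> Re (\<psi> q)" using q(2)[of "{}"] by (simp add: D_def)
  ultimately show False using e W_linear_zero[OF f] by simp
qed

lemma sum_half_powers_le: "finite I \<Longrightarrow> I \<subseteq> {K..} \<Longrightarrow> (\<Sum>k\<in>I. (1/2::real) ^ k) \<le> 2 * (1/2) ^ K"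
proof -
  assume I: "finite I" "I \<subseteq> {K..}"
  have tail: "(\<Sum>k\<in>{K..<K + n}. (1/2::real) ^ k) = 2 * (1/2) ^ K - 2 * (1/2) ^ (K + n)" for n
    by (induction n) auto
  obtain n where "\<And>k. k \<in> I \<Longrightarrow> k \<le> n" using I(1) by (meson Max_ge)
  then have "I \<subseteq> {K..<K + Suc n}" using I(2) by fastforce
  then have "(\<Sum>k\<in>I. (1/2::real) ^ k) \<le> (\<Sum>k\<in>{K..<K + Suc n}. (1/2::real) ^ k)"
    by (intro sum_mono2) auto
  moreover have "(1/2::real) ^ (K + Suc n) > 0" by simp
  ultimately show ?thesis unfolding tail by linarith
qed

text \<open>Otherwise a sequence of effects would tend rapidly to \<open>0\<close> on \<open>F\<close> with \<open>\<psi>\<close> bounded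
  below. Its tails lie below effects \<open>c K\<close> that tend to \<open>0\<close> on \<open>F\<close>, so its weak-star cluster
  points vanish on \<open>F\<close>.\<close>

lemma W_positive_small:
  assumes p: "W_positive \<psi> s" and e: "e > 0"
  shows "\<exists>F d. finite F \<and> d > 0 \<and> (\<forall>q\<in>effects M. (\<Sum>x\<in>F. quad q x) \<le> d \<longrightarrow> Re (\<psi> q) \<le> e)"
proof -
  have f: "W_linear \<psi>" using p by (simp add: W_positive_def)
  obtain F where F: "finite F" "\<And>q. q \<in> effects M \<Longrightarrow> \<forall>x\<in>F. quad q x = 0 \<Longrightarrow> Re (\<psi> q) < e"
    using W_positive_small_on_vanishing[OF p e] by blast
  have "\<exists>d>0. \<forall>q\<in>effects M. (\<Sum>x\<in>F. quad q x) \<le> d \<longrightarrow> Re (\<psi> q) \<le> e"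
  proof (rule ccontr)
    assume neg: "\<not> ?thesis"
    have "\<exists>q\<in>effects M. (\<Sum>x\<in>F. quad q x) \<le> (1/4) ^ k \<and> e \<le> Re (\<psi> q)" for k :: nat
    proof -
      have "(1/4 :: real) ^ k > 0" by simp
      then show ?thesis using neg by (meson less_imp_le not_le)
    qed
    then obtain a where a: "\<And>k::nat. a k \<in> effects M" "\<And>k. (\<Sum>x\<in>F. quad (a k) x) \<le> (1/4) ^ k"
      "\<And>k. e \<le> Re (\<psi> (a k))" by metis
    have bound: "\<exists>c\<in>effects M. (\<Sum>x\<in>F. quad c x) \<le> 2 * (1/2) ^ K \<and>
        (\<forall>k\<ge>K. \<forall>x. quad (a k) x \<le> quad c x + (1/2) ^ k * (norm x)\<^sup>2)" for K
    proof -
      \<comment> \<open>Weights \<open>2 ^ k\<close> against sums of size \<open>(1/4) ^ k\<close>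
        leave the summable \<open>(1/2) ^ k\<close>, while the errors
        \<open>(norm x)\<^sup>2 / 2 ^ k\<close> still tend to 0.\<close>
      define g where "g k = (a k, (2::real) ^ k)" for k
      have inj: "inj_on g I" for I by (rule inj_onI) (simp add: g_def)
      have "\<exists>c\<in>effects M. (\<Sum>x\<in>F. quad c x) \<le> 2 * (1/2) ^ K \<and>
        (\<forall>b l. (b, l) \<in> g ` {K..} \<longrightarrow> (\<forall>x. quad b x \<le> quad c x + (norm x)\<^sup>2 / l))"
      proof (rule effects_common_bound[OF _ F(1)])
        show "b \<in> effects M \<and> l > 0" if "(b, l) \<in> g ` {K..}" for b l using that a(1) by (auto simp: g_def)
        fix G0 assume "finite G0" "G0 \<subseteq> g ` {K..}"
        then obtain I where I: "I \<subseteq> {K..}" "finite I" "G0 = g ` I" using finite_subset_image by metis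
        have "(\<Sum>(b, l)\<in>G0. \<Sum>x\<in>F. l * quad b x) = (\<Sum>k\<in>I. 2 ^ k * (\<Sum>x\<in>F. quad (a k) x))"
          unfolding I(3) sum.reindex[OF inj] by (simp add: g_def sum_distrib_left)
        also have "\<dots> \<le> (\<Sum>k\<in>I. (1/2) ^ k)"
        proof (rule sum_mono)
          fix k
          have "2 ^ k * (\<Sum>x\<in>F. quad (a k) x) \<le> 2 ^ k * (1/4) ^ k" by (intro mult_left_mono a) simp
          also have "\<dots> = (1/2) ^ k" by (simp flip: power_mult_distrib)
          finally show "2 ^ k * (\<Sum>x\<in>F. quad (a k) x) \<le> (1/2) ^ k" .
        qed
        also have "\<dots> \<le> 2 * (1/2) ^ K" by (rule sum_half_powers_le[OF I(2,1)])
        finally show "(\<Sum>(b, l)\<in>G0. \<Sum>x\<in>F. l * quad b x) \<le> 2 * (1/2) ^ K" .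
      qed
      then obtain c where c: "c \<in> effects M" "(\<Sum>x\<in>F. quad c x) \<le> 2 * (1/2) ^ K"
        "\<And>k x. k \<ge> K \<Longrightarrow> quad (a k) x \<le> quad c x + (norm x)\<^sup>2 / 2 ^ k"
        unfolding g_def by blast
      then show ?thesis by (intro bexI[of _ c]) (auto simp: power_divide)
    qed
    define T where "T K = W closure_of (a ` {K..})" for K
    have "effects M \<inter> \<Inter>(range T) \<noteq> {}"
    proof (rule compactin_effects[unfolded compactin_fip, THEN conjunct2, rule_format], intro conjI ballI allI impI)
      show "closedin W C" if "C \<in> range T" for C using that by (auto simp: T_def)
      fix \<F> assume "finite \<F> \<and> \<F> \<subseteq> range T"
      then obtain I where I: "finite I" "\<F> = T ` I" by (metis finite_subset_image)
      then obtain n where n: "\<And>k. k \<in> I \<Longrightarrow> k \<le> n" by (meson Max_ge)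
      have "a n \<in> T k" if "k \<in> I" for k
      proof -
        have "a ` {k..} \<subseteq> T k" unfolding T_def
          by (rule closure_of_subset) (use a(1) in \<open>auto simp: topspace_W effects_mem\<close>)
        then show ?thesis using n[OF that] by auto
      qed
      then show "effects M \<inter> \<Inter>\<F> \<noteq> {}" using a(1)[of n] I by blast
    qed
    then obtain q where q: "q \<in> effects M" "\<And>K. q \<in> T K" by blast
    have inT: "q \<in> C" if "closedin W C" "\<And>k. k \<ge> K \<Longrightarrow> a k \<in> C" for C K
    proof -
      have "T K \<subseteq> C" unfolding T_def by (rule closure_of_minimal[OF _ that(1)]) (use that(2) in auto)
      then show ?thesis using q(2) by blast
    qed
    have "q \<in> {q \<in> topspace W. Re (\<psi> q) \<in> {e..}}"
      by (rule inT[OF closedin_Re_ge[OF f]]) (use a in \<open>auto simp: topspace_W effects_mem\<close>)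
    then have ge: "e \<le> Re (\<psi> q)" by simp
    have small: "(\<Sum>x\<in>F. quad q x) \<le> 2 * (1/2) ^ K" for K
    proof -
      obtain c where c: "c \<in> effects M" "(\<Sum>x\<in>F. quad c x) \<le> 2 * (1/2) ^ K"
        "\<And>k x. k \<ge> K \<Longrightarrow> quad (a k) x \<le> quad c x + (1/2) ^ k * (norm x)\<^sup>2" using bound[of K] by blast
      \<comment> \<open>For fixed \<open>K\<close> the terms from \<open>m\<close> on satisfy this
        closed condition, hence so does the cluster point \<open>q\<close>. Then \<open>m\<close>
        tends to infinity, and \<open>K\<close> only afterwards.\<close>
      have m: "quad q x \<le> quad c x + (1/2) ^ m * (norm x)\<^sup>2" if m: "m \<ge> K" for m x
      proof -
        let ?S = "{q \<in> effects M. \<forall>x. quad q x \<le> quad c x + (1/2) ^ m * (norm x)\<^sup>2}"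
        have "q \<in> ?S"
        proof (rule inT[where K = m])
          show "closedin W ?S"
            by (rule closedin_effects_le[OF c(1)]) (auto intro: power_le_one)
          fix k assume k: "k \<ge> m"
          have "quad (a k) x \<le> quad c x + (1/2) ^ m * (norm x)\<^sup>2" for x
          proof -
            have "(1/2::real) ^ k * (norm x)\<^sup>2 \<le> (1/2) ^ m * (norm x)\<^sup>2"
              using k by (intro mult_right_mono power_decreasing) auto
            then show ?thesis using c(3)[of k x] k m by linarith
          qed
          then show "a k \<in> ?S" using a(1) by blast
        qed
        then show ?thesis by blast
      qed
      have "quad q x \<le> quad c x" for x
      proof (rule LIMSEQ_le_const)
        have "(\<lambda>m. quad c x + (1/2) ^ m * (norm x)\<^sup>2) \<longlonglongrightarrow> quad c x + 0 * (norm x)\<^sup>2"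
          by (intro tendsto_intros LIMSEQ_power_zero) simp
        then show "(\<lambda>m. quad c x + (1/2) ^ m * (norm x)\<^sup>2) \<longlonglongrightarrow> quad c x" by simp
      qed (use m in blast)
      then have "(\<Sum>x\<in>F. quad q x) \<le> (\<Sum>x\<in>F. quad c x)" by (intro sum_mono)
      then show ?thesis using c(2) by linarith
    qed
    have z: "(\<Sum>x\<in>F. quad q x) \<le> 0"
    proof (rule LIMSEQ_le_const)
      have "(\<lambda>K. 2 * (1/2::real) ^ K) \<longlonglongrightarrow> 2 * 0" by (intro tendsto_intros LIMSEQ_power_zero) simp
      then show "(\<lambda>K. 2 * (1/2::real) ^ K) \<longlonglongrightarrow> 0" by simp
    qed (use small in blast)
    have "\<forall>x\<in>F. quad q x = 0"
      by (intro ballI sum_nonneg_0_le[OF F(1) effects_quad_nonneg[OF q(1)] z])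
    then show False using F(2)[OF q(1)] ge by simp
  qed
  then show ?thesis using F(1) by blast
qed

end

section \<open>From strong bounds to vector functionals\<close>

context vn_algebra
begin

interpretation BM: complex_banach_space op_scale M norm by (rule complex_banach_space_M)

text \<open>The bound makes \<open>h a\<close> depend only on \<open>a x\<close>, so
  \<open>h\<close> descends to the orbit of \<open>x\<close>, a subspace that need not be closed;
  Riesz on it supplies \<open>y\<close>.\<close>

lemma functional_on_orbit:
  assumes h: "BM.linear_functional h"
    and le: "\<And>a. a \<in> M \<Longrightarrow> cmod (h a) \<le> C * norm (a x)"
  shows "\<exists>y. \<forall>a\<in>M. h a = cinner (a x) y"
proof -
  have hadd: "h (a + b) = h a + h b" if "a \<in> M" "b \<in> M" for a b
    using h that by (auto simp: BM.linear_functional_def)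
  have hsc: "h (op_scale c a) = c * h a" if "a \<in> M" for a c
    using h that by (auto simp: BM.linear_functional_def)
  define g where "g w = h (SOME a. a \<in> M \<and> blinfun_apply a x = w)" for w
  have g: "g (a x) = h a" if a: "a \<in> M" for a
  proof -
    define b where "b = (SOME b. b \<in> M \<and> blinfun_apply b x = a x)"
    have b: "b \<in> M \<and> blinfun_apply b x = a x" unfolding b_def by (rule someI[where x = a]) (use a in simp)
    have "cmod (h (a + op_scale (-1) b)) \<le> C * norm ((a + op_scale (-1) b) x)"
      by (rule le) (use a b in auto)
    also have "(a + op_scale (-1) b) x = 0" using b by (simp only: blinfun.add_left op_scale_apply scaleC_minus1) simp
    finally have "h a = h b" using hadd[OF a scale_mem, of b "-1"] hsc[of b "-1"] b by simp
    then show ?thesis by (simp add: g_def b_def)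
  qed
  define orb where "orb = (\<lambda>a. blinfun_apply a x) ` M"
  have "\<exists>y. \<forall>w\<in>orb. g w = cinner w y"
  proof (rule riesz_representation_on)
    show "0 \<in> orb" unfolding orb_def by (rule image_eqI[of _ _ 0]) (auto simp: zero_mem)
    fix u v assume "u \<in> orb"
    then obtain a where a: "a \<in> M" "u = a x" by (auto simp: orb_def)
    have s: "c *\<^sub>C u = op_scale c a x" for c using a by simp
    show "c *\<^sub>C u \<in> orb" for c unfolding s orb_def by (rule imageI[OF scale_mem[OF a(1)]])
    show "g (c *\<^sub>C u) = c * g u" for c unfolding s unfolding a g[OF scale_mem[OF a(1)]] g[OF a(1)] hsc[OF a(1)] ..
    show "cmod (g u) \<le> C * norm u" using le a g by simp
    assume "v \<in> orb"
    then obtain b where b: "b \<in> M" "v = b x" by (auto simp: orb_def)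
    have p: "u + v = (a + b) x" using a b by (simp add: blinfun.add_left)
    show "u + v \<in> orb" unfolding p orb_def by (rule imageI[OF add_mem[OF a(1) b(1)]])
    show "g (u + v) = g u + g v"
      unfolding p unfolding a b g[OF add_mem[OF a(1) b(1)]] g[OF a(1)] g[OF b(1)] hadd[OF a(1) b(1)] ..
  qed
  then obtain y where y: "\<And>w. w \<in> orb \<Longrightarrow> g w = cinner w y" by blast
  have "h a = cinner (a x) y" if a: "a \<in> M" for a
    using y[of "a x"] a g[OF a] by (auto simp: orb_def)
  then show ?thesis by blast
qed

text \<open>Induction on \<open>F\<close>: \<open>functional_split\<close> detaches the part
  controlled by one vector \<open>x\<close>, which \<open>functional_on_orbit\<close> turns into a
  vector functional. What remains at the end is controlled by \<open>e * norm a\<close>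
  alone.\<close>

lemma strong_bound_approx:
  assumes F: "finite F" and e: "0 \<le> e" and C: "0 \<le> C"
    and f: "BM.linear_functional f"
    and le: "\<And>a. a \<in> M \<Longrightarrow> cmod (f a) \<le> e * norm a + C * (\<Sum>x\<in>F. norm (a x))"
  shows "\<exists>ps. \<forall>a\<in>M. cmod (f a - vsum ps a) \<le> e * norm a"
  using F f le
proof (induction F arbitrary: f rule: finite_induct)
  case empty
  then show ?case by (intro exI[of _ "[]"]) (auto simp: vsum_def)
next
  case (insert x F)
  define p where "p a = e * norm a + C * (\<Sum>x\<in>F. norm (a x))" for a :: "'h \<Rightarrow>\<^sub>L 'h"
  define q where "q a = C * norm (a x)" for a :: "'h \<Rightarrow>\<^sub>L 'h"
  have p: "BM.seminorm p"
    unfolding BM.seminorm_def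
  proof (intro conjI ballI allI)
    fix a b :: "'h \<Rightarrow>\<^sub>L 'h"
    have "(\<Sum>x\<in>F. norm (blinfun_apply (a + b) x)) \<le> (\<Sum>x\<in>F. norm (a x) + norm (b x))"
      by (intro sum_mono) (simp add: blinfun.add_left norm_triangle_ineq)
    then have "C * (\<Sum>x\<in>F. norm (blinfun_apply (a + b) x))
        \<le> C * (\<Sum>x\<in>F. norm (a x)) + C * (\<Sum>x\<in>F. norm (b x))"
      using C by (simp add: sum.distrib mult_left_mono flip: distrib_left)
    moreover have "e * norm (a + b) \<le> e * norm a + e * norm b"
      using e by (simp add: norm_triangle_ineq mult_left_mono flip: distrib_left)
    ultimately show "p (a + b) \<le> p a + p b" by (simp add: p_def)
    show "p (op_scale c a) = cmod c * p a" for c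
      by (simp add: p_def norm_op_scale norm_scaleC sum_distrib_left algebra_simps)
  qed
  have q: "BM.seminorm q"
    unfolding BM.seminorm_def
  proof (intro conjI ballI allI)
    fix a b :: "'h \<Rightarrow>\<^sub>L 'h"
    show "q (a + b) \<le> q a + q b"
      using C by (simp add: q_def blinfun.add_left norm_triangle_ineq mult_left_mono flip: distrib_left)
    show "q (op_scale c a) = cmod c * q a" for c by (simp add: q_def norm_scaleC)
  qed
  have "cmod (f a) \<le> p a + q a" if "a \<in> M" for a
    using insert.prems(2)[OF that] insert.hyps by (simp add: p_def q_def algebra_simps)
  from BM.functional_split[OF insert.prems(1) p q this] obtain g h
    where g: "BM.linear_functional g" "\<And>a. a \<in> M \<Longrightarrow> cmod (g a) \<le> p a"
      and h: "BM.linear_functional h" "\<And>a. a \<in> M \<Longrightarrow> cmod (h a) \<le> q a"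
      and gh: "\<And>a. a \<in> M \<Longrightarrow> f a = g a + h a" by blast
  obtain ps where ps: "\<And>a. a \<in> M \<Longrightarrow> cmod (g a - vsum ps a) \<le> e * norm a"
    using insert.IH[OF g(1) g(2)[unfolded p_def]] by blast
  obtain y where y: "\<And>a. a \<in> M \<Longrightarrow> h a = cinner (a x) y"
    using functional_on_orbit[OF h(1) h(2)[unfolded q_def]] by blast
  have "f a - vsum ((x, y) # ps) a = g a - vsum ps a" if "a \<in> M" for a
    using that by (simp add: gh y vsum_def)
  then show ?case using ps by (intro exI[of _ "(x, y) # ps"]) auto
qed

end

lemma sum_squares_le_square_sum:
  fixes f :: "'i \<Rightarrow> real"
  assumes "finite F" "\<And>x. 0 \<le> f x"
  shows "(\<Sum>x\<in>F. (f x)\<^sup>2) \<le> (\<Sum>x\<in>F. f x)\<^sup>2"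
  using assms(1)
proof (induction F rule: finite_induct)
  case (insert x F)
  have "0 \<le> 2 * f x * (\<Sum>x\<in>F. f x)" using assms(2) by (simp add: sum_nonneg)
  then show ?case using insert by (simp add: power2_sum)
qed simp

context vn_predual_sep
begin

interpretation BM: complex_banach_space op_scale M norm by (rule complex_banach_space_M)

interpretation P: complex_banach_space "\<lambda>c f x. c * f x" normal_predual "dual_norm M norm"
  by (rule complex_banach_space_normal_predual)

lemma W_linear_linear:
  assumes "W_linear \<phi>" shows "BM.linear_functional \<phi>"
  using assms by (simp add: BM.linear_functional_def W_linear_def)

text \<open>Smallness below \<open>d\<close>, together with the crude bound \<open>s\<close> above
  it, gives an affine bound for \<psi> on effects in terms of the sum of the forms over
  \<open>F\<close>. Applied to \<open>op_adjoint a o\<^sub>L a\<close> and combined with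
  Cauchy-Schwarz, it bounds \<psi> itself.\<close>

lemma W_positive_strong_bound:
  assumes p: "W_positive \<psi> s" and e: "e > 0"
  shows "\<exists>F C. finite F \<and> 0 \<le> C \<and> (\<forall>a\<in>M. cmod (\<psi> a) \<le> e * norm a + C * (\<Sum>x\<in>F. norm (a x)))"
proof -
  have f: "W_linear \<psi>" and s: "0 \<le> s" using p by (auto simp: W_positive_def)
  \<comment> \<open>Cauchy-Schwarz multiplies by \<open>s\<close>, and \<open>s * e'\<close> has to
    stay below \<open>e\<^sup>2\<close>; the \<open>+ 1\<close> covers \<open>s = 0\<close>.\<close>
  define e' where "e' = e\<^sup>2 / (s + 1)"
  have e': "e' > 0" "s * e' \<le> e\<^sup>2" using e s by (auto simp: e'_def field_simps)
  obtain F d where F: "finite F" "d > 0"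
    and small: "\<And>q. q \<in> effects M \<Longrightarrow> (\<Sum>x\<in>F. quad q x) \<le> d \<Longrightarrow> Re (\<psi> q) \<le> e'"
    using W_positive_small[OF p e'(1)] by blast
  have lin: "Re (\<psi> q) \<le> e' + s / d * (\<Sum>x\<in>F. quad q x)" if q: "q \<in> effects M" for q
  proof (cases "(\<Sum>x\<in>F. quad q x) \<le> d")
    case True
    have "0 \<le> s / d * (\<Sum>x\<in>F. quad q x)"
      using s F effects_quad_nonneg[OF q] by (intro mult_nonneg_nonneg sum_nonneg) auto
    then show ?thesis using small[OF q True] by linarith
  next
    case False
    then have "s / d * d \<le> s / d * (\<Sum>x\<in>F. quad q x)" using s F by (intro mult_left_mono) auto
    then show ?thesis using W_positive_effects(3)[OF p q] e' F by simp
  qed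
  \<comment> \<open>The slope \<open>s / d\<close> times the Cauchy-Schwarz factor \<open>s\<close>
    is \<open>C\<^sup>2\<close>.\<close>
  define C where "C = s / sqrt d"
  have C: "0 \<le> C" "C\<^sup>2 = s * (s / d)" using s F by (auto simp: C_def power_divide power2_eq_square)
  have ball: "cmod (\<psi> a) \<le> e + C * (\<Sum>x\<in>F. norm (a x))" if a: "a \<in> M" "norm a \<le> 1" for a
  proof -
    define S where "S = (\<Sum>x\<in>F. norm (a x))"
    have S: "S \<ge> 0" unfolding S_def by (simp add: sum_nonneg)
    have qa: "quad (op_adjoint a o\<^sub>L a) x = (norm (a x))\<^sup>2" for x
      using quad_adj_comp[OF a(1), of x] by (metis Re_complex_of_real)
    have "(cmod (\<psi> a))\<^sup>2 \<le> Re (\<psi> (op_adjoint a o\<^sub>L a)) * s" by (rule W_positive_cauchy_schwarz[OF p a(1)])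
    also have "\<dots> \<le> (e' + s / d * (\<Sum>x\<in>F. (norm (a x))\<^sup>2)) * s"
      using lin[OF adj_comp_effect[OF a]] s unfolding qa by (rule mult_right_mono)
    also have "\<dots> \<le> (e' + s / d * S\<^sup>2) * s"
      using s F sum_squares_le_square_sum[OF F(1), of "\<lambda>x. norm (a x)"]
      by (intro mult_right_mono add_left_mono mult_left_mono) (auto simp: S_def)
    also have "\<dots> = s * e' + C\<^sup>2 * S\<^sup>2" by (simp add: C algebra_simps)
    also have "\<dots> \<le> e\<^sup>2 + C\<^sup>2 * S\<^sup>2" using e' by simp
    also have "\<dots> \<le> (e + C * S)\<^sup>2" using e C(1) S by (simp add: power2_sum power_mult_distrib)
    finally show ?thesis unfolding S_def[symmetric] by (rule power2_le_imp_le) (use e C(1) S in simp)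
  qed
  have "cmod (\<psi> a) \<le> e * norm a + C * (\<Sum>x\<in>F. norm (a x))" if a: "a \<in> M" for a
  proof (cases "a = 0")
    case False
    let ?c = "complex_of_real (inverse (norm a))"
    have "cmod (\<psi> (op_scale ?c a)) \<le> e + C * (\<Sum>x\<in>F. norm (blinfun_apply (op_scale ?c a) x))"
      by (rule ball) (use a False in \<open>auto simp: norm_op_scale norm_inverse\<close>)
    also have "(\<Sum>x\<in>F. norm (blinfun_apply (op_scale ?c a) x)) = inverse (norm a) * (\<Sum>x\<in>F. norm (a x))"
      by (simp add: norm_scaleC norm_inverse norm_divide sum_distrib_left)
    also have "cmod (\<psi> (op_scale ?c a)) = inverse (norm a) * cmod (\<psi> a)"
      by (simp add: W_linear_scale[OF f a] norm_mult norm_inverse norm_divide)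
    finally have le: "inverse (norm a) * cmod (\<psi> a)
        \<le> e + C * (inverse (norm a) * (\<Sum>x\<in>F. norm (a x)))" .
    have "cmod (\<psi> a) = norm a * (inverse (norm a) * cmod (\<psi> a))" using False by simp
    also have "\<dots> \<le> norm a * (e + C * (inverse (norm a) * (\<Sum>x\<in>F. norm (a x))))"
      by (rule mult_left_mono[OF le]) simp
    also have "\<dots> = e * norm a + C * (\<Sum>x\<in>F. norm (a x))" using False by (simp add: field_simps)
    finally show ?thesis .
  qed (simp add: W_linear_zero[OF f])
  then show ?thesis using F(1) C(1) by blast
qed

text \<open>The positive part of the polar decomposition is approximated by vector functionals; the
  contraction \<open>a\<close> moves onto their second vectors without enlarging the error.\<close>

theorem W_linear_normal:
  assumes f: "W_linear \<phi>"
  shows "(\<lambda>a. if a \<in> M then \<phi> a else 0) \<in> normal_predual"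
proof -
  obtain \<psi> s a where p: "W_positive \<psi> s" and a: "a \<in> M" "norm a \<le> 1"
    and eq: "\<forall>b\<in>M. \<phi> b = \<psi> (op_adjoint a o\<^sub>L b)" by (rule W_linear_polar[OF f])
  obtain a' K where K: "\<forall>b\<in>M. cmod (\<phi> b) \<le> K * norm b"
    by (rule W_linear_attains_norm[OF f])
  have d: "(\<lambda>a. if a \<in> M then \<phi> a else 0) \<in> dual_space op_scale M norm"
    by (rule mem_dual_spaceI[where K = K])
      (use K in \<open>auto simp: W_linear_add[OF f] W_linear_scale[OF f] add_mem scale_mem\<close>)
  have "\<exists>ps. \<forall>b\<in>M. cmod (\<phi> b - vsum ps b) \<le> e * norm b" if e: "e > 0" for e
  proof -
    obtain F C where F: "finite F" "0 \<le> C"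
      and le: "\<And>a. a \<in> M \<Longrightarrow> cmod (\<psi> a) \<le> e * norm a + C * (\<Sum>x\<in>F. norm (a x))"
      using W_positive_strong_bound[OF p e] by blast
    have "W_linear \<psi>" using p by (simp add: W_positive_def)
    from strong_bound_approx[OF F(1) less_imp_le[OF e] F(2) W_linear_linear[OF this] le]
    obtain ps where ps: "\<And>a. a \<in> M \<Longrightarrow> cmod (\<psi> a - vsum ps a) \<le> e * norm a" by blast
    have "cmod (\<phi> b - vsum (map (\<lambda>(x, y). (x, a y)) ps) b) \<le> e * norm b" if b: "b \<in> M" for b
    proof -
      have "cmod (\<psi> (op_adjoint a o\<^sub>L b) - vsum ps (op_adjoint a o\<^sub>L b)) \<le> e * norm (op_adjoint a o\<^sub>L b)"
        using a b by (intro ps) auto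
      also have "norm (op_adjoint a o\<^sub>L b) \<le> norm b"
        using norm_blinfun_compose[of "op_adjoint a" b] norm_adj[OF a(1)] mult_right_mono[OF a(2), of "norm b"]
        by simp
      finally show ?thesis using e b eq by (simp add: vsum_adj_comp[OF a(1) b])
    qed
    then show ?thesis by blast
  qed
  then show ?thesis using d by (simp add: normal_predual_def)
qed

section \<open>Identification of an arbitrary predual with the normal one\<close>

definition W_vector :: "'x \<Rightarrow> ('h \<Rightarrow>\<^sub>L 'h) \<Rightarrow> complex" where
  "W_vector x a = (if a \<in> M then j a x else 0)"

lemma W_linear_j: "x \<in> X \<Longrightarrow> W_linear (\<lambda>a. j a x)"
  by (simp add: W_linear_def j_add j_scale continuous_map_eval)

lemma W_vector_normal: "x \<in> X \<Longrightarrow> W_vector x \<in> normal_predual"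
  using W_linear_normal[OF W_linear_j] unfolding W_vector_def[abs_def] by blast

lemma W_vector_add: "x \<in> X \<Longrightarrow> y \<in> X \<Longrightarrow> W_vector (x + y) = W_vector x + W_vector y"
  using dual_space_add[OF j_dual] by (auto simp: W_vector_def fun_eq_iff)

lemma W_vector_scale: "x \<in> X \<Longrightarrow> W_vector (smul c x) = (\<lambda>a. c * W_vector x a)"
  using dual_space_scale[OF j_dual] by (auto simp: W_vector_def fun_eq_iff)

lemma W_vector_diff: "x \<in> X \<Longrightarrow> y \<in> X \<Longrightarrow> W_vector (x - y) = W_vector x - W_vector y"
  using W_vector_add[of "x - y" y] X_diff by (simp add: algebra_simps)

text \<open>The predual \<open>X\<close> separates \<open>M\<close>, the dual of the normal predual.\<close>

lemma W_vector_dense: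
  assumes f: "f \<in> normal_predual" and e: "e > 0"
  shows "\<exists>x\<in>X. dual_norm M norm (f - W_vector x) < e"
proof (rule ccontr)
  assume neg: "\<not> ?thesis"
  have w0: "W_vector 0 = 0" using W_vector_add[of 0 0] X_zero by simp
  have sub: "P.subspace (W_vector ` X)"
    unfolding P.subspace_def
  proof (intro conjI ballI allI)
    show "0 \<in> W_vector ` X" using w0 X_zero by force
    show "u + v \<in> W_vector ` X" if "u \<in> W_vector ` X" "v \<in> W_vector ` X" for u v
      using that X_add by (auto simp flip: W_vector_add)
    show "(\<lambda>x. c * u x) \<in> W_vector ` X" if "u \<in> W_vector ` X" for c u
      using that X_scale by (auto simp flip: W_vector_scale)
  qed
  have "e \<le> dual_norm M norm (f + v)" if "v \<in> W_vector ` X" for v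
  proof -
    obtain x where x: "x \<in> X" "v = W_vector x" using \<open>v \<in> W_vector ` X\<close> by blast
    have "f + v = f - W_vector (- x)" using W_vector_diff[OF X_zero x(1)] w0 by (simp add: x)
    then show ?thesis using neg X_neg[OF x(1)] by (metis not_less)
  qed
  from P.separate_from_subspace[OF sub _ f less_imp_le[OF e] this] obtain G
    where G: "G \<in> dual_space (\<lambda>c f x. c * f x) normal_predual (dual_norm M norm)"
      "\<And>v. v \<in> W_vector ` X \<Longrightarrow> G v = 0" "e \<le> Re (G f)"
    using W_vector_normal by blast
  \<comment> \<open>A functional vanishing on the image of \<open>X\<close> is evaluation at some
    \<open>T\<close> with \<open>j T = j 0\<close>; injectivity of \<open>j\<close> gives
    \<open>T = 0\<close>, against \<open>e \<le> Re (G f)\<close>.\<close>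
  obtain T where T: "T \<in> M" "evaluation T = G" using functional_on_normal_predual[OF G(1)] by blast
  have "j T x = j 0 x" for x
  proof (cases "x \<in> X")
    case True
    have "j T x = W_vector x T" using T(1) by (simp add: W_vector_def)
    also have "\<dots> = G (W_vector x)"
      unfolding T(2)[symmetric] using W_vector_normal[OF True] by (simp add: evaluation_def)
    also have "\<dots> = 0" using True by (intro G(2)) simp
    finally have "j T x = 0" .
    then show ?thesis using j_add[OF zero_mem zero_mem, of x] by simp
  next
    case False
    then show ?thesis using dual_space_outside[OF j_dual] T(1) zero_mem by metis
  qed
  then have "j T = j 0" by (rule ext)
  then have "T = 0" using j_bij T(1) zero_mem by (metis bij_betw_def inj_onD)
  then have "G f = f 0" using T f by (auto simp: evaluation_def)
  also have "f 0 = 0" using BM.dual_space_scale[OF normal_dual[OF f] zero_mem, of 0] by simp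
  finally show False using G(3) e by simp
qed

text \<open>A Hahn-Banach functional norming \<open>x\<close> is \<open>j a\<close> for some
  \<open>a\<close> in \<open>M\<close> of norm at most \<open>D\<close>, and \<open>a\<close> tests
  \<open>W_vector x\<close>.\<close>

lemma W_vector_bounded_below: "\<exists>D\<ge>0. \<forall>x\<in>X. N x \<le> D * dual_norm M norm (W_vector x)"
proof -
  obtain C D where D: "D > 0"
    "\<And>a r. a \<in> M \<Longrightarrow> 0 \<le> r \<Longrightarrow> (\<And>x. x \<in> X \<Longrightarrow> cmod (j a x) \<le> r * N x) \<Longrightarrow> norm a \<le> D * r"
    using j_bounds by metis
  have "N x \<le> D * dual_norm M norm (W_vector x)" if x: "x \<in> X" for x
  proof -
    obtain f where f: "f \<in> dual_space smul X N" "\<forall>y\<in>X. cmod (f y) \<le> N y" "N x \<le> cmod (f x)"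
      using norming_functional[OF x] by blast
    have "f \<in> j ` M" using f(1) j_bij by (simp add: bij_betw_def)
    then obtain a where a: "a \<in> M" "j a = f" by blast
    have "norm a \<le> D * 1" by (rule D(2)) (use a f in auto)
    moreover note wd = normal_dual[OF W_vector_normal[OF x]]
    moreover have "cmod (j a x) \<le> dual_norm M norm (W_vector x) * norm a"
      using BM.dual_norm_bound[OF wd a(1)] a(1) by (simp add: W_vector_def)
    ultimately show ?thesis
      using f(3) a(2) mult_left_mono[of "norm a" D "dual_norm M norm (W_vector x)"] BM.dual_norm_nonneg[OF wd]
      by (simp add: mult.commute)
  qed
  then show ?thesis using D(1) by (intro exI[of _ D]) auto
qed

text \<open>Approximants of \<open>f\<close> exist by density; the lower bound makes them Cauchy in
  \<open>X\<close>, whose completeness supplies the limit.\<close>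

lemma normal_eq_W_vector:
  assumes f: "f \<in> normal_predual"
  shows "\<exists>x\<in>X. \<forall>a\<in>M. f a = j a x"
proof -
  obtain D where D: "D \<ge> 0" "\<And>x. x \<in> X \<Longrightarrow> N x \<le> D * dual_norm M norm (W_vector x)"
    using W_vector_bounded_below by blast
  have "\<forall>n. \<exists>x\<in>X. dual_norm M norm (f - W_vector x) < inverse (real (Suc n))"
    using W_vector_dense[OF f] by simp
  then obtain x where x: "\<And>n. x n \<in> X" "\<And>n. dual_norm M norm (f - W_vector (x n)) < inverse (real (Suc n))"
    by metis
  note W = W_vector_normal[OF x(1)]
  have dist: "N (x m - x n) \<le> D * (inverse (real (Suc m)) + inverse (real (Suc n)))" for m n
  proof -
    have "dual_norm M norm (W_vector (x m - x n)) = dual_norm M norm ((f - W_vector (x n)) - (f - W_vector (x m)))"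
      by (simp add: W_vector_diff[OF x(1) x(1)])
    also have "\<dots> \<le> dual_norm M norm (f - W_vector (x n)) + dual_norm M norm (f - W_vector (x m))"
    proof -
      have neg: "(\<lambda>a. (-1) * (f - W_vector (x m)) a) = - (f - W_vector (x m))" by (auto simp: fun_eq_iff)
      have "dual_norm M norm (- (f - W_vector (x m))) = dual_norm M norm (f - W_vector (x m))"
        using P.norm_scale[OF P.X_diff[OF f W[of m]], of "-1"] unfolding neg by simp
      then show ?thesis
        using P.norm_triangle[OF P.X_diff[OF f W[of n]] P.X_neg[OF P.X_diff[OF f W[of m]]]] by simp
    qed
    also have "\<dots> \<le> inverse (real (Suc m)) + inverse (real (Suc n))" using x(2)[of m] x(2)[of n] by simp
    finally show ?thesis using D(2)[OF X_diff[OF x(1) x(1)], of m n] D(1) by (meson mult_left_mono order.trans)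
  qed
  have "\<exists>l\<in>X. (\<lambda>n. N (x n - l)) \<longlonglongrightarrow> 0"
  proof (rule complete[OF x(1)], intro allI impI)
    fix e :: real assume e: "e > 0"
    \<comment> \<open>The distances are then at most \<open>e * (D / (D + 1))\<close>, which is
      below \<open>e\<close> even if \<open>D = 0\<close>.\<close>
    obtain n0 where n0: "inverse (real (Suc n0)) < e / (2 * (D + 1))"
      using reals_Archimedean[of "e / (2 * (D + 1))"] e D(1) by auto
    have "N (x m - x n) < e" if "m \<ge> n0" "n \<ge> n0" for m n
    proof -
      have i: "inverse (real (Suc k)) < e / (2 * (D + 1))" if "k \<ge> n0" for k
      proof -
        have "inverse (real (Suc k)) \<le> inverse (real (Suc n0))" using that by (simp add: field_simps)
        then show ?thesis using n0 by linarith
      qed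
      have half: "D * (e / (2 * k) + e / (2 * k)) = e * (D / k)" for k by (simp add: field_simps)
      have "N (x m - x n) \<le> D * (e / (2 * (D + 1)) + e / (2 * (D + 1)))"
        using dist[of m n] i[OF that(1)] i[OF that(2)] D(1) by (meson add_mono less_imp_le mult_left_mono order.trans)
      also have "\<dots> < e * 1" unfolding half using e D(1) by (intro mult_strict_left_mono) auto
      finally show ?thesis by simp
    qed
    then show "\<exists>n0. \<forall>m\<ge>n0. \<forall>n\<ge>n0. N (x m - x n) < e" by blast
  qed
  then obtain l where l: "l \<in> X" "(\<lambda>n. N (x n - l)) \<longlonglongrightarrow> 0" by blast
  obtain C D' where C: "\<And>a y. a \<in> M \<Longrightarrow> y \<in> X \<Longrightarrow> cmod (j a y) \<le> C * norm a * N y"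
    using j_bounds by metis
  have "f a = j a l" if a: "a \<in> M" for a
  proof -
    have "cmod (f a - j a l) \<le> inverse (real (Suc n)) * norm a + C * norm a * N (x n - l)" for n
    proof -
      have "cmod ((f - W_vector (x n)) a) \<le> dual_norm M norm (f - W_vector (x n)) * norm a"
        by (rule BM.dual_norm_bound[OF normal_dual[OF P.X_diff[OF f W]] a])
      also have "\<dots> \<le> inverse (real (Suc n)) * norm a" using x(2)[of n] by (intro mult_right_mono) auto
      finally have 1: "cmod (f a - j a (x n)) \<le> inverse (real (Suc n)) * norm a" using a by (simp add: W_vector_def)
      have "j a (x n) = j a (x n - l) + j a l"
        using dual_space_add[OF j_dual[OF a] X_diff[OF x(1) l(1)] l(1)] by simp
      then have "cmod (j a (x n) - j a l) \<le> C * norm a * N (x n - l)"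
        using C[OF a X_diff[OF x(1) l(1)]] by simp
      then show ?thesis using 1 norm_triangle_ineq[of "f a - j a (x n)" "j a (x n) - j a l"] by simp
    qed
    moreover have "(\<lambda>n. inverse (real (Suc n)) * norm a + C * norm a * N (x n - l)) \<longlonglongrightarrow> 0 * norm a + C * norm a * 0"
      by (intro tendsto_intros l LIMSEQ_inverse_real_of_nat)
    ultimately have "cmod (f a - j a l) \<le> 0 * norm a + C * norm a * 0" by (intro LIMSEQ_le_const) auto
    then show ?thesis by simp
  qed
  then show ?thesis using l(1) by blast
qed

text \<open>Both topologies are initial for families of functionals that coincide on
  \<open>M\<close>, so the identity is continuous in both directions.\<close>

theorem W_eq_normal:
  "W = pullback_topology M evaluation (weak_star_on_dual (\<lambda>c f x. c * f x) normal_predual (dual_norm M norm))"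
proof -
  interpret nrm: vn_predual_sep M "\<lambda>c f x. c * f x" normal_predual "dual_norm M norm" evaluation
    by (rule normal_vn_predual_sep)
  have 1: "continuous_map nrm.W W (\<lambda>a. a)"
  proof (rule continuous_map_into_W)
    fix x assume x: "x \<in> X"
    have "continuous_map nrm.W euclidean (\<lambda>a. evaluation a (W_vector x))"
      by (rule nrm.continuous_map_eval[OF W_vector_normal[OF x]])
    then show "continuous_map nrm.W euclidean (\<lambda>a. j a x)"
      by (rule continuous_map_eq) (use W_vector_normal[OF x] in \<open>auto simp: nrm.topspace_W evaluation_def W_vector_def\<close>)
  qed (simp add: nrm.topspace_W)
  have 2: "continuous_map W nrm.W (\<lambda>a. a)"
  proof (rule nrm.continuous_map_into_W)
    fix f assume f: "f \<in> normal_predual"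
    then obtain x where x: "x \<in> X" "\<forall>a\<in>M. f a = j a x" using normal_eq_W_vector by blast
    show "continuous_map W euclidean (\<lambda>a. evaluation a f)"
      by (rule continuous_map_eq[OF continuous_map_eval[OF x(1)]]) (use x(2) f in \<open>auto simp: topspace_W evaluation_def\<close>)
  qed (simp add: topspace_W)
  have "openin W U \<longleftrightarrow> openin nrm.W U" for U
  proof
    assume U: "openin W U"
    then have "U \<subseteq> M" using openin_subset topspace_W by metis
    then have "{x \<in> topspace nrm.W. x \<in> U} = U" by (auto simp: nrm.topspace_W)
    then show "openin nrm.W U" using openin_continuous_map_preimage[OF 1 U] by simp
  next
    assume U: "openin nrm.W U"
    then have "U \<subseteq> M" using openin_subset nrm.topspace_W by metis
    then have "{x \<in> topspace W. x \<in> U} = U" by (auto simp: topspace_W)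
    then show "openin W U" using openin_continuous_map_preimage[OF 2 U] by simp
  qed
  then have "W = nrm.W" by (simp add: topology_eq)
  then show ?thesis by (simp add: nrm.W_def)
qed

end

text \<open>The witness is the normal (ultraweak) topology. A rival predual has elements of another
  type \<open>'x\<close>, but the comparison takes place between topologies on
  \<open>M\<close>.\<close>

theorem corollary5p3:
  fixes M :: "('h::complex_hilbert \<Rightarrow>\<^sub>L 'h) set"
  assumes "von_neumann_algebra M"
  shows "\<exists>T.
    (weak_star_topology TYPE(('h \<Rightarrow>\<^sub>L 'h) \<Rightarrow> complex) op_scale M norm T \<and>
     separately_continuous_mult M T) \<and>
    (\<forall>T'. weak_star_topology TYPE('x::ab_group_add) op_scale M norm T' \<and>
          separately_continuous_mult M T' \<longrightarrow> T' = T)"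
proof -
  interpret vn_algebra M by (rule vn_algebra.intro[OF assms])
  interpret nrm: vn_predual_sep M "\<lambda>c f x. c * f x" normal_predual "dual_norm M norm" evaluation
    by (rule normal_vn_predual_sep)
  show ?thesis
  proof (intro exI[of _ nrm.W] conjI allI impI)
    show "weak_star_topology TYPE(('h \<Rightarrow>\<^sub>L 'h) \<Rightarrow> complex) op_scale M norm nrm.W"
      unfolding weak_star_topology_def nrm.W_def
      using complex_banach_space_normal_predual nrm.iso by blast
    show "separately_continuous_mult M nrm.W" by (rule nrm.sep)
    fix T' assume T': "weak_star_topology TYPE('x) op_scale M norm T' \<and> separately_continuous_mult M T'"
    then obtain smul :: "complex \<Rightarrow> 'x \<Rightarrow> 'x" and X N j where
      X: "complex_banach_space smul X N" and
      j: "banach_isomorphism op_scale M norm (\<lambda>c f x. c * f x) (dual_space smul X N) (dual_norm X N) j" and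
      eq: "T' = pullback_topology M j (weak_star_on_dual smul X N)"
      unfolding weak_star_topology_def by blast
    interpret Y: vn_predual M smul X N j
      using vn_algebra_axioms X j by (intro vn_predual.intro vn_predual_axioms.intro)
    have eqW: "T' = Y.W" by (simp add: eq Y.W_def)
    interpret Y: vn_predual_sep M smul X N j
      by unfold_locales (use T' eqW in simp)
    show "T' = nrm.W" unfolding eqW Y.W_eq_normal nrm.W_def ..
  qed
qed

end
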